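(* Let $n>3$ be an odd integer. Then, modulo $[n]\Phi_n(q)^2$, $$\sum_{k=0}^{n-1}[8k-1]\frac{(q^{-1};q^4)_k^6(q^2;q^2)_{2k}}{(q^4;q^4)_k^6(q^{-1};q^2)_{2k}}q^{8k}\equiv\begin{cases}0, &\text{if }n\equiv 1\pmod{4},\\[5pt] A_n\dfrac{(q^2;q^4)_{(n+1)/4}^2}{(q^4;q^4)_{(n+1)/4}^2},&\text{if }n\equiv 3\pmod{4},\end{cases}$$ where $$A_n=q^{n+1}(q^n-2)[n]\frac{(1-q^{1-n})^3-q^{-n-2}(1+q)(1-q^2)^2(1-q^{2-n})}{(1-q^{3-n})(1-q^{1-n})^2}.$$
   Context: Here $q$ is treated as an indeterminate. The $q$-shifted factorial is $(x;q)_0=1$ and $(x;q)_k=(1-x)(1-xq)\cdots(1-xq^{k-1})$ for $k\ge 1$; thus $(x;q^d)_k=\prod_{j=0}^{k-1}(1-xq^{dj})$, and $(x;q^d)_k^s$ denotes the $s$-th power of $(x;q^d)_k$. For an integer $m$ (possibly negative), $[m]=(1-q^m)/(1-q)$ is the $q$-integer. $\Phi_n(q)=\prod_{1\le k\le n,\ \gcd(n,k)=1}(q-e^{2\pi i k/n})$ is the $n$-th cyclotomic polynomial in $q$. For rational functions $A,B$ in $q$ and a polynomial $P$ in $q$, $A\equiv B\pmod{P}$ means that the numerator of $A-B$, written in lowest terms, is divisible by $P$. *)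

theory Defs
  imports Complex_Main
    "HOL-Computational_Algebra.Computational_Algebra"
    "HOL-Computational_Algebra.Field_as_Ring"
begin

text \<open>
  Rational functions in the indeterminate \<open>q\<close> are elements of the fraction field of
  \<open>\<complex>[q]\<close>.
\<close>

type_synonym ratfun = "complex poly fract"

definition q :: ratfun where
  "q = to_fract [:0, 1:]"

definition qpoch :: "'a::comm_ring_1 \<Rightarrow> 'a \<Rightarrow> nat \<Rightarrow> 'a" where
  "qpoch x p k = (\<Prod>j<k. 1 - x * p ^ j)"

definition qint :: "int \<Rightarrow> ratfun" where
  "qint m = (1 - q powi m) / (1 - q)"

text \<open>
  For \<open>n \<ge> 0\<close> the \<open>q\<close>-integer is the polynomial \<open>1 + q + \<dots> + q^(n - 1)\<close>. This
  form is needed where \<open>[n]\<close> is part of a modulus; \<open>to_fract_qint_poly\<close> below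
  identifies it with \<open>qint n\<close>.
\<close>

definition qint_poly :: "nat \<Rightarrow> complex poly" where
  "qint_poly n = (\<Sum>i<n. [:0, 1:] ^ i)"

definition cyclotomic :: "nat \<Rightarrow> complex poly" where
  "cyclotomic n =
     (\<Prod>k | 1 \<le> k \<and> k \<le> n \<and> coprime n k.
        [:- exp (2 * complex_of_real pi * \<i> * of_nat k / of_nat n), 1:])"

text \<open>
  \<open>quot_of_fract\<close> returns numerator and denominator in lowest terms, the denominator
  being monic.
\<close>

definition ratfun_cong :: "ratfun \<Rightarrow> ratfun \<Rightarrow> complex poly \<Rightarrow> bool" where
  "ratfun_cong A B P \<longleftrightarrow> P dvd fst (quot_of_fract (A - B))"

lemma q_neq_1: "q \<noteq> 1"
  unfolding q_def to_fract_1[symmetric] to_fract_eq_iff by (simp add: one_pCons)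

lemma to_fract_power: "to_fract (x ^ n) = to_fract x ^ n"
  by (induction n) simp_all

lemma to_fract_sum: "to_fract (\<Sum>i\<in>I. f i) = (\<Sum>i\<in>I. to_fract (f i))"
  by (induction I rule: infinite_finite_induct) simp_all

lemma to_fract_qint_poly: "to_fract (qint_poly n) = qint (int n)"
proof -
  have "to_fract (qint_poly n) = (\<Sum>i<n. q ^ i)"
    by (simp add: qint_poly_def to_fract_sum to_fract_power q_def)
  also have "\<dots> = (1 - q ^ n) / (1 - q)"
    using q_neq_1 by (simp add: sum_gp_strict)
  finally show ?thesis
    by (simp add: qint_def)
qed

definition A_coeff :: "nat \<Rightarrow> ratfun" where
  "A_coeff n =
     q ^ (n + 1) * (q ^ n - 2) * qint (int n) *
     (((1 - q powi (1 - int n)) ^ 3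
        - q powi (- int n - 2) * (1 + q) * (1 - q\<^sup>2)\<^sup>2 * (1 - q powi (2 - int n)))
      / ((1 - q powi (3 - int n)) * (1 - q powi (1 - int n))\<^sup>2))"

end

theory Submission
  imports Defs
begin

text \<open>
  Put \<open>p = q^4\<close>. Splitting \<open>(q^2;q^2)_(2k)\<close> and \<open>(q^(-1);q^2)_(2k)\<close> into their even and odd
  factors shows that the series is a truncated very-well-poised 8phi7 in base \<open>p\<close> with
  \<open>a = q^(-1)\<close>, four parameters \<open>q^(-1)\<close>, one parameter \<open>q^2\<close> and argument \<open>q^8\<close>. The
  modulus vanishes exactly at the \<open>n\<close>-th roots of unity \<open>z \<noteq> 1\<close>: to order 3 if \<open>z\<close> is
  primitive and to order 1 otherwise. So the claim is a lower bound on the order of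
  vanishing at each \<open>z\<close> (\<open>ratfun_cong_if_ord_ge\<close>). Let \<open>d\<close> be the order of \<open>z\<close>.

  The sum over one period \<open>k < d\<close>. Choose \<open>e = d\<close> or \<open>e = 3 d\<close> with \<open>e \<equiv> 3\<close> modulo 4.
  Let \<open>F(e,f)\<close> be the sum in which the four parameters \<open>q^(-1)\<close> are replaced by
  \<open>q^(e-1), q^(-e-1), q^(f-1), q^(-f-1)\<close>. The factor belonging to \<open>q^(e-1), q^(-e-1)\<close> does
  not change when \<open>e\<close> is replaced by \<open>-e\<close>; this is why it differs from the factor for
  \<open>e = 0\<close> only by a function with a double zero at \<open>z\<close>. Therefore
  \<open>F(0,0) - 2 F(e,0) + F(e,e)\<close>, which is a sum of squares of such differences times
  coefficients with at most a simple pole, vanishes to order 3. The sums \<open>F(e,f)\<close> terminate,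
  and Watson's transformation shows that they contain the factor \<open>[e]\<close>, the other factor
  changing by a double zero when \<open>f\<close> goes from 0 to \<open>e\<close>. So \<open>F(0,0)\<close> and \<open>F(e,0)\<close> agree to
  order 3 (\<open>first_period_sum\<close>). Finally \<open>F(e,0)\<close> has a closed form,
  \<open>sum_coef_pair_closed_form\<close>, because the 4phi3 in Watson's transformation degenerates to a
  combination of two 3phi2 that are summed by the q-Saalschuetz formula. For \<open>d \<equiv> 1\<close>
  modulo 4 the closed form has a triple zero at \<open>z\<close>. For \<open>d \<equiv> 3\<close> it has a simple
  zero, and if \<open>d = n\<close> it agrees with the right-hand side up to a multiple of
  \<open>(1 - q^n)^2 [n]\<close>.

  The other periods. They matter when \<open>d < n\<close>, where a simple zero suffices. The block
  \<open>u d \<le> k < (u + 1) d\<close> arises from the first one by replacing \<open>q^(4k)\<close> by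
  \<open>q^(d M) q^(4k)\<close> with \<open>M = 4 u\<close>. If \<open>d \<equiv> 3\<close> modulo 4, all terms that count are
  regular at \<open>z\<close> and the block sum does not depend on \<open>M\<close> to first order. If \<open>d \<equiv> 1\<close>,
  some terms have a simple pole, and one needs a double zero after the pole has been
  cleared. To that order the cleared sum is an affine function of \<open>M\<close> (\<open>affine_mod_2\<close>). It
  vanishes at \<open>M = 0\<close>, by the result for the first period, and at \<open>M = -3\<close>, because the
  reflection that reverses a well-poised series maps that block to the first one
  (\<open>block_term_reflect\<close>). Hence it vanishes for all \<open>M\<close>.
\<close>

section \<open>Summation formulas for basic hypergeometric series\<close>

lemma qpoch_0 [simp]: "qpoch x p 0 = 1"
  by (simp add: qpoch_def)

lemma qpoch_Suc: "qpoch x p (Suc k) = qpoch x p k * (1 - x * p ^ k)"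
  by (simp add: qpoch_def)

lemma qpoch_add: "qpoch x p (j + k) = qpoch x p j * qpoch (x * p ^ j) p k"
  by (induction k) (simp_all add: qpoch_Suc power_add mult_ac)

lemma qpoch_Suc_left: "qpoch x p (Suc k) = (1 - x) * qpoch (x * p) p k"
  using qpoch_add[of x p 1 k] by (simp add: qpoch_Suc)

text \<open>
  The q-Pfaff-Saalschuetz sum for a 3phi2 with lower parameter \<open>C = A B D\<close>. The factors
  \<open>(p^(-N);p)_k\<close> are rewritten in terms of \<open>(p;p)_(N-k)\<close>, so that no parameter has to be
  inverted. Both sides satisfy the same first-order recurrence in \<open>N\<close>; for the sum this is
  creative telescoping.
\<close>
lemma q_saalschuetz:
  fixes A B D p :: "'a::field"
  assumes p: "\<And>k. qpoch p p k \<noteq> 0" and C: "\<And>k. qpoch (A * B * D) p k \<noteq> 0"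
  shows "(\<Sum>k\<le>N. qpoch A p k * qpoch B p k * D ^ k * qpoch D p (N - k)
              / (qpoch p p k * qpoch (A * B * D) p k * qpoch p p (N - k)))
         = qpoch (A * D) p N * qpoch (B * D) p N / (qpoch p p N * qpoch (A * B * D) p N)"
proof (induction N)
  case 0
  show ?case by simp
next
  case (Suc N)
  define W where "W k = qpoch A p k * qpoch B p k * D ^ k / (qpoch p p k * qpoch (A * B * D) p k)" for k
  define v where "v m = qpoch D p m / qpoch p p m" for m
  define S where "S M = (\<Sum>k\<le>M. W k * v (M - k))" for M
  have p1: "1 - p ^ Suc k \<noteq> 0" for k
    using p[of "Suc k"] by (auto simp: qpoch_Suc)
  have C1: "1 - A * B * D * p ^ k \<noteq> 0" for k
    using C[of "Suc k"] by (auto simp: qpoch_Suc)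
  have W_Suc: "W (Suc k) * ((1 - p ^ Suc k) * (1 - A * B * D * p ^ k))
      = W k * (D * (1 - A * p ^ k) * (1 - B * p ^ k))" for k
    using p1[of k] C1[of k] p[of k] C[of k]
    by (simp add: W_def qpoch_Suc divide_simps)
  have v_Suc: "v (Suc m) * (1 - p ^ Suc m) = v m * (1 - D * p ^ m)" for m
    using p1[of m] p[of m] by (simp add: v_def qpoch_Suc divide_simps)
  let ?l = "(1 - p ^ Suc N) * (1 - A * B * D * p ^ N)"
  let ?r = "(1 - A * D * p ^ N) * (1 - B * D * p ^ N)"
  let ?G = "\<lambda>k. - (p ^ (N - k) * (D * (1 - A * p ^ k) * (1 - B * p ^ k)) * W k * v (N - k))"
  \<comment> \<open>The recurrence operator applied to the summand is a difference in k, with certificate ?G.\<close>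
  have partial: "(\<Sum>k\<le>m. ?l * (W k * v (Suc N - k)) - ?r * (W k * v (N - k))) = ?G m"
    if "m \<le> N" for m
    using that
  proof (induction m)
    case 0
    have "(1 - p ^ Suc N) * (?l * v (Suc N) - ?r * v N)
        = ?l * (v (Suc N) * (1 - p ^ Suc N)) - (1 - p ^ Suc N) * ?r * v N"
      by (simp add: algebra_simps)
    also have "\<dots> = (1 - p ^ Suc N) * (- (p ^ N * (D * (1 - A) * (1 - B)) * v N))"
      unfolding v_Suc by (simp add: algebra_simps)
    finally have "?l * v (Suc N) - ?r * v N = - (p ^ N * (D * (1 - A) * (1 - B)) * v N)"
      using p1[of N] by (metis mult_left_cancel)
    then show ?case by (simp add: W_def)
  next
    case (Suc m)
    define J where "J = p ^ (N - Suc m)"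
    define K where "K = p ^ m"
    have e: "N - m = Suc (N - Suc m)" "Suc N - Suc m = Suc (N - Suc m)"
      using Suc.prems by auto
    have "p ^ N = J * (p * K)"
      using Suc.prems by (simp add: J_def K_def flip: power_add power_Suc power_Suc2)
    moreover have "p ^ (N - m) = J * p"
      unfolding e(1) by (simp add: J_def)
    ultimately have PK: "p ^ N = J * (p * K)" "p ^ (N - m) = J * p" .
    have pJ: "1 - p * J \<noteq> 0" using p1[of "N - Suc m"] by (simp add: J_def)
    have vS: "v (Suc (N - Suc m)) * (1 - p * J) = v (N - Suc m) * (1 - D * J)"
      using v_Suc[of "N - Suc m"] by (simp add: J_def)
    have WS: "W (Suc m) * ((1 - p * K) * (1 - A * B * D * K)) = W m * (D * (1 - A * K) * (1 - B * K))"
      using W_Suc[of m] by (simp add: K_def)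
    let ?V = "v (N - Suc m)"
    let ?W = "W (Suc m)"
    have "(1 - p * J) * ((\<Sum>k\<le>Suc m. ?l * (W k * v (Suc N - k)) - ?r * (W k * v (N - k))) - ?G (Suc m))
      = (1 - p * J) * (?G m + ?l * (?W * v (Suc (N - Suc m))) - ?r * (?W * ?V) - ?G (Suc m))"
      using Suc by (simp add: e)
    also have "\<dots> = - (J * p * (W m * (D * (1 - A * K) * (1 - B * K))) * (v (Suc (N - Suc m)) * (1 - p * J)))
       + ?l * ?W * (v (Suc (N - Suc m)) * (1 - p * J)) - (1 - p * J) * (?r * (?W * ?V)) - (1 - p * J) * ?G (Suc m)"
      unfolding PK by (simp add: e algebra_simps flip: K_def J_def)
    also have "\<dots> = 0"
      unfolding vS WS[symmetric]
      by (simp add: PK flip: K_def J_def) (simp add: algebra_simps)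
    finally show ?case using pJ unfolding mult_eq_0_iff right_minus_eq by blast
  qed
  have "?l * S (Suc N) - ?r * S N
     = (\<Sum>k\<le>N. ?l * (W k * v (Suc N - k)) - ?r * (W k * v (N - k))) + ?l * W (Suc N)"
  proof -
    have "v 0 = 1" by (simp add: v_def)
    then show ?thesis
      by (simp add: S_def sum_subtractf distrib_left sum_distrib_left[symmetric])
  qed
  also have "\<dots> = 0"
    using W_Suc[of N] by (subst partial) (simp_all add: v_def mult_ac)
  finally have rec: "?l * S (Suc N) = ?r * S N" by simp
  have S_eq: "S M = (\<Sum>k\<le>M. qpoch A p k * qpoch B p k * D ^ k * qpoch D p (M - k)
              / (qpoch p p k * qpoch (A * B * D) p k * qpoch p p (M - k)))" for M
    by (simp add: S_def W_def v_def)
  have "S (Suc N) = ?r * S N / ?l"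
    using rec p1[of N] C1[of N] by (metis mult_eq_0_iff nonzero_mult_div_cancel_left)
  also have "S N = qpoch (A * D) p N * qpoch (B * D) p N / (qpoch p p N * qpoch (A * B * D) p N)"
    using Suc by (simp add: S_eq)
  finally show ?case
    unfolding S_eq by (simp add: qpoch_Suc mult_ac)
qed

text \<open>
  The terminating 6phi5 sum, with \<open>a p = d e h\<close>. Written through
  \<open>1 / ((a)_(N+k+1) (p)_(N-k))\<close>, the summand depends on \<open>N\<close> only via these two factors,
  which makes the recurrence in \<open>N\<close> provable by telescoping as for q-Saalschuetz.
\<close>
lemma very_well_poised_6phi5:
  fixes a d e h p :: "'a::field"
  assumes ap: "a * p = d * e * h"
    and p: "\<And>k. qpoch p p k \<noteq> 0" and a: "\<And>k. qpoch a p k \<noteq> 0"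
    and D: "\<And>k. qpoch (d * h) p k \<noteq> 0" and E: "\<And>k. qpoch (e * h) p k \<noteq> 0"
  shows "(\<Sum>k\<le>N. (1 - a * p ^ (2 * k)) * qpoch a p k * (-1) ^ k * p ^ (k choose 2)
              * (qpoch d p k * qpoch e p k * h ^ k)
              / (qpoch p p k * qpoch (d * h) p k * qpoch (e * h) p k
                 * (qpoch a p (N + k + 1) * qpoch p p (N - k))))
         = qpoch h p N / (qpoch p p N * qpoch (d * h) p N * qpoch (e * h) p N)"
proof (induction N)
  case 0
  show ?case using a[of 1] by (simp add: qpoch_Suc binomial_eq_0)
next
  case (Suc N)
  define B where "B k = qpoch a p k * (-1) ^ k * p ^ (k choose 2) * (qpoch d p k * qpoch e p k * h ^ k)
    / (qpoch p p k * qpoch (d * h) p k * qpoch (e * h) p k)" for k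
  define v where "v m = 1 / qpoch p p m" for m
  define w where "w m = 1 / qpoch a p m" for m
  define S where "S M = (\<Sum>k\<le>M. (1 - a * p ^ (2 * k)) * B k * w (M + k + 1) * v (M - k))" for M
  have p1: "1 - p ^ Suc k \<noteq> 0" for k
    using p[of "Suc k"] by (auto simp: qpoch_Suc)
  have D1: "1 - d * h * p ^ k \<noteq> 0" and E1: "1 - e * h * p ^ k \<noteq> 0" and a1: "1 - a * p ^ k \<noteq> 0" for k
    using D[of "Suc k"] E[of "Suc k"] a[of "Suc k"] by (auto simp: qpoch_Suc)
  have choose: "p ^ (Suc k choose 2) = p ^ (k choose 2) * p ^ k" for k
    by (simp add: numeral_2_eq_2 power_add)
  have B_Suc: "B (Suc k) * ((1 - p ^ Suc k) * (1 - d * h * p ^ k) * (1 - e * h * p ^ k))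
      = B k * (- (p ^ k) * h * (1 - a * p ^ k) * (1 - d * p ^ k) * (1 - e * p ^ k))" for k
    using p1[of k] D1[of k] E1[of k] p[of k] D[of k] E[of k]
    by (simp add: B_def qpoch_Suc choose divide_simps)
  have v_Suc: "v (Suc m) * (1 - p ^ Suc m) = v m" and w_Suc: "w (Suc m) * (1 - a * p ^ m) = w m" for m
    using p1[of m] p[of m] a1[of m] a[of m] by (simp_all add: v_def w_def qpoch_Suc)
  let ?l = "(1 - p ^ Suc N) * (1 - d * h * p ^ N) * (1 - e * h * p ^ N)"
  let ?r = "1 - h * p ^ N"
  let ?G = "\<lambda>k. B k * (h * p ^ N * (1 - a * p ^ k) * (1 - d * p ^ k) * (1 - e * p ^ k)) * w (N + k + 2) * v (N - k)"
  let ?T = "\<lambda>M k. (1 - a * p ^ (2 * k)) * B k * w (M + k + 1) * v (M - k)"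
  \<comment> \<open>Again ?G is the certificate that makes the combination telescope.\<close>
  have partial: "(\<Sum>k\<le>m. ?l * ?T (Suc N) k - ?r * ?T N k) = ?G m"
    if "m \<le> N" for m
    using that
  proof (induction m)
    case 0
    have w: "w (Suc N) = w (Suc (Suc N)) * (1 - a * p ^ Suc N)" by (rule w_Suc[symmetric])
    have "?l * v (Suc N) = (1 - d * h * p ^ N) * (1 - e * h * p ^ N) * (v (Suc N) * (1 - p ^ Suc N))"
      by (simp only: mult_ac)
    also have "\<dots> = (1 - d * h * p ^ N) * (1 - e * h * p ^ N) * v N" by (simp only: v_Suc)
    finally have l: "?l * v (Suc N) = (1 - d * h * p ^ N) * (1 - e * h * p ^ N) * v N" .
    have "(\<Sum>k\<le>0. ?l * ?T (Suc N) k - ?r * ?T N k)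
        = (1 - a) * w (Suc (Suc N)) * (?l * v (Suc N)) - ?r * ((1 - a) * w (Suc N) * v N)"
      by (simp add: B_def binomial_eq_0)
    also have "\<dots> = (1 - a) * w (Suc (Suc N)) * v N *
       ((1 - d * h * p ^ N) * (1 - e * h * p ^ N) - (1 - h * p ^ N) * (1 - (a * p) * p ^ N))"
      unfolding l w by (simp add: algebra_simps)
    also have "\<dots> = ?G 0" unfolding ap by (simp add: B_def binomial_eq_0 algebra_simps)
    finally show ?case .
  next
    case (Suc m)
    define J where "J = p ^ (N - Suc m)"
    define K where "K = p ^ m"
    have PK: "p ^ N = J * (p * K)"
      using Suc.prems by (simp_all add: J_def K_def flip: power_add power_Suc power_Suc2)
    have e: "N - m = Suc (N - Suc m)" "Suc N - Suc m = Suc (N - Suc m)"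
      using Suc.prems by auto
    define V where "V = v (Suc (N - Suc m))"
    define U where "U = w (N + m + 3)"
    have vS: "v (N - Suc m) = V * (1 - p * J)"
      using v_Suc[of "N - Suc m"] by (simp add: J_def V_def)
    have aK: "a * p ^ Suc m = d * e * h * K"
      using ap by (simp add: K_def)
    have aK2: "a * p ^ (2 * Suc m) = d * e * h * p * K * K"
      by (simp add: K_def power2_eq_square mult_2 power_add flip: ap)
    have aNK: "a * p ^ (N + m + 2) = d * e * h * p * J * K * p * K"
      by (simp add: K_def PK power_add flip: ap)
    have wS: "w (N + m + 2) = U * (1 - d * e * h * p * J * K * p * K)"
      using w_Suc[of "N + m + 2"] unfolding aNK by (simp add: U_def numeral_3_eq_3)
    have BS: "B (Suc m) * ((1 - p * K) * (1 - d * h * K) * (1 - e * h * K))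
        = B m * (- K * h * (1 - a * K) * (1 - d * K) * (1 - e * K))"
      using B_Suc[of m] by (simp add: K_def)
    let ?B = "B (Suc m)"
    have G: "?G m = - J * p * (B m * (- K * h * (1 - a * K) * (1 - d * K) * (1 - e * K))) * w (N + m + 2) * V"
      unfolding PK e(1) V_def by (simp add: algebra_simps flip: K_def)
    have "(\<Sum>k\<le>Suc m. ?l * ?T (Suc N) k - ?r * ?T N k) = ?G m + (?l * ?T (Suc N) (Suc m) - ?r * ?T N (Suc m))"
      using Suc by simp
    also have "?T (Suc N) (Suc m) = (1 - d * e * h * p * K * K) * ?B * U * V"
      unfolding aK2 by (simp add: e U_def V_def numeral_3_eq_3)
    also have "?T N (Suc m) = (1 - d * e * h * p * K * K) * ?B * w (N + m + 2) * v (N - Suc m)"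
      unfolding aK2 by simp
    also have "?G m + (?l * ((1 - d * e * h * p * K * K) * ?B * U * V)
        - ?r * ((1 - d * e * h * p * K * K) * ?B * w (N + m + 2) * v (N - Suc m))) = ?G (Suc m)"
    proof -
      have GS: "?G (Suc m) = ?B * (h * (J * (p * K)) * (1 - d * e * h * K) * (1 - d * (p * K)) * (1 - e * (p * K)))
          * U * (V * (1 - p * J))"
        unfolding aK vS[symmetric] PK U_def K_def by (simp add: numeral_3_eq_3)
      show ?thesis
        unfolding GS unfolding G unfolding BS[symmetric] unfolding wS vS PK power_Suc
        by (simp add: algebra_simps)
    qed
    finally show ?case .
  qed
  have "?l * S (Suc N) - ?r * S N = (\<Sum>k\<le>N. ?l * ?T (Suc N) k - ?r * ?T N k) + ?l * ?T (Suc N) (Suc N)"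
    by (simp add: S_def sum_subtractf distrib_left sum_distrib_left[symmetric])
  also have "\<dots> = 0"
  proof -
    have "?l * ?T (Suc N) (Suc N) = (B (Suc N) * ?l) * (w (2 * N + 3) * (1 - a * p ^ (2 * N + 2)))"
      by (simp add: v_def mult_2 mult_2_right numeral_3_eq_3 mult_ac)
    also have "w (2 * N + 3) * (1 - a * p ^ (2 * N + 2)) = w (2 * N + 2)"
      using w_Suc[of "2 * N + 2"] by (simp add: numeral_3_eq_3)
    finally have last: "?l * ?T (Suc N) (Suc N) = - ?G N"
      unfolding B_Suc by (simp add: v_def mult_2 mult_2_right algebra_simps)
    show ?thesis
      unfolding last by (subst partial) simp_all
  qed
  finally have rec: "?l * S (Suc N) = ?r * S N" by simp
  have S_eq: "S M = (\<Sum>k\<le>M. (1 - a * p ^ (2 * k)) * qpoch a p k * (-1) ^ k * p ^ (k choose 2)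
              * (qpoch d p k * qpoch e p k * h ^ k)
              / (qpoch p p k * qpoch (d * h) p k * qpoch (e * h) p k
                 * (qpoch a p (M + k + 1) * qpoch p p (M - k))))" for M
    by (simp add: S_def B_def v_def w_def mult_ac)
  have "S (Suc N) = ?r * S N / ?l"
    using rec p1[of N] D1[of N] E1[of N] by (metis mult_eq_0_iff nonzero_mult_div_cancel_left)
  also have "S N = qpoch h p N / (qpoch p p N * qpoch (d * h) p N * qpoch (e * h) p N)"
    using Suc by (simp add: S_eq)
  finally show ?case
    unfolding S_eq by (simp add: qpoch_Suc mult_ac)
qed


text \<open>
  The hypothesis says \<open>y = p^(1-k) / x\<close>, so the factors of \<open>(y;p)_k\<close> are, in reverse order
  and up to sign and a monomial, those of \<open>(x;p)_k\<close>.
\<close>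
lemma qpoch_reverse:
  fixes x y p :: "'a::field"
  assumes "y * x * p ^ k = p" and "p \<noteq> 0"
  shows "x ^ k * p ^ (k choose 2) * qpoch y p k = (-1) ^ k * qpoch x p k"
  using assms(1)
proof (induction k arbitrary: y)
  case 0
  show ?case by (simp add: binomial_eq_0)
next
  case (Suc k)
  have y: "y * (x * p ^ k) = 1"
    using Suc.prems assms(2) by simp
  have choose: "p ^ (Suc k choose 2) = p ^ (k choose 2) * p ^ k"
    by (simp add: numeral_2_eq_2 power_add)
  have "x ^ Suc k * p ^ (Suc k choose 2) * qpoch y p (Suc k)
      = (x * p ^ k) * (1 - y) * (x ^ k * p ^ (k choose 2) * qpoch (y * p) p k)"
    unfolding qpoch_Suc_left choose by (simp add: mult_ac)
  also have "(x * p ^ k) * (1 - y) = - (1 - x * p ^ k)"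
    using y by (simp add: algebra_simps)
  also have "x ^ k * p ^ (k choose 2) * qpoch (y * p) p k = (-1) ^ k * qpoch x p k"
    by (rule Suc.IH) (use Suc.prems in \<open>simp add: mult_ac\<close>)
  also have "- (1 - x * p ^ k) * ((-1) ^ k * qpoch x p k) = (-1) ^ Suc k * qpoch x p (Suc k)"
    by (simp add: qpoch_Suc algebra_simps)
  finally show ?case .
qed

lemma choose_two_add: "(j + i) choose 2 = (j choose 2) + (i choose 2) + i * j"
  by (induction i) (simp_all add: numeral_2_eq_2)

lemma square_eq_choose_two: "j * j = 2 * (j choose 2) + j"
  by (induction j) (simp_all add: numeral_2_eq_2)

text \<open>
  q-Saalschuetz read from right to left. It expands the well-poised quotient of the
  parameters \<open>b\<close>, \<open>c\<close> into the functions \<open>(a)_(k+j) (p)_k / ((a)_k (p)_(k-j) p^(kj))\<close> of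
  \<open>k\<close>. Multiplication by these turns a very-well-poised summand into a shifted
  very-well-poised summand, and \<open>b\<close>, \<open>c\<close> no longer interact with \<open>k\<close>.
\<close>
lemma qpoch_quotient_expansion:
  fixes a b c g p :: "'a::field"
  assumes ap: "a * p = b * c * g" and nz: "a \<noteq> 0" "p \<noteq> 0"
    and p: "\<And>k. qpoch p p k \<noteq> 0" and a: "\<And>k. qpoch a p k \<noteq> 0"
    and B: "\<And>k. qpoch (b * g) p k \<noteq> 0" and C: "\<And>k. qpoch (c * g) p k \<noteq> 0"
  shows "qpoch b p k * qpoch c p k * g ^ k / (qpoch (b * g) p k * qpoch (c * g) p k)
       = (\<Sum>j\<le>k. (-1) ^ j * p ^ ((j choose 2) + j) / p ^ (k * j)
             * (qpoch a p (k + j) / qpoch a p k) * (qpoch p p k / qpoch p p (k - j))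
             * (qpoch g p j / (qpoch p p j * qpoch (b * g) p j * qpoch (c * g) p j)))"
proof -
  have nz': "b \<noteq> 0" "c \<noteq> 0" "g \<noteq> 0"
    using ap nz by auto
  define D where "D = p / (b * g * p ^ k)"
  have D: "D * (b * g) * p ^ k = p"
    using nz nz' by (simp add: D_def)
  have ABD: "(a * p ^ k) * g * D = c * g" and AD: "(a * p ^ k) * D = c"
    using nz nz' ap by (simp_all add: D_def field_simps)
  \<comment> \<open>Z is the factor by which q-Saalschuetz with parameters a p^k, g and D has to be rescaled.\<close>
  define Z where "Z = qpoch p p k / qpoch (b * g) p k * (b * g) ^ k * p ^ (k choose 2) * (-1) ^ k"
  have b: "b ^ k * p ^ (k choose 2) * qpoch (g * D) p k = (-1) ^ k * qpoch b p k"
    by (rule qpoch_reverse) (use D nz in \<open>simp_all add: mult_ac\<close>)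
  have "Z * (qpoch c p k * qpoch (g * D) p k / (qpoch p p k * qpoch (c * g) p k))
      = (-1) ^ k * (b ^ k * p ^ (k choose 2) * qpoch (g * D) p k) * qpoch c p k * g ^ k
         / (qpoch (b * g) p k * qpoch (c * g) p k)"
    using p[of k] by (simp add: Z_def power_mult_distrib mult_ac)
  also have "\<dots> = ((-1) ^ k * (-1) ^ k) * qpoch b p k * qpoch c p k * g ^ k / (qpoch (b * g) p k * qpoch (c * g) p k)"
    unfolding b by (simp add: mult_ac)
  finally have "qpoch b p k * qpoch c p k * g ^ k / (qpoch (b * g) p k * qpoch (c * g) p k)
      = Z * (qpoch c p k * qpoch (g * D) p k / (qpoch p p k * qpoch (c * g) p k))"
    by (simp flip: power_mult_distrib)
  also have "\<dots> = Z * (\<Sum>j\<le>k. qpoch (a * p ^ k) p j * qpoch g p j * D ^ j * qpoch D p (k - j)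
              / (qpoch p p j * qpoch (c * g) p j * qpoch p p (k - j)))"
    using q_saalschuetz[of p "a * p ^ k" g D k] p C unfolding ABD AD by simp
  also have "\<dots> = (\<Sum>j\<le>k. (-1) ^ j * p ^ ((j choose 2) + j) / p ^ (k * j)
             * (qpoch a p (k + j) / qpoch a p k) * (qpoch p p k / qpoch p p (k - j))
             * (qpoch g p j / (qpoch p p j * qpoch (b * g) p j * qpoch (c * g) p j)))"
    unfolding sum_distrib_left
  proof (rule sum.cong[OF refl])
    fix j assume "j \<in> {..k}"
    define i where "i = k - j"
    have k: "k = j + i" using \<open>j \<in> {..k}\<close> by (simp add: i_def)
    define x where "x = b * g"
    have x: "D * x * p ^ k = p" using D by (simp add: x_def)
    have X: "(x * p ^ j) ^ i * p ^ (i choose 2) * qpoch D p i = (-1) ^ i * qpoch (x * p ^ j) p i"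
      by (rule qpoch_reverse) (use x nz in \<open>simp_all add: k power_add mult_ac\<close>)
    have Y: "qpoch x p k = qpoch x p j * qpoch (x * p ^ j) p i"
      by (simp add: k qpoch_add)
    have "x ^ j * D ^ j * p ^ (k * j) = (D * x * p ^ k) ^ j"
      unfolding power_mult by (simp add: power_mult_distrib)
    then have Dj: "x ^ j * D ^ j * p ^ (k * j) = p ^ j"
      by (simp only: x)
    have sign: "(-1) ^ i * (-1) ^ i = (1::'a)"
      by (simp flip: power_mult_distrib)
    have pk: "p ^ (k choose 2) = p ^ (j choose 2) * p ^ (i choose 2) * p ^ (i * j)"
      by (simp add: k choose_two_add power_add)
    have "x ^ k * p ^ (k choose 2) * (-1) ^ k * D ^ j * qpoch D p i * p ^ (k * j)
        = (-1) ^ j * (-1) ^ i * p ^ (j choose 2) * (x ^ j * D ^ j * p ^ (k * j))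
           * ((x * p ^ j) ^ i * p ^ (i choose 2) * qpoch D p i)"
      unfolding pk by (simp add: k power_add power_mult_distrib power_mult[symmetric] mult_ac)
    also have "\<dots> = (-1) ^ j * p ^ ((j choose 2) + j) * qpoch (x * p ^ j) p i * ((-1) ^ i * (-1) ^ i)"
      unfolding Dj X by (simp add: power_add mult_ac)
    finally have "x ^ k * p ^ (k choose 2) * (-1) ^ k * D ^ j * qpoch D p i
       = (-1) ^ j * p ^ ((j choose 2) + j) / p ^ (k * j) * qpoch (x * p ^ j) p i"
      unfolding sign using nz by (simp add: field_simps)
    moreover have "qpoch (x * p ^ j) p i / qpoch x p k = 1 / qpoch x p j"
      using B[of k] unfolding x_def[symmetric] Y by simp
    ultimately have main: "x ^ k * p ^ (k choose 2) * (-1) ^ k * D ^ j * qpoch D p i / qpoch x p k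
       = (-1) ^ j * p ^ ((j choose 2) + j) / p ^ (k * j) * (1 / qpoch x p j)"
      by (metis times_divide_eq_right)
    have aj: "qpoch (a * p ^ k) p j = qpoch a p (k + j) / qpoch a p k"
      using a[of k] by (simp add: qpoch_add)
    have "Z * (qpoch (a * p ^ k) p j * qpoch g p j * D ^ j * qpoch D p (k - j)
              / (qpoch p p j * qpoch (c * g) p j * qpoch p p (k - j)))
       = (x ^ k * p ^ (k choose 2) * (-1) ^ k * D ^ j * qpoch D p i / qpoch x p k)
          * qpoch (a * p ^ k) p j * (qpoch p p k / qpoch p p (k - j)) * (qpoch g p j / (qpoch p p j * qpoch (c * g) p j))"
      by (simp add: Z_def i_def x_def mult_ac)
    also have "\<dots> = (-1) ^ j * p ^ ((j choose 2) + j) / p ^ (k * j)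
             * (qpoch a p (k + j) / qpoch a p k) * (qpoch p p k / qpoch p p (k - j))
             * (qpoch g p j / (qpoch p p j * qpoch (b * g) p j * qpoch (c * g) p j))"
      unfolding main aj by (simp add: x_def)
    finally show "Z * (qpoch (a * p ^ k) p j * qpoch g p j * D ^ j * qpoch D p (k - j)
              / (qpoch p p j * qpoch (c * g) p j * qpoch p p (k - j)))
      = (-1) ^ j * p ^ ((j choose 2) + j) / p ^ (k * j)
             * (qpoch a p (k + j) / qpoch a p k) * (qpoch p p k / qpoch p p (k - j))
             * (qpoch g p j / (qpoch p p j * qpoch (b * g) p j * qpoch (c * g) p j))"
      unfolding main by (simp add: x_def)
  qed
  finally show ?thesis .
qed

lemma sum_triangle:
  fixes f :: "nat \<Rightarrow> nat \<Rightarrow> 'a::comm_monoid_add"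
  shows "(\<Sum>k\<le>N. \<Sum>j\<le>k. f j (k - j)) = (\<Sum>j\<le>N. \<Sum>i\<le>N - j. f j i)"
proof -
  have "{(j, i). j + i \<le> N} = (SIGMA j:{..N}. {..N - j})" by auto
  then show ?thesis
    by (simp add: sum.Sigma flip: sum.triangle_reindex_eq)
qed

text \<open>
  Watson's transformation of a terminating very-well-poised 8phi7 into a balanced 4phi3, the
  parameters being tied by \<open>a p = b c g = d e h\<close>. After \<open>b\<close>, \<open>c\<close> have been expanded and the
  summations exchanged, the inner sum is the 6phi5 in which \<open>a, d, e, N\<close> are replaced by
  \<open>a p^(2j), d p^j, e p^j, N - j\<close>.
\<close>
theorem watson_transformation:
  fixes a b c d e g h p :: "'a::field"
  assumes bcg: "a * p = b * c * g" and deh: "a * p = d * e * h" and nz: "a \<noteq> 0" "p \<noteq> 0"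
    and p: "\<And>k. qpoch p p k \<noteq> 0" and a: "\<And>k. qpoch a p k \<noteq> 0"
    and B: "\<And>k. qpoch (b * g) p k \<noteq> 0" and C: "\<And>k. qpoch (c * g) p k \<noteq> 0"
    and D: "\<And>k. qpoch (d * h) p k \<noteq> 0" and E: "\<And>k. qpoch (e * h) p k \<noteq> 0"
  shows "(\<Sum>k\<le>N. (1 - a * p ^ (2 * k)) * qpoch a p k * (-1) ^ k * p ^ (k choose 2)
              * (qpoch d p k * qpoch e p k * h ^ k)
              / (qpoch p p k * qpoch (d * h) p k * qpoch (e * h) p k
                 * (qpoch a p (N + k + 1) * qpoch p p (N - k)))
              * (qpoch b p k * qpoch c p k * g ^ k / (qpoch (b * g) p k * qpoch (c * g) p k)))
       = (\<Sum>j\<le>N. qpoch g p j * qpoch d p j * qpoch e p j * h ^ j * qpoch h p (N - j)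
              / (qpoch p p j * qpoch (b * g) p j * qpoch (c * g) p j * qpoch p p (N - j)))
         / (qpoch (d * h) p N * qpoch (e * h) p N)"
proof -
  define L where "L k = (1 - a * p ^ (2 * k)) * qpoch a p k * (-1) ^ k * p ^ (k choose 2)
              * (qpoch d p k * qpoch e p k * h ^ k)
              / (qpoch p p k * qpoch (d * h) p k * qpoch (e * h) p k
                 * (qpoch a p (N + k + 1) * qpoch p p (N - k)))" for k
  define R where "R j i = (-1) ^ j * p ^ ((j choose 2) + j) / p ^ ((j + i) * j)
             * (qpoch a p (2 * j + i) / qpoch a p (j + i)) * (qpoch p p (j + i) / qpoch p p i)
             * (qpoch g p j / (qpoch p p j * qpoch (b * g) p j * qpoch (c * g) p j))" for j i
  let ?M = "\<lambda>j. qpoch g p j * qpoch d p j * qpoch e p j * h ^ j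
             / (qpoch p p j * qpoch (b * g) p j * qpoch (c * g) p j * qpoch (d * h) p j * qpoch (e * h) p j)"
  let ?T = "\<lambda>j i. (1 - (a * p ^ (2 * j)) * p ^ (2 * i)) * qpoch (a * p ^ (2 * j)) p i * (-1) ^ i * p ^ (i choose 2)
              * (qpoch (d * p ^ j) p i * qpoch (e * p ^ j) p i * h ^ i)
              / (qpoch p p i * qpoch (d * p ^ j * h) p i * qpoch (e * p ^ j * h) p i
                 * (qpoch (a * p ^ (2 * j)) p (N - j + i + 1) * qpoch p p (N - j - i)))"
  have tail: "qpoch (x * p ^ j) p k \<noteq> 0" if "\<And>k. qpoch x p k \<noteq> 0" for x j k
    using that[of "j + k"] unfolding qpoch_add by simp
  have "(\<Sum>k\<le>N. L k * (qpoch b p k * qpoch c p k * g ^ k / (qpoch (b * g) p k * qpoch (c * g) p k)))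
      = (\<Sum>k\<le>N. \<Sum>j\<le>k. L (j + (k - j)) * R j (k - j))"
  proof (rule sum.cong[OF refl])
    fix k
    have "R j (k - j) = (-1) ^ j * p ^ ((j choose 2) + j) / p ^ (k * j)
             * (qpoch a p (k + j) / qpoch a p k) * (qpoch p p k / qpoch p p (k - j))
             * (qpoch g p j / (qpoch p p j * qpoch (b * g) p j * qpoch (c * g) p j))" if "j \<le> k" for j
    proof -
      have "2 * j + (k - j) = k + j" using that by simp
      then show ?thesis using that by (simp only: R_def le_add_diff_inverse)
    qed
    then show "L k * (qpoch b p k * qpoch c p k * g ^ k / (qpoch (b * g) p k * qpoch (c * g) p k))
       = (\<Sum>j\<le>k. L (j + (k - j)) * R j (k - j))"
      unfolding qpoch_quotient_expansion[OF bcg nz p a B C] sum_distrib_left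
      by (intro sum.cong refl) simp
  qed
  also have "\<dots> = (\<Sum>j\<le>N. \<Sum>i\<le>N - j. L (j + i) * R j i)"
    by (rule sum_triangle)
  also have "\<dots> = (\<Sum>j\<le>N. qpoch g p j * qpoch d p j * qpoch e p j * h ^ j * qpoch h p (N - j)
              / (qpoch p p j * qpoch (b * g) p j * qpoch (c * g) p j * qpoch p p (N - j))
         / (qpoch (d * h) p N * qpoch (e * h) p N))"
  proof (rule sum.cong[OF refl])
    fix j assume "j \<in> {..N}"
    then have N: "N = j + (N - j)" by simp
    have "L (j + i) * R j i = ?M j * ?T j i" if "i \<le> N - j" for i
    proof -
      have e1: "N + (j + i) + 1 = 2 * j + (N - j + i + 1)" and e2: "N - (j + i) = N - j - i"
        and e3: "2 * (j + i) = 2 * j + 2 * i"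
        using N that by auto
      have "(j + i choose 2) + (j choose 2) + j = (j + i) * j + (i choose 2)"
        using square_eq_choose_two[of j] by (simp add: choose_two_add algebra_simps)
      then have "p ^ (j + i choose 2) * p ^ ((j choose 2) + j) = p ^ ((j + i) * j) * p ^ (i choose 2)"
        by (metis power_add add.assoc)
      moreover have "(-1) ^ (j + i) * (-1) ^ j = ((-1) ^ i :: 'a)"
        by (simp add: power_add mult_ac flip: power_mult_distrib)
      ultimately have pw: "((-1) ^ (j + i) * p ^ (j + i choose 2)) * ((-1) ^ j * p ^ ((j choose 2) + j) / p ^ ((j + i) * j))
         = (-1) ^ i * p ^ (i choose 2)"
        using nz by (simp add: field_simps) 
      have "L (j + i) * R j i = (1 - a * p ^ (2 * j + 2 * i))
         * (((-1) ^ (j + i) * p ^ (j + i choose 2)) * ((-1) ^ j * p ^ ((j choose 2) + j) / p ^ ((j + i) * j)))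
         * (qpoch d p (j + i) * qpoch e p (j + i) * h ^ (j + i)) * qpoch a p (2 * j + i)
         / (qpoch (d * h) p (j + i) * qpoch (e * h) p (j + i)
                 * (qpoch a p (2 * j + (N - j + i + 1)) * qpoch p p (N - j - i)) * qpoch p p i)
         * (qpoch g p j / (qpoch p p j * qpoch (b * g) p j * qpoch (c * g) p j))"
        using a[of "j + i"] p[of "j + i"] unfolding L_def R_def e1 e2 e3 by (simp add: mult_ac)
      also have "\<dots> = ?M j * ?T j i"
        unfolding pw qpoch_add[of a p "2 * j" "N - j + i + 1"] using a[of "2 * j"]
        by (simp add: qpoch_add power_add mult_ac)
      finally show ?thesis .
    qed
    then have "(\<Sum>i\<le>N - j. L (j + i) * R j i) = ?M j * (\<Sum>i\<le>N - j. ?T j i)"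
      by (simp add: sum_distrib_left)
    also have "(\<Sum>i\<le>N - j. ?T j i) = qpoch h p (N - j)
         / (qpoch p p (N - j) * qpoch (d * p ^ j * h) p (N - j) * qpoch (e * p ^ j * h) p (N - j))"
    proof (rule very_well_poised_6phi5)
      show "a * p ^ (2 * j) * p = d * p ^ j * (e * p ^ j) * h"
      proof -
        have "a * p ^ (2 * j) * p = (a * p) * (p ^ j * p ^ j)"
          by (simp add: mult_2 power_add)
        then show ?thesis
          unfolding deh by (simp add: mult_ac)
      qed
      show "qpoch (d * p ^ j * h) p k \<noteq> 0" "qpoch (e * p ^ j * h) p k \<noteq> 0" for k
        using tail[OF D, of j k] tail[OF E, of j k] by (simp_all add: mult_ac)
    qed (rule p, rule tail, rule a)
    also have "?M j * (qpoch h p (N - j)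
         / (qpoch p p (N - j) * qpoch (d * p ^ j * h) p (N - j) * qpoch (e * p ^ j * h) p (N - j)))
      = qpoch g p j * qpoch d p j * qpoch e p j * h ^ j * qpoch h p (N - j)
              / (qpoch p p j * qpoch (b * g) p j * qpoch (c * g) p j * qpoch p p (N - j))
         / ((qpoch (d * h) p j * qpoch (d * h * p ^ j) p (N - j)) * (qpoch (e * h) p j * qpoch (e * h * p ^ j) p (N - j)))"
      by (simp add: mult_ac)
    finally show "(\<Sum>i\<le>N - j. L (j + i) * R j i)
      = qpoch g p j * qpoch d p j * qpoch e p j * h ^ j * qpoch h p (N - j)
              / (qpoch p p j * qpoch (b * g) p j * qpoch (c * g) p j * qpoch p p (N - j))
         / (qpoch (d * h) p N * qpoch (e * h) p N)"
      unfolding qpoch_add[symmetric] using N by simp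
  qed
  finally show ?thesis
    unfolding L_def sum_divide_distrib .
qed

section \<open>Orders of vanishing of rational functions\<close>

text \<open>
  A lower bound for the order of vanishing at \<open>z\<close>: membership in \<open>(X - z)^i R\<close>, where \<open>R\<close> is
  the ring of rational functions without a pole at \<open>z\<close>. Negative \<open>i\<close> bounds the order of a
  pole.
\<close>
definition ord_ge :: "complex \<Rightarrow> int \<Rightarrow> ratfun \<Rightarrow> bool" where
  "ord_ge z i f \<longleftrightarrow>
     (\<exists>a b. poly b z \<noteq> 0 \<and> f * to_fract b = to_fract [:-z, 1:] powi i * to_fract a)"

lemma ord_ge_mult:
  assumes "ord_ge z i f" and "ord_ge z j g"
  shows "ord_ge z (i + j) (f * g)"
proof -
  obtain a b where f: "poly b z \<noteq> 0" "f * to_fract b = to_fract [:-z, 1:] powi i * to_fract a"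
    using assms(1) by (auto simp: ord_ge_def)
  obtain c d where g: "poly d z \<noteq> 0" "g * to_fract d = to_fract [:-z, 1:] powi j * to_fract c"
    using assms(2) by (auto simp: ord_ge_def)
  have "f * g * to_fract (b * d) = (f * to_fract b) * (g * to_fract d)"
    by simp
  also have "\<dots> = to_fract [:-z, 1:] powi (i + j) * to_fract (a * c)"
    unfolding f(2) g(2) by (simp add: power_int_add)
  finally show ?thesis
    unfolding ord_ge_def using f(1) g(1) by (intro exI[of _ "a * c"] exI[of _ "b * d"]) simp
qed

lemma ord_ge_add:
  assumes "ord_ge z i f" and "ord_ge z i g"
  shows "ord_ge z i (f + g)"
proof -
  obtain a b where f: "poly b z \<noteq> 0" "f * to_fract b = to_fract [:-z, 1:] powi i * to_fract a"
    using assms(1) by (auto simp: ord_ge_def)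
  obtain c d where g: "poly d z \<noteq> 0" "g * to_fract d = to_fract [:-z, 1:] powi i * to_fract c"
    using assms(2) by (auto simp: ord_ge_def)
  have "(f + g) * to_fract (b * d) = (f * to_fract b) * to_fract d + (g * to_fract d) * to_fract b"
    by (simp add: algebra_simps)
  also have "\<dots> = to_fract [:-z, 1:] powi i * to_fract (a * d + c * b)"
    unfolding f(2) g(2) by (simp add: algebra_simps)
  finally show ?thesis
    unfolding ord_ge_def using f(1) g(1) by (intro exI[of _ "a * d + c * b"] exI[of _ "b * d"]) simp
qed

lemma ord_ge_to_fract [simp]: "ord_ge z 0 (to_fract a)"
  unfolding ord_ge_def by (intro exI[of _ a] exI[of _ 1]) simp

lemma ord_ge_0 [simp]: "ord_ge z i 0"
  unfolding ord_ge_def by (intro exI[of _ 0] exI[of _ 1]) simp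

lemma ord_ge_1 [simp]: "ord_ge z 0 1"
  using ord_ge_to_fract[of z 1] by (simp del: ord_ge_to_fract)

text \<open>
  Multiplication by a function regular at \<open>z\<close>. Unlike in \<open>ord_ge_mult\<close>, the goal determines
  both orders, so that this can be used as an introduction rule.
\<close>
lemma ord_ge_scale: "ord_ge z 0 f \<Longrightarrow> ord_ge z i g \<Longrightarrow> ord_ge z i (f * g)"
  using ord_ge_mult[of z 0 f i g] by simp

lemma ord_ge_uminus: "ord_ge z i f \<Longrightarrow> ord_ge z i (- f)"
  unfolding ord_ge_def by (metis mult_minus_left mult_minus_right to_fract_uminus)

lemma ord_ge_diff: "ord_ge z i f \<Longrightarrow> ord_ge z i g \<Longrightarrow> ord_ge z i (f - g)"
  using ord_ge_add[of z i f "- g"] ord_ge_uminus[of z i g] by simp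

lemma ord_ge_of_int [simp]: "ord_ge z 0 (of_int m)"
proof -
  have "ord_ge z 0 (of_nat n)" for n
    by (induction n) (simp_all add: ord_ge_add)
  then show ?thesis
    by (cases m rule: int_cases2) (simp_all add: ord_ge_uminus)
qed

lemma ord_ge_sum: "(\<And>k. k \<in> K \<Longrightarrow> ord_ge z i (f k)) \<Longrightarrow> ord_ge z i (\<Sum>k\<in>K. f k)"
  by (induction K rule: infinite_finite_induct) (auto intro: ord_ge_add)

lemma ord_ge_prod: "(\<And>k. k \<in> K \<Longrightarrow> ord_ge z 0 (f k)) \<Longrightarrow> ord_ge z 0 (\<Prod>k\<in>K. f k)"
  by (induction K rule: infinite_finite_induct) (auto intro: ord_ge_scale)

lemma ord_ge_power: "ord_ge z i f \<Longrightarrow> ord_ge z (int n * i) (f ^ n)"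
proof (induction n)
  case (Suc n)
  then show ?case using ord_ge_mult[of z i f "int n * i" "f ^ n"] by (simp add: algebra_simps)
qed simp

lemma ord_ge_mono:
  assumes "ord_ge z j f" and "i \<le> j"
  shows "ord_ge z i f"
proof -
  have "to_fract [:-z, 1:] powi (j - i) = to_fract ([:-z, 1:] ^ nat (j - i))"
    using assms(2) by (simp add: power_int_def to_fract_power)
  moreover have "to_fract [:-z, 1:] powi j = to_fract [:-z, 1:] powi i * to_fract [:-z, 1:] powi (j - i)"
    by (simp flip: power_int_add)
  ultimately show ?thesis
    using assms(1) unfolding ord_ge_def
    by (metis (no_types, opaque_lifting) mult.assoc to_fract_mult)
qed

lemma ord_ge_inverse_to_fract:
  "poly b z \<noteq> 0 \<Longrightarrow> ord_ge z 0 (1 / to_fract b)"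
  unfolding ord_ge_def by (intro exI[of _ 1] exI[of _ b]) auto

text \<open>
  The polynomial \<open>b\<close> in the definition of \<open>ord_ge\<close> is prime to \<open>X - z\<close>, so all factors
  \<open>X - z\<close> must occur in the numerator.
\<close>
lemma dvd_numerator_of_ord_ge:
  assumes "ord_ge z (int m) f"
  shows "[:-z, 1:] ^ m dvd fst (quot_of_fract f)"
proof -
  obtain a b where b: "poly b z \<noteq> 0" and f: "f * to_fract b = to_fract [:-z, 1:] powi int m * to_fract a"
    using assms by (auto simp: ord_ge_def)
  obtain n e where ne: "quot_of_fract f = (n, e)" by force
  have e: "e \<noteq> 0" using snd_quot_of_fract_nonzero[of f] by (simp add: ne)
  have "f = to_fract n / to_fract e"
    using Fract_quot_of_fract[of f] by (simp add: ne Fract_conv_to_fract)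
  then have "to_fract (n * b) = (f * to_fract b) * to_fract e"
    using e by simp
  also have "\<dots> = to_fract ([:-z, 1:] ^ m * (a * e))"
    unfolding f by (simp add: to_fract_power)
  finally have "to_fract (n * b) = to_fract ([:-z, 1:] ^ m * (a * e))" .
  then have "[:-z, 1:] ^ m dvd n * b"
    unfolding to_fract_eq_iff by simp
  moreover have "coprime ([:-z, 1:] ^ m) b"
  proof -
    have "prime_elem [:-z, 1:]" by (rule prime_elem_linear_field_poly) simp
    then have "coprime [:-z, 1:] b"
      using b by (intro prime_elem_imp_coprime) (auto simp: poly_eq_0_iff_dvd)
    then show ?thesis by simp
  qed
  ultimately show ?thesis
    by (simp add: ne coprime_dvd_mult_left_iff)
qed

section \<open>Roots of unity of odd order\<close>

lemma q_neq_0 [simp]: "q \<noteq> 0"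
  by (simp add: q_def)

lemma q_power_eq_1_iff: "q ^ m = 1 \<longleftrightarrow> m = 0"
proof
  assume "q ^ m = 1"
  then have "to_fract ([:0, 1::complex:] ^ m) = to_fract 1"
    by (simp only: q_def to_fract_power to_fract_1)
  then have "[:0, 1::complex:] ^ m = 1" unfolding to_fract_eq_iff .
  then have "degree ([:0, 1::complex:] ^ m) = 0" by simp
  then show "m = 0" by (simp add: degree_power_eq)
qed simp

lemma q_powi_eq_1_iff: "q powi m = 1 \<longleftrightarrow> m = 0"
proof -
  have "inverse q ^ k = 1 \<longleftrightarrow> q ^ k = 1" for k
    by (simp add: power_inverse)
  then show ?thesis
    by (auto simp: power_int_def q_power_eq_1_iff)
qed

locale odd_root_of_unity =
  fixes z :: complex and d :: nat
  assumes odd_d: "odd d" and d_gt_1: "d > 1"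
    and z_power_eq_1_iff: "z ^ m = 1 \<longleftrightarrow> d dvd m"
begin

lemma z_neq_0 [simp]: "z \<noteq> 0"
  using z_power_eq_1_iff[of d] d_gt_1 by (auto simp: power_0_left split: if_splits)

lemma ord_ge_q_powi [simp]: "ord_ge z 0 (q powi m)"
proof -
  have 1: "ord_ge z 0 q" "ord_ge z 0 (1 / q)"
    using ord_ge_inverse_to_fract[of "[:0, 1:]" z] by (simp_all add: q_def)
  have "ord_ge z 0 (q ^ n)" "ord_ge z 0 ((1 / q) ^ n)" for n
    using ord_ge_power[OF 1(1), of n] ord_ge_power[OF 1(2), of n] by simp_all
  then show ?thesis
    by (auto simp: power_int_def divide_inverse)
qed

lemma one_minus_q_powi_neg: "1 - q powi (- m) = - (q powi (- m)) * (1 - q powi m)"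
  by (simp add: algebra_simps flip: power_int_add)

lemma to_fract_one_minus_monom: "to_fract (1 - [:0, 1:] ^ m) = 1 - q ^ m"
  by (simp add: q_def to_fract_power)

lemma ord_ge_one_minus_q_power:
  assumes "d dvd m"
  shows "ord_ge z 1 (1 - q ^ m)"
proof -
  have "poly (1 - [:0, 1:] ^ m) z = 0"
    using assms z_power_eq_1_iff by simp
  then obtain r where "1 - [:0, 1:] ^ m = [:-z, 1:] * r"
    unfolding poly_eq_0_iff_dvd by (elim dvdE)
  then have "1 - q ^ m = to_fract [:-z, 1:] * to_fract r"
    by (metis to_fract_one_minus_monom to_fract_mult)
  then show ?thesis
    unfolding ord_ge_def by (intro exI[of _ r] exI[of _ 1]) simp
qed

text \<open>
  The zeros of \<open>1 - X^m\<close> are simple, since its derivative \<open>- m X^(m-1)\<close> does not vanish at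
  \<open>z\<close>.
\<close>
lemma ord_ge_inverse_one_minus_q_power:
  assumes "m > 0"
  shows "ord_ge z (if d dvd m then - 1 else 0) (1 / (1 - q ^ m))"
proof (cases "d dvd m")
  case True
  let ?P = "1 - [:0, 1:] ^ m :: complex poly"
  have "poly ?P z = 0"
    using True z_power_eq_1_iff by simp
  then obtain r where r: "?P = [:-z, 1:] * r"
    unfolding poly_eq_0_iff_dvd by (elim dvdE)
  have "poly (pderiv ?P) z = - of_nat m * z ^ (m - 1)"
    by (simp add: pderiv_diff pderiv_power pderiv_pCons)
  moreover have "poly (pderiv ?P) z = poly r z"
    unfolding r pderiv_mult by (simp add: pderiv_pCons)
  ultimately have "poly r z \<noteq> 0"
    using assms by auto
  moreover have "1 - q ^ m = to_fract [:-z, 1:] * to_fract r"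
    by (metis to_fract_one_minus_monom to_fract_mult r)
  ultimately show ?thesis
    using True unfolding ord_ge_def
    by (intro exI[of _ 1] exI[of _ r]) (auto simp: power_int_minus field_simps)
next
  case False
  then have "poly (1 - [:0, 1:] ^ m) z \<noteq> 0"
    using z_power_eq_1_iff by simp
  from ord_ge_inverse_to_fract[OF this] show ?thesis
    using False by (simp only: to_fract_one_minus_monom) simp
qed

lemma ord_ge_one_minus_q_powi:
  "int d dvd m \<Longrightarrow> ord_ge z 1 (1 - q powi m)"
  "ord_ge z 0 (1 - q powi m)"
proof -
  have 1: "ord_ge z 1 (1 - q powi m)" if "m \<ge> 0" "int d dvd m" for m
  proof -
    define k where "k = nat m"
    have "m = int k" using that(1) by (simp add: k_def)
    then show ?thesis using that(2) ord_ge_one_minus_q_power[of k] by simp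
  qed
  show "ord_ge z 1 (1 - q powi m)" if "int d dvd m"
  proof (cases "m \<ge> 0")
    case False
    then have "ord_ge z 1 (1 - q powi (- m))" using that by (intro 1) auto
    then have "ord_ge z 1 (- (q powi m) * (1 - q powi (- m)))"
      by (intro ord_ge_scale ord_ge_uminus) auto
    then show ?thesis using one_minus_q_powi_neg[of "- m"] by simp
  qed (use 1 that in auto)
  show "ord_ge z 0 (1 - q powi m)"
    by (intro ord_ge_diff) auto
qed

text \<open>
  For \<open>m = 0\<close> this holds by the convention \<open>1 / 0 = 0\<close>.
\<close>
lemma ord_ge_inverse_one_minus_q_powi:
  "ord_ge z (if int d dvd m then - 1 else 0) (1 / (1 - q powi m))"
proof -
  have 1: "ord_ge z (if int d dvd m then - 1 else 0) (1 / (1 - q powi m))" if "m > 0" for m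
  proof -
    define k where "k = nat m"
    have "m = int k" "k > 0" using that by (simp_all add: k_def)
    then show ?thesis using ord_ge_inverse_one_minus_q_power[of k] by simp
  qed
  consider "m > 0" | "m = 0" | "m < 0" by linarith
  then show ?thesis
  proof cases
    case 3
    then have "ord_ge z (if int d dvd (- m) then - 1 else 0) (1 / (1 - q powi (- m)))"
      by (intro 1) auto
    then have "ord_ge z (if int d dvd (- m) then - 1 else 0) (- (q powi (- m)) * (1 / (1 - q powi (- m))))"
      by (intro ord_ge_scale ord_ge_uminus) auto
    moreover have "- (q powi (- m)) * (1 / (1 - q powi (- m))) = 1 / (1 - q powi m)"
      unfolding one_minus_q_powi_neg[of m] by simp
    ultimately show ?thesis by simp
  qed (use 1 in auto)
qed

end

section \<open>A closed form for the deformed terminating series\<close>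

lemma q_powi_mult: "q powi a * q powi b = q powi (a + b)"
  by (simp add: power_int_add)

lemma neg_one_power_diff:
  assumes "j \<le> N"
  shows "(-1) ^ (N - j) = (-1) ^ N * (-1 :: 'a::comm_ring_1) ^ j"
proof -
  obtain i where N: "N = j + i" using assms le_Suc_ex by blast
  have "(-1) ^ N * (-1 :: 'a) ^ j = (-1) ^ i * ((-1) ^ j * (-1) ^ j)"
    by (simp only: N power_add mult_ac)
  also have "(-1) ^ j * (-1) ^ j = (1 :: 'a)"
    by (simp flip: power_mult_distrib)
  finally show ?thesis by (simp add: N)
qed

lemma neg_one_power_square: "(-1) ^ N * (-1) ^ N = (1 :: 'a::comm_ring_1)"
  by (simp flip: power_mult_distrib)

text \<open>
  The shifted factorial \<open>(q^c; q^4)_k\<close>. Its argument is the exponent \<open>c\<close>, because whether a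
  factor is nonzero, or vanishes at a root of unity, depends on the integers \<open>c + 4 j\<close>
  alone.
\<close>
definition fac :: "int \<Rightarrow> nat \<Rightarrow> ratfun" where
  "fac c k = (\<Prod>j<k. 1 - q powi (c + 4 * int j))"

lemma fac_0 [simp]: "fac c 0 = 1"
  by (simp add: fac_def)

lemma fac_Suc: "fac c (Suc k) = fac c k * (1 - q powi (c + 4 * int k))"
  by (simp add: fac_def)

lemma qpoch_eq_fac: "qpoch (q powi c) (q ^ 4) k = fac c k"
  by (simp add: fac_def qpoch_def power_int_add power_int_mult)

lemma fac_add: "fac c (j + k) = fac c j * fac (c + 4 * int j) k"
  by (induction k) (simp_all add: fac_Suc algebra_simps)

lemma fac_Suc_left: "fac c (Suc k) = (1 - q powi c) * fac (c + 4) k"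
  using fac_add[of c 1 k] by (simp add: fac_Suc)

lemma fac_neq_0: "(\<And>j. j < k \<Longrightarrow> c + 4 * int j \<noteq> 0) \<Longrightarrow> fac c k \<noteq> 0"
  by (auto simp: fac_def q_powi_eq_1_iff)

lemma fac_odd_neq_0: "odd c \<Longrightarrow> fac c k \<noteq> 0"
  by (rule fac_neq_0) presburger

lemma fac_pos_neq_0: "c > 0 \<Longrightarrow> fac c k \<noteq> 0"
  by (rule fac_neq_0) linarith

lemma q4_power_choose_two: "(q ^ 4) ^ (k choose 2) = q powi (2 * int k * (int k - 1))"
proof -
  have "int (k * k) = int (2 * (k choose 2) + k)"
    by (simp only: square_eq_choose_two)
  then have "2 * int k * (int k - 1) = int (4 * (k choose 2))"
    by (simp add: algebra_simps)
  then show ?thesis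
    by (simp only: power_int_of_nat power_mult)
qed

lemma fac_reverse:
  assumes "c + c' = 4 - 4 * int k"
  shows "fac c k = (-1) ^ k * q powi (- (int k * (c' + 2 * (int k - 1)))) * fac c' k"
proof -
  have "q powi c * q powi c' * (q ^ 4) ^ k = q powi (c + c' + 4 * int k)"
    by (simp add: power_int_add power_int_mult)
  also have "\<dots> = q ^ 4"
    using assms by simp
  finally have "(q powi c') ^ k * (q ^ 4) ^ (k choose 2) * qpoch (q powi c) (q ^ 4) k
      = (-1) ^ k * qpoch (q powi c') (q ^ 4) k"
    by (intro qpoch_reverse) auto
  moreover have "(q powi c') ^ k * (q ^ 4) ^ (k choose 2) = q powi (int k * (c' + 2 * (int k - 1)))"
    unfolding q4_power_choose_two power_int_power'
    unfolding q_powi_mult by (simp add: algebra_simps)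
  ultimately have *: "q powi (int k * (c' + 2 * (int k - 1))) * fac c k = (-1) ^ k * fac c' k"
    by (simp add: qpoch_eq_fac)
  have "fac c k = q powi (- (int k * (c' + 2 * (int k - 1)))) * (q powi (int k * (c' + 2 * (int k - 1))) * fac c k)"
    unfolding mult.assoc[symmetric] q_powi_mult by simp
  then show ?thesis
    unfolding * by (simp only: mult_ac)
qed

text \<open>
  The summand of the theorem is \<open>coef k * (pair 0 k)\<^sup>2\<close>. In \<open>pair e k\<close>, two of the
  parameters \<open>q^(-1)\<close> are deformed to \<open>q^(e-1)\<close> and \<open>q^(-e-1)\<close>.
\<close>
definition coef :: "nat \<Rightarrow> ratfun" where
  "coef k = qint (8 * int k - 1) * fac (- 1) k * fac 2 k / (fac 4 k * fac 1 k) * q ^ (8 * k)"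

definition pair :: "int \<Rightarrow> nat \<Rightarrow> ratfun" where
  "pair e k = fac (e - 1) k * fac (- e - 1) k / (fac (4 - e) k * fac (4 + e) k)"

text \<open>
  The numerator of the 4phi3 summand, apart from \<open>1 - q^(4j+1)\<close>, once \<open>(q^(2-e);q^4)_(N-j)\<close>
  has been reversed and cancelled against \<open>(q;q^4)_N\<close>.
\<close>
definition saal_coef :: "int \<Rightarrow> nat \<Rightarrow> ratfun" where
  "saal_coef e j = (-1) ^ j * q powi (2 * int j * int j + int j - e * int j) * fac (e - 1) j * fac 2 j"

text \<open>
  Watson's transformation in base \<open>p = q^4\<close> with \<open>a = q^(-1)\<close>, first pair of parameters
  \<open>q^(f-1), q^(-f-1)\<close>, second pair \<open>q^(e-1), q^2\<close>, and \<open>q^(-e-1) = p^(-N)\<close> as the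
  terminating parameter. Then \<open>g = q^5\<close> and \<open>h = q^(2-e)\<close>, and the second pair contributes
  the denominators \<open>(q)_N\<close> and \<open>(q^(4-e))_N\<close>. So \<open>(q^5)_j / (q)_j\<close> reduces to one factor,
  and the quotient \<open>(q^3)_N / (q^(4-e))_N\<close> in front reduces to \<open>[e]\<close> times a monomial.
\<close>
lemma sum_coef_pair_pair:
  assumes N: "4 * int N = e + 1" and f: "odd f \<or> f = 0"
  shows "(\<Sum>k\<le>N. coef k * pair e k * pair f k)
       = qint e / (1 - q) * q powi (- 2 * int N) * fac 4 N
         * (\<Sum>j\<le>N. (1 - q powi (4 * int j + 1)) * saal_coef e j
                / (fac 4 j * fac (4 + f) j * fac (4 - f) j * fac 4 (N - j)))"
proof -
  have e: "e = 4 * int N - 1" using N by simp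
  have odd_e: "odd e" unfolding e by presburger
  have f_neq_0: "fac (4 + f) k \<noteq> 0" "fac (4 - f) k \<noteq> 0" for k
    using f fac_odd_neq_0[of "4 + f" k] fac_odd_neq_0[of "4 - f" k] fac_pos_neq_0[of 4 k] by auto
  have q1: "1 - q \<noteq> 0" using q_neq_1 by simp
  have q4: "q ^ 4 = q powi 4" by simp
  \<comment> \<open>Up to 1 - q, a sign and a monomial, this turns 1 / ((a)_(N+k+1) (p)_(N-k)) into (p^(-N))_k / (a p^(N+1))_k.\<close>
  define \<kappa> where "\<kappa> = fac 4 N * fac (- 1) (N + 1) / (1 - q)"
  let ?W = "\<lambda>k. (1 - q powi (- 1) * (q ^ 4) ^ (2 * k)) * fac (- 1) k * (-1) ^ k * (q ^ 4) ^ (k choose 2)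
              * (fac (e - 1) k * fac 2 k * (q powi (2 - e)) ^ k)
              / (fac 4 k * fac 1 k * fac (4 - e) k
                 * (fac (- 1) (N + k + 1) * fac 4 (N - k)))
              * (fac (f - 1) k * fac (- f - 1) k * (q powi 5) ^ k / (fac (4 + f) k * fac (4 - f) k))"
  have watson: "(\<Sum>k\<le>N. ?W k)
       = (\<Sum>j\<le>N. fac 5 j * fac (e - 1) j * fac 2 j * (q powi (2 - e)) ^ j * fac (2 - e) (N - j)
              / (fac 4 j * fac (4 + f) j * fac (4 - f) j * fac 4 (N - j)))
         / (fac 1 N * fac (4 - e) N)"
  proof -
    have params: "q powi (f - 1) * q powi 5 = q powi (4 + f)" "q powi (- f - 1) * q powi 5 = q powi (4 - f)"
       "q powi (e - 1) * q powi (2 - e) = q powi 1" "q powi 2 * q powi (2 - e) = q powi (4 - e)"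
       "q powi (- 1) * q ^ 4 = q powi (f - 1) * q powi (- f - 1) * q powi 5"
       "q powi (- 1) * q ^ 4 = q powi (e - 1) * q powi 2 * q powi (2 - e)"
      unfolding q4 q_powi_mult by simp_all
    have "qpoch (q ^ 4) (q ^ 4) k = fac 4 k" for k
      using qpoch_eq_fac[of 4 k] by simp
    then show ?thesis
      using watson_transformation[OF params(5,6), of N] fac_odd_neq_0[of "- 1"] fac_odd_neq_0[of 1]
        fac_odd_neq_0[of "4 - e"] fac_pos_neq_0[of 4] f_neq_0 odd_e
      by (simp only: params(1-4) qpoch_eq_fac) simp
  qed
  have lhs: "\<kappa> * ?W k = coef k * pair e k * pair f k" if "k \<le> N" for k
  proof -
    have c': "fac 4 N = fac 4 (N - k) * fac (4 + 4 * int (N - k)) k"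
      using fac_add[of 4 "N - k" k] that by simp
    have rev: "fac (- e - 1) k = (-1) ^ k * q powi (- (int k * (4 + 4 * int (N - k) + 2 * (int k - 1))))
        * fac (4 + 4 * int (N - k)) k"
      by (rule fac_reverse) (use e that in \<open>simp add: of_nat_diff\<close>)
    have add: "fac (- 1) (N + k + 1) = fac (- 1) (N + 1) * fac (4 + e) k"
      using fac_add[of "- 1" "N + 1" k] by (simp add: e algebra_simps)
    have pw: "(q ^ 4) ^ (k choose 2) * (q powi (2 - e)) ^ k * (q powi 5) ^ k
       = q ^ (8 * k) * q powi (- (int k * (4 + 4 * int (N - k) + 2 * (int k - 1))))"
    proof -
      have q8: "q ^ (8 * k) = q powi (8 * int k)" by (simp flip: power_int_of_nat)
      show ?thesis
        unfolding q8 q4_power_choose_two power_int_power' q_powi_mult e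
        by (intro arg_cong[where f = "power_int q"]) (use that in \<open>simp add: of_nat_diff algebra_simps\<close>)
    qed
    have one: "q powi (- 1) * (q ^ 4) ^ (2 * k) = q powi (8 * int k - 1)"
      unfolding q4 power_int_power' q_powi_mult by simp
    have "\<kappa> * ?W k = (1 - q powi (8 * int k - 1)) / (1 - q)
        * (fac (- 1) k * fac 2 k / (fac 4 k * fac 1 k)) * (fac (e - 1) k / (fac (4 - e) k * fac (4 + e) k))
        * (((q ^ 4) ^ (k choose 2) * (q powi (2 - e)) ^ k * (q powi 5) ^ k) * (-1) ^ k * fac (4 + 4 * int (N - k)) k)
        * pair f k"
      unfolding one \<kappa>_def add c' pair_def
      using fac_odd_neq_0[of "- 1" "N + 1"] fac_pos_neq_0[of 4 "N - k"] by (simp add: mult_ac)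
    also have "\<dots> = (1 - q powi (8 * int k - 1)) / (1 - q)
        * (fac (- 1) k * fac 2 k / (fac 4 k * fac 1 k)) * (fac (e - 1) k / (fac (4 - e) k * fac (4 + e) k))
        * (q ^ (8 * k) * fac (- e - 1) k) * pair f k"
      unfolding pw rev by (simp only: mult_ac)
    also have "\<dots> = coef k * pair e k * pair f k"
      by (simp add: coef_def pair_def qint_def mult_ac)
    finally show ?thesis .
  qed
  have rhs: "\<kappa> * (fac 5 j * fac (e - 1) j * fac 2 j * (q powi (2 - e)) ^ j * fac (2 - e) (N - j)
              / (fac 4 j * fac (4 + f) j * fac (4 - f) j * fac 4 (N - j))
         / (fac 1 N * fac (4 - e) N))
     = qint e / (1 - q) * q powi (- 2 * int N) * fac 4 N
         * ((1 - q powi (4 * int j + 1)) * saal_coef e j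
                / (fac 4 j * fac (4 + f) j * fac (4 - f) j * fac 4 (N - j)))" if "j \<le> N" for j
  proof -
    have r1: "fac (2 - e) (N - j) = (-1) ^ (N - j) * q powi (- (int (N - j) * (1 + 4 * int j + 2 * (int (N - j) - 1))))
        * fac (1 + 4 * int j) (N - j)"
      by (rule fac_reverse) (use e that in \<open>simp add: of_nat_diff\<close>)
    have s1: "fac 1 N = fac 1 j * fac (1 + 4 * int j) (N - j)"
      using fac_add[of 1 j "N - j"] that by simp
    have r2: "fac (4 - e) N = (-1) ^ N * q powi (- (int N * (- 1 + 2 * (int N - 1)))) * fac (- 1) N"
      by (rule fac_reverse) (simp add: e)
    have s2: "fac (- 1) (N + 1) = fac (- 1) N * (1 - q powi e)"
      by (simp add: fac_Suc e)
    have s3: "fac 5 j * (1 - q) = fac 1 j * (1 - q powi (4 * int j + 1))"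
      using fac_Suc[of 1 j] fac_Suc_left[of 1 j] by (simp add: mult_ac add_ac)
    have sgn: "(-1) ^ (N - j) = (-1) ^ N * (-1 :: ratfun) ^ j"
      by (rule neg_one_power_diff[OF that])
    define E1 where "E1 = - (int (N - j) * (1 + 4 * int j + 2 * (int (N - j) - 1)))"
    define E2 where "E2 = - (int N * (- 1 + 2 * (int N - 1)))"
    have "E1 + (2 - e) * int j = - 2 * int N + (2 * int j * int j + int j - e * int j) + E2"
      using that by (simp add: E1_def E2_def of_nat_diff algebra_simps)
    then have pw: "q powi E1 * (q powi (2 - e)) ^ j = q powi (- 2 * int N) * q powi (2 * int j * int j + int j - e * int j) * q powi E2"
      unfolding power_int_power' q_powi_mult by simp
    have "fac 5 j / fac 1 j = (1 - q powi (4 * int j + 1)) / (1 - q)"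
      using s3 q1 fac_pos_neq_0[of 1 j] by (simp add: field_simps)
    moreover have "\<kappa> * (fac 5 j * fac (e - 1) j * fac 2 j * (q powi (2 - e)) ^ j * fac (2 - e) (N - j)
              / (fac 4 j * fac (4 + f) j * fac (4 - f) j * fac 4 (N - j))
         / (fac 1 N * fac (4 - e) N))
      = fac 4 N * (1 - q powi e) / (1 - q) * (fac 5 j / fac 1 j) * fac (e - 1) j * fac 2 j * (-1) ^ j
         * (q powi E1 * (q powi (2 - e)) ^ j) / q powi E2
         / (fac 4 j * fac (4 + f) j * fac (4 - f) j * fac 4 (N - j))"
      unfolding \<kappa>_def s1 s2 r1 r2 sgn E1_def[symmetric] E2_def[symmetric]
      using fac_odd_neq_0[of "- 1" N] fac_pos_neq_0[of "1 + 4 * int j" "N - j"] by (simp add: mult_ac)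
    ultimately show ?thesis
      unfolding pw by (simp add: saal_coef_def qint_def mult_ac)
  qed
  have "(\<Sum>k\<le>N. coef k * pair e k * pair f k) = \<kappa> * (\<Sum>k\<le>N. ?W k)"
    unfolding sum_distrib_left by (rule sum.cong[OF refl]) (simp only: lhs atMost_iff)
  also have "\<dots> = (\<Sum>j\<le>N. qint e / (1 - q) * q powi (- 2 * int N) * fac 4 N
         * ((1 - q powi (4 * int j + 1)) * saal_coef e j
                / (fac 4 j * fac (4 + f) j * fac (4 - f) j * fac 4 (N - j))))"
    unfolding watson sum_divide_distrib sum_distrib_left by (rule sum.cong[OF refl]) (simp only: rhs atMost_iff)
  finally show ?thesis
    unfolding sum_distrib_left .
qed


text \<open>
  The factor \<open>1 - q^(e-1+4j)\<close> is absorbed into \<open>(q^(e-1))_j\<close>, raising that parameter to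
  \<open>q^(e+3)\<close>; this makes the series balanced.
\<close>
lemma saal_sum_upper:
  assumes N: "4 * int N = e + 1"
  shows "(\<Sum>j\<le>N. (1 - q powi (e - 1 + 4 * int j)) * saal_coef e j / (fac 4 j ^ 3 * fac 4 (N - j)))
       = (1 - q powi (e - 1)) * q powi (2 * int N) * fac 2 N ^ 2 / fac 4 N ^ 3"
proof -
  have e: "e = 4 * int N - 1" using N by simp
  define E where "E = - (int N * (4 + 2 * (int N - 1)))"
  have saal: "(\<Sum>j\<le>N. fac (e + 3) j * fac 2 j * (q powi (- 1 - e)) ^ j * fac (- 1 - e) (N - j)
              / (fac 4 j * fac 4 j * fac 4 (N - j))) = fac 2 N * fac (1 - e) N / (fac 4 N * fac 4 N)"
  proof -
    have params: "q powi (e + 3) * q powi 2 * q powi (- 1 - e) = q powi 4"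
       "q powi (e + 3) * q powi (- 1 - e) = q powi 2" "q powi 2 * q powi (- 1 - e) = q powi (1 - e)"
      unfolding q_powi_mult by simp_all
    have "qpoch (q ^ 4) (q ^ 4) k = fac 4 k" for k
      using qpoch_eq_fac[of 4 k] by simp
    then show ?thesis
      using q_saalschuetz[of "q ^ 4" "q powi (e + 3)" "q powi 2" "q powi (- 1 - e)" N] fac_pos_neq_0[of 4]
      by (simp only: params qpoch_eq_fac) simp
  qed
  have term_eq: "(1 - q powi (e - 1 + 4 * int j)) * saal_coef e j / (fac 4 j ^ 3 * fac 4 (N - j))
    = (1 - q powi (e - 1)) * (-1) ^ N / q powi E / fac 4 N
       * (fac (e + 3) j * fac 2 j * (q powi (- 1 - e)) ^ j * fac (- 1 - e) (N - j)
              / (fac 4 j * fac 4 j * fac 4 (N - j)))" if "j \<le> N" for j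
  proof -
    define F where "F = - (int (N - j) * (4 + 4 * int j + 2 * (int (N - j) - 1)))"
    have r: "fac (- 1 - e) (N - j) = (-1) ^ (N - j) * q powi F * fac (4 + 4 * int j) (N - j)"
      unfolding F_def by (rule fac_reverse) (use e that in \<open>simp add: of_nat_diff\<close>)
    have s: "fac 4 N = fac 4 j * fac (4 + 4 * int j) (N - j)"
      using fac_add[of 4 j "N - j"] that by simp
    have sgn: "(-1) ^ N * (-1) ^ (N - j) = (-1 :: ratfun) ^ j"
      unfolding neg_one_power_diff[OF that] by (simp add: neg_one_power_square flip: mult.assoc)
    have shift: "(1 - q powi (e - 1 + 4 * int j)) * fac (e - 1) j = (1 - q powi (e - 1)) * fac (e + 3) j"
      using fac_Suc[of "e - 1" j] fac_Suc_left[of "e - 1" j] by (simp add: mult_ac add_ac)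
    have "F + (- 1 - e) * int j = (2 * int j * int j + int j - e * int j) + E"
      using that by (simp add: E_def F_def of_nat_diff e algebra_simps)
    then have pw: "q powi F * (q powi (- 1 - e)) ^ j = q powi (2 * int j * int j + int j - e * int j) * q powi E"
      unfolding power_int_power' q_powi_mult by simp
    have "(1 - q powi (e - 1)) * (-1) ^ N / q powi E / fac 4 N
       * (fac (e + 3) j * fac 2 j * (q powi (- 1 - e)) ^ j * fac (- 1 - e) (N - j)
              / (fac 4 j * fac 4 j * fac 4 (N - j)))
      = ((1 - q powi (e - 1)) * fac (e + 3) j) * ((-1) ^ N * (-1) ^ (N - j)) * (q powi F * (q powi (- 1 - e)) ^ j) / q powi E
         * fac 2 j / (fac 4 j ^ 3 * fac 4 (N - j))"
      unfolding r s using fac_pos_neq_0[of "4 + 4 * int j" "N - j"]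
      by (simp add: power3_eq_cube mult_ac)
    also have "\<dots> = (1 - q powi (e - 1 + 4 * int j)) * saal_coef e j / (fac 4 j ^ 3 * fac 4 (N - j))"
      unfolding shift[symmetric] sgn pw by (simp add: saal_coef_def mult_ac)
    finally show ?thesis by simp
  qed
  have "fac (1 - e) N = (-1) ^ N * q powi (- (int N * (2 + 2 * (int N - 1)))) * fac 2 N"
    by (rule fac_reverse) (simp add: e)
  moreover have "q powi (- (int N * (2 + 2 * (int N - 1)))) = q powi (2 * int N) * q powi E"
    unfolding q_powi_mult by (simp add: E_def algebra_simps)
  moreover have "(-1) ^ N * (-1) ^ N = (1 :: ratfun)"
    by (simp flip: power_mult_distrib)
  ultimately have fin: "(1 - q powi (e - 1)) * (-1) ^ N / q powi E / fac 4 N * (fac 2 N * fac (1 - e) N / (fac 4 N * fac 4 N))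
      = (1 - q powi (e - 1)) * q powi (2 * int N) * fac 2 N ^ 2 / fac 4 N ^ 3"
    by (simp add: power2_eq_square power3_eq_cube mult_ac)
  show ?thesis
    unfolding fin[symmetric] saal[symmetric] sum_distrib_left
    by (rule sum.cong[OF refl]) (simp only: term_eq atMost_iff)
qed

text \<open>
  Here \<open>1 - q^(4j)\<close> cancels a factor of \<open>(q^4)_j\<close>. The term \<open>j = 0\<close> drops out, and after a
  shift of the index the other parameters are multiplied by \<open>p = q^4\<close>, so that the series is
  again balanced.
\<close>
lemma saal_sum_lower:
  assumes N: "4 * int N = e + 1" and "N > 0"
  shows "(\<Sum>j\<le>N. (1 - q powi (4 * int j)) * saal_coef e j / (fac 4 j ^ 3 * fac 4 (N - j)))
       = (1 - q powi 2) * (1 - q powi (e + 1)) * q powi (2 * int N - 1 - e) * fac 2 N ^ 2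
          / (fac 4 N ^ 3 * (1 - q powi (1 - e)))"
proof -
  obtain M where M: "N = Suc M" using \<open>N > 0\<close> gr0_implies_Suc by blast
  have e: "e = 4 * int M + 3" using N by (simp add: M)
  have nz: "1 - q powi m \<noteq> 0" if "m \<noteq> 0" for m
    using that q_powi_eq_1_iff[of m] by auto
  define E where "E = - (int M * (8 + 2 * (int M - 1)))"
  have saal: "(\<Sum>i\<le>M. fac (e + 3) i * fac 6 i * (q powi (- 1 - e)) ^ i * fac (- 1 - e) (M - i)
              / (fac 4 i * fac 8 i * fac 4 (M - i))) = fac 2 M * fac (5 - e) M / (fac 4 M * fac 8 M)"
  proof -
    have params: "q powi (e + 3) * q powi 6 * q powi (- 1 - e) = q powi 8"
       "q powi (e + 3) * q powi (- 1 - e) = q powi 2" "q powi 6 * q powi (- 1 - e) = q powi (5 - e)"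
      unfolding q_powi_mult by simp_all
    have "qpoch (q ^ 4) (q ^ 4) k = fac 4 k" for k
      using qpoch_eq_fac[of 4 k] by simp
    then show ?thesis
      using q_saalschuetz[of "q ^ 4" "q powi (e + 3)" "q powi 6" "q powi (- 1 - e)" M]
        fac_pos_neq_0[of 4] fac_pos_neq_0[of 8]
      by (simp only: params qpoch_eq_fac) simp
  qed
  let ?C = "- ((1 - q powi (e - 1)) * (1 - q powi 2) / (1 - q powi 4)) * q powi (3 - e) * (-1) ^ M / q powi E / fac 4 N"
  have term_eq: "(1 - q powi (4 * int (Suc i))) * saal_coef e (Suc i) / (fac 4 (Suc i) ^ 3 * fac 4 (N - Suc i))
    = ?C * (fac (e + 3) i * fac 6 i * (q powi (- 1 - e)) ^ i * fac (- 1 - e) (M - i)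
              / (fac 4 i * fac 8 i * fac 4 (M - i)))" if "i \<le> M" for i
  proof -
    define F where "F = - (int (M - i) * (8 + 4 * int i + 2 * (int (M - i) - 1)))"
    have r: "fac (- 1 - e) (M - i) = (-1) ^ (M - i) * q powi F * fac (8 + 4 * int i) (M - i)"
      unfolding F_def by (rule fac_reverse) (use e that in \<open>simp add: of_nat_diff\<close>)
    have s: "fac 4 N = (1 - q powi 4) * fac 8 i * fac (8 + 4 * int i) (M - i)"
      using fac_add[of 8 i "M - i"] that by (simp add: M fac_Suc_left)
    have sgn: "(-1) ^ M * (-1) ^ (M - i) = (-1 :: ratfun) ^ i"
      unfolding neg_one_power_diff[OF that] by (simp add: neg_one_power_square flip: mult.assoc)
    have fac4: "fac 4 (Suc i) = (1 - q powi 4) * fac 8 i" "fac 4 (Suc i) = fac 4 i * (1 - q powi (4 * int (Suc i)))"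
      using fac_Suc[of 4 i] by (simp_all add: fac_Suc_left algebra_simps)
    have num: "fac (e - 1) (Suc i) = (1 - q powi (e - 1)) * fac (e + 3) i" "fac 2 (Suc i) = (1 - q powi 2) * fac 6 i"
      by (simp_all add: fac_Suc_left add.commute)
    have "F + (- 1 - e) * int i + (3 - e) = (2 * int (Suc i) * int (Suc i) + int (Suc i) - e * int (Suc i)) + E"
      using that by (simp add: E_def F_def of_nat_diff e algebra_simps)
    then have pw: "q powi F * (q powi (- 1 - e)) ^ i * q powi (3 - e)
       = q powi (2 * int (Suc i) * int (Suc i) + int (Suc i) - e * int (Suc i)) * q powi E"
      unfolding power_int_power' q_powi_mult by (simp only:)
    have "?C * (fac (e + 3) i * fac 6 i * (q powi (- 1 - e)) ^ i * fac (- 1 - e) (M - i)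
              / (fac 4 i * fac 8 i * fac 4 (M - i)))
      = - (((1 - q powi (e - 1)) * fac (e + 3) i) * ((1 - q powi 2) * fac 6 i)
         * ((-1) ^ M * (-1) ^ (M - i)) * (q powi F * (q powi (- 1 - e)) ^ i * q powi (3 - e)) / q powi E
         / (((1 - q powi 4) * fac 8 i) ^ 2 * fac 4 i * fac 4 (N - Suc i)))"
      unfolding r s using fac_pos_neq_0[of "8 + 4 * int i" "M - i"]
      by (simp add: M power2_eq_square mult_ac)
    also have "\<dots> = - (fac (e - 1) (Suc i) * fac 2 (Suc i) * (-1) ^ i
          * q powi (2 * int (Suc i) * int (Suc i) + int (Suc i) - e * int (Suc i))
          / (fac 4 (Suc i) ^ 2 * fac 4 i * fac 4 (N - Suc i)))"
      unfolding pw sgn num[symmetric] fac4(1)[symmetric] by simp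
    also have "\<dots> = - (fac (e - 1) (Suc i) * fac 2 (Suc i) * (-1) ^ i * (1 - q powi (4 * int (Suc i)))
          * q powi (2 * int (Suc i) * int (Suc i) + int (Suc i) - e * int (Suc i))
          / (fac 4 (Suc i) ^ 3 * fac 4 (N - Suc i)))"
    proof -
      have "fac 4 (Suc i) ^ 3 = fac 4 (Suc i) ^ 2 * fac 4 i * (1 - q powi (4 * int (Suc i)))"
        unfolding power3_eq_cube power2_eq_square mult.assoc fac4(2)[symmetric] ..
      then show ?thesis
        using nz[of "4 * int (Suc i)"] by (simp add: mult_ac)
    qed
    also have "\<dots> = (1 - q powi (4 * int (Suc i))) * saal_coef e (Suc i) / (fac 4 (Suc i) ^ 3 * fac 4 (N - Suc i))"
      by (simp only: saal_coef_def power_Suc) (simp add: mult_ac)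
    finally show ?thesis by simp
  qed
  have "(\<Sum>j\<le>N. (1 - q powi (4 * int j)) * saal_coef e j / (fac 4 j ^ 3 * fac 4 (N - j)))
     = (\<Sum>i\<le>M. (1 - q powi (4 * int (Suc i))) * saal_coef e (Suc i) / (fac 4 (Suc i) ^ 3 * fac 4 (N - Suc i)))"
    unfolding M sum.atMost_Suc_shift by simp
  also have "\<dots> = ?C * (fac 2 M * fac (5 - e) M / (fac 4 M * fac 8 M))"
    unfolding saal[symmetric] sum_distrib_left
    by (rule sum.cong[OF refl]) (simp only: term_eq atMost_iff)
  also have "\<dots> = (1 - q powi 2) * (1 - q powi (e + 1)) * q powi (2 * int N - 1 - e) * fac 2 N ^ 2
          / (fac 4 N ^ 3 * (1 - q powi (1 - e)))"
  proof -
    define R where "R = - (int N * (2 + 2 * (int N - 1)))"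
    have rev: "fac (1 - e) N = (-1) ^ N * q powi R * fac 2 N"
      unfolding R_def by (rule fac_reverse) (simp add: e M)
    have a: "fac (1 - e) N = (1 - q powi (1 - e)) * fac (5 - e) M" "fac 4 N = (1 - q powi 4) * fac 8 M"
       "fac 4 N = fac 4 M * (1 - q powi (e + 1))" "fac 2 N = fac 2 M * (1 - q powi (e - 1))"
    proof -
      show "fac (1 - e) N = (1 - q powi (1 - e)) * fac (5 - e) M" "fac 4 N = (1 - q powi 4) * fac 8 M"
        by (simp_all add: M fac_Suc_left)
      have "e + 1 = 4 + 4 * int M" "e - 1 = 2 + 4 * int M" using e by simp_all
      then show "fac 4 N = fac 4 M * (1 - q powi (e + 1))" "fac 2 N = fac 2 M * (1 - q powi (e - 1))"
        unfolding M fac_Suc by (simp_all only:)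
    qed
    have pw: "q powi R * q powi (3 - e) = q powi (2 * int N - 1 - e) * q powi E"
      unfolding q_powi_mult by (simp add: R_def E_def M algebra_simps)
    have "fac (5 - e) M = (-1) ^ N * q powi R * fac 2 N / (1 - q powi (1 - e))"
      using rev a(1) nz[of "1 - e"] e by (simp add: field_simps)
    moreover have "fac 8 M = fac 4 N / (1 - q powi 4)"
      unfolding a(2) using nz[of 4] by simp
    moreover have "fac 4 M = fac 4 N / (1 - q powi (e + 1))"
      unfolding a(3) using nz[of "e + 1"] e by simp
    moreover have "fac 2 M = fac 2 N / (1 - q powi (e - 1))"
      unfolding a(4) using nz[of "e - 1"] e by simp
    ultimately have "?C * (fac 2 M * fac (5 - e) M / (fac 4 M * fac 8 M))
       = - ((-1) ^ M * (-1) ^ N) * (1 - q powi 2) * (1 - q powi (e + 1)) * (q powi R * q powi (3 - e)) / q powi E * fac 2 N ^ 2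
          / (fac 4 N ^ 3 * (1 - q powi (1 - e)))"
      using nz[of 4] nz[of "e + 1"] nz[of "e - 1"] e by (simp add: power2_eq_square power3_eq_cube mult_ac)
    also have "- ((-1) ^ M * (-1) ^ N) = (1 :: ratfun)"
      by (simp add: M flip: power_mult_distrib)
    finally show ?thesis unfolding pw by simp
  qed
  finally show ?thesis .
qed


text \<open>
  What remains of the closed form once \<open>[e]\<close> and the squared quotient of shifted factorials
  have been split off; \<open>x\<close> stands for \<open>q^e\<close>.
\<close>
definition main_factor :: "ratfun \<Rightarrow> ratfun" where
  "main_factor x = 1 - (q\<^sup>2 - x) * (1 + q) * (1 - x * q) / (q * (x - q)\<^sup>2)"

text \<open>
  The factor \<open>1 - q^(4j+1)\<close> in Watson's transformation is a linear combination of
  \<open>1 - q^(e-1+4j)\<close> and \<open>1 - q^(4j)\<close>, for which the sum is known.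
\<close>
lemma sum_coef_pair_closed_form:
  assumes N: "4 * int N = e + 1" and "N > 0"
  shows "(\<Sum>k\<le>N. coef k * pair e k * pair 0 k)
       = qint e * (fac 2 N / fac 4 N) ^ 2 * main_factor (q powi e)"
proof -
  define x where "x = q powi e"
  define A where "A = q powi (e - 1)"
  define Z where "Z = q powi (2 * int N) * fac 2 N ^ 2 / fac 4 N ^ 3"
  have e: "e = 4 * int N - 1" "e \<ge> 3" using N \<open>N > 0\<close> by auto
  have nz: "1 - q powi m \<noteq> 0" if "m \<noteq> 0" for m
    using that q_powi_eq_1_iff[of m] by auto
  have [simp]: "x \<noteq> 0" by (simp add: x_def)
  have qpw: "q powi (1 - e) = q / x" "q powi (e + 1) = x * q" "A = x / q"
    "q powi (2 * int N - 1 - e) = q powi (2 * int N) / (q * x)"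
    by (simp_all add: x_def A_def power_int_diff power_int_add)
  have A1: "1 - A \<noteq> 0" unfolding A_def by (rule nz) (use e in simp)
  have q1: "1 - q \<noteq> 0" using q_neq_1 by simp
  have xq: "x - q \<noteq> 0" using A1 by (auto simp: qpw)
  have split: "1 - q powi (4 * int j + 1) = (1 - q) / (1 - A) * (1 - q powi (e - 1 + 4 * int j))
      + (q - A) / (1 - A) * (1 - q powi (4 * int j))" for j
  proof -
    define K where "K = q powi (4 * int j)"
    have "q powi (4 * int j + 1) = K * q" "q powi (e - 1 + 4 * int j) = A * K"
      unfolding K_def A_def q_powi_mult by (simp_all add: power_int_add)
    moreover have "1 - K * q = (1 - q) / (1 - A) * (1 - A * K) + (q - A) / (1 - A) * (1 - K)"
      using A1 by (simp add: divide_simps) (simp add: algebra_simps)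
    ultimately show ?thesis by (simp only: K_def)
  qed
  let ?u = "\<lambda>j. saal_coef e j / (fac 4 j ^ 3 * fac 4 (N - j))"
  have "(\<Sum>j\<le>N. (1 - q powi (4 * int j + 1)) * saal_coef e j / (fac 4 j * fac (4 + 0) j * fac (4 - 0) j * fac 4 (N - j)))
     = (\<Sum>j\<le>N. (1 - q) / (1 - A) * ((1 - q powi (e - 1 + 4 * int j)) * saal_coef e j / (fac 4 j ^ 3 * fac 4 (N - j)))
         + (q - A) / (1 - A) * ((1 - q powi (4 * int j)) * saal_coef e j / (fac 4 j ^ 3 * fac 4 (N - j))))"
    unfolding split by (intro sum.cong refl)
      (simp only: power3_eq_cube mult.assoc distrib_right add_divide_distrib times_divide_eq_right add_0_right diff_0_right)
  also have "\<dots> = (1 - q) / (1 - A) * ((1 - A) * Z)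
     + (q - A) / (1 - A) * ((1 - q powi 2) * (1 - q powi (e + 1)) * q powi (2 * int N - 1 - e) * fac 2 N ^ 2
          / (fac 4 N ^ 3 * (1 - q powi (1 - e))))"
    unfolding sum.distrib sum_distrib_left[symmetric] saal_sum_upper[OF N] saal_sum_lower[OF assms]
    by (simp add: Z_def A_def)
  also have "\<dots> = Z * ((1 - q) + (q - A) / (1 - A) * ((1 - q\<^sup>2) * (1 - x * q) / (q * x * (1 - q / x))))"
  proof -
    have "(1 - q) / (1 - A) * ((1 - A) * Z) = Z * (1 - q)"
      using A1 by simp
    moreover have "(q - A) / (1 - A) * ((1 - q powi 2) * (1 - q powi (e + 1)) * q powi (2 * int N - 1 - e) * fac 2 N ^ 2
          / (fac 4 N ^ 3 * (1 - q powi (1 - e))))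
      = Z * ((q - A) / (1 - A) * ((1 - q\<^sup>2) * (1 - x * q) / (q * x * (1 - q / x))))"
      unfolding qpw(1,2,4) Z_def by (simp add: mult_ac)
    ultimately show ?thesis
      by (simp only: distrib_left)
  qed
  also have "(q - A) / (1 - A) = (q\<^sup>2 - x) / (q - x)"
    using A1 xq unfolding qpw(3) by (simp add: divide_simps power2_eq_square)
  also have "q * x * (1 - q / x) = q * (x - q)"
    by (simp add: field_simps)
  also have "(1 - q) + (q\<^sup>2 - x) / (q - x) * ((1 - q\<^sup>2) * (1 - x * q) / (q * (x - q))) = (1 - q) * main_factor x"
  proof -
    have *: "s / - y * (u * t * w / (r * y)) = - (u * (s * t * w / (r * y\<^sup>2)))" for s t u w r y :: ratfun
      by (simp add: power2_eq_square mult_ac)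
    have "q - x = - (x - q)" by simp
    moreover have "(1 - q\<^sup>2) = (1 - q) * (1 + q)" by (simp add: power2_eq_square algebra_simps)
    ultimately have "(q\<^sup>2 - x) / (q - x) * ((1 - q\<^sup>2) * (1 - x * q) / (q * (x - q)))
       = - ((1 - q) * ((q\<^sup>2 - x) * (1 + q) * (1 - x * q) / (q * (x - q)\<^sup>2)))"
      by (simp only: *)
    then show ?thesis
      by (simp only: main_factor_def) (simp only: right_diff_distrib mult_1_right add_uminus_conv_diff)
  qed
  finally have sum: "(\<Sum>j\<le>N. (1 - q powi (4 * int j + 1)) * saal_coef e j / (fac 4 j * fac (4 + 0) j * fac (4 - 0) j * fac 4 (N - j)))
     = Z * ((1 - q) * main_factor x)" .
  have "(\<Sum>k\<le>N. coef k * pair e k * pair 0 k)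
     = qint e / (1 - q) * q powi (- 2 * int N) * fac 4 N * (Z * ((1 - q) * main_factor x))"
    unfolding sum[symmetric] by (rule sum_coef_pair_pair[OF N]) simp
  also have "\<dots> = qint e * (q powi (- 2 * int N) * q powi (2 * int N)) * (fac 2 N / fac 4 N) ^ 2 * main_factor x"
    using q1 fac_pos_neq_0[of 4 N] by (simp add: Z_def power2_eq_square power3_eq_cube mult_ac)
  also have "q powi (- 2 * int N) * q powi (2 * int N) = 1"
    unfolding q_powi_mult by simp
  finally show ?thesis by (simp add: x_def)
qed

section \<open>The sum over the first period\<close>

definition summand :: "nat \<Rightarrow> ratfun" where
  "summand k = qint (8 * int k - 1) * fac (- 1) k ^ 5 * fac 2 k / (fac 4 k ^ 5 * fac 1 k) * q ^ (8 * k)"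

lemma summand_eq_coef_pair: "summand k = coef k * (pair 0 k * pair 0 k)"
  by (simp add: summand_def coef_def pair_def power_numeral_reduce mult_ac)

text \<open>
  The deformed sum terminates: the factor with \<open>j = N\<close> of \<open>(q^(-e-1);q^4)_k\<close> is identically
  zero.
\<close>
lemma pair_eq_0:
  assumes "4 * int N = e + 1" and "N < k"
  shows "pair e k = 0"
proof -
  have "fac (- e - 1) k = 0"
    unfolding fac_def using assms by (intro prod_zero) (auto intro!: bexI[of _ N])
  then show ?thesis by (simp add: pair_def)
qed

context odd_root_of_unity
begin

lemma dvd_4_mult_iff: "int d dvd 4 * i \<longleftrightarrow> int d dvd i"
proof -
  have "coprime (int d) (2 * 2)"
    using odd_d by (simp only: coprime_mult_right_iff) simp
  then show ?thesis
    by (simp add: coprime_dvd_mult_right_iff)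
qed

lemma dvd_progression_unique:
  assumes "int d dvd c + 4 * int i" and "int d dvd c + 4 * int j" and "i < d" and "j < d"
  shows "i = j"
proof -
  have "int d dvd 4 * (int i - int j)"
    using dvd_diff[OF assms(1,2)] by (simp add: algebra_simps)
  then have "int d dvd int i - int j"
    unfolding dvd_4_mult_iff .
  moreover have "\<bar>int i - int j\<bar> < int d"
    using assms(3,4) by linarith
  ultimately have "int i - int j = 0"
    using dvd_imp_le_int[of "int i - int j" "int d"] by linarith
  then show ?thesis by simp
qed

lemma ord_ge_qint: "ord_ge z 0 (qint m)" "int d dvd m \<Longrightarrow> ord_ge z 1 (qint m)"
proof -
  have "\<not> int d dvd 1" using d_gt_1 by simp
  then have "ord_ge z 0 (1 / (1 - q))"
    using ord_ge_inverse_one_minus_q_powi[of 1] by simp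
  then have *: "ord_ge z i (qint m)" if "ord_ge z i (1 - q powi m)" for i
    using ord_ge_scale[OF _ that, of "1 / (1 - q)"] by (simp add: qint_def)
  show "ord_ge z 0 (qint m)" and "int d dvd m \<Longrightarrow> ord_ge z 1 (qint m)"
    by (rule *, rule ord_ge_one_minus_q_powi, assumption?)+
qed

lemma ord_ge_fac: "ord_ge z 0 (fac c k)"
  unfolding fac_def by (intro ord_ge_prod ord_ge_one_minus_q_powi)

lemma ord_ge_inverse_fac:
  assumes "\<And>j. j < k \<Longrightarrow> \<not> int d dvd c + 4 * int j"
  shows "ord_ge z 0 (1 / fac c k)"
proof -
  have "1 / fac c k = (\<Prod>j<k. 1 / (1 - q powi (c + 4 * int j)))"
    by (simp add: fac_def prod_dividef)
  also have "ord_ge z 0 \<dots>"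
    using assms ord_ge_inverse_one_minus_q_powi by (intro ord_ge_prod) (metis lessThan_iff)
  finally show ?thesis .
qed

lemma fac_split:
  assumes "j < k"
  shows "fac c k = fac c j * (1 - q powi (c + 4 * int j)) * fac (c + 4 * int (Suc j)) (k - Suc j)"
  using fac_add[of c "Suc j" "k - Suc j"] assms by (simp add: fac_Suc)

lemma ord_ge_fac_1:
  assumes "j < k" and "int d dvd c + 4 * int j"
  shows "ord_ge z 1 (fac c k)"
proof -
  have "ord_ge z 1 ((fac c j * fac (c + 4 * int (Suc j)) (k - Suc j)) * (1 - q powi (c + 4 * int j)))"
    by (intro ord_ge_scale ord_ge_fac ord_ge_one_minus_q_powi assms)
  then show ?thesis
    by (simp add: fac_split[OF assms(1)] mult_ac)
qed

text \<open>
  Since 4 is invertible modulo \<open>d\<close>, at most one factor in a period vanishes at \<open>z\<close>, and its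
  zero is simple.
\<close>
lemma ord_ge_inverse_fac_minus_1:
  assumes "k \<le> d"
  shows "ord_ge z (- 1) (1 / fac c k)"
proof (cases "\<exists>j<k. int d dvd c + 4 * int j")
  case True
  then obtain j where j: "j < k" "int d dvd c + 4 * int j" by blast
  have other: "\<not> int d dvd c + 4 * int i" if "i < k" "i \<noteq> j" for i
    using dvd_progression_unique[OF j(2), of i] j(1) that assms by auto
  have "ord_ge z 0 (1 / fac c j)"
    by (rule ord_ge_inverse_fac) (use other j(1) in auto)
  moreover have "ord_ge z (- 1) (1 / (1 - q powi (c + 4 * int j)))"
    using ord_ge_inverse_one_minus_q_powi[of "c + 4 * int j"] j(2) by simp
  moreover have "ord_ge z 0 (1 / fac (c + 4 * int (Suc j)) (k - Suc j))"
  proof (rule ord_ge_inverse_fac)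
    fix i assume "i < k - Suc j"
    then show "\<not> int d dvd c + 4 * int (Suc j) + 4 * int i"
      using other[of "Suc j + i"] by (simp add: algebra_simps)
  qed
  ultimately have "ord_ge z (- 1) ((1 / fac c j) * ((1 / fac (c + 4 * int (Suc j)) (k - Suc j))
      * (1 / (1 - q powi (c + 4 * int j)))))"
    by (intro ord_ge_scale)
  then show ?thesis
    by (simp add: fac_split[OF j(1)] mult_ac)
next
  case False
  then have "ord_ge z 0 (1 / fac c k)"
    by (intro ord_ge_inverse_fac) auto
  then show ?thesis
    by (rule ord_ge_mono) simp
qed

lemma not_dvd_first_period:
  assumes "int d dvd e" and "j < k" and "k < d"
  shows "\<not> int d dvd 4 + e + 4 * int j"
proof
  assume *: "int d dvd 4 + e + 4 * int j"
  have "4 + e + 4 * int j - e = 4 * int (Suc j)" by simp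
  with dvd_diff[OF * assms(1)] have "int d dvd 4 * int (Suc j)"
    by (simp only:)
  then have "int d dvd int (Suc j)"
    unfolding dvd_4_mult_iff .
  then have "d dvd Suc j"
    by (simp only: int_dvd_int_iff)
  then have "d \<le> Suc j"
    by (rule dvd_imp_le) simp
  then show False
    using assms(2,3) by simp
qed

lemma ord_ge_mult_diff:
  assumes "ord_ge z 0 f" and "ord_ge z 0 g'" and "ord_ge z i (f - f')" and "ord_ge z i (g - g')"
  shows "ord_ge z i (f * g - f' * g')"
proof -
  have "f * g - f' * g' = f * (g - g') + g' * (f - f')"
    by (simp add: algebra_simps)
  also have "ord_ge z i \<dots>"
    by (intro ord_ge_add ord_ge_scale assms)
  finally show ?thesis .
qed

lemma ord_ge_inverse_diff:
  assumes "ord_ge z 0 (1 / f)" and "ord_ge z 0 (1 / g)" and "ord_ge z i (f - g)" and "f \<noteq> 0" and "g \<noteq> 0"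
  shows "ord_ge z i (1 / f - 1 / g)"
proof -
  have "1 / f - 1 / g = - ((1 / f) * ((1 / g) * (f - g)))"
    using assms(4,5) by (simp add: field_simps)
  also have "ord_ge z i \<dots>"
    by (intro ord_ge_uminus ord_ge_scale assms)
  finally show ?thesis .
qed

text \<open>
  For a single factor this is the identity
  \<open>(1 - q^(s-e)) (1 - q^(s+e)) - (1 - q^s)^2 = q^s (1 - q^e) (1 - q^(-e))\<close>.
\<close>
lemma fac_pair_diff:
  assumes "int d dvd e"
  shows "ord_ge z 2 (fac (c - e) k * fac (c + e) k - fac c k * fac c k)"
proof (induction k)
  case (Suc k)
  define s where "s = c + 4 * int k"
  have "(1 - q powi (s - e)) * (1 - q powi (s + e)) - (1 - q powi s) * (1 - q powi s)
      = q powi s * ((1 - q powi e) * (1 - q powi (- e)))"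
    by (simp add: power_int_add power_int_diff power_int_minus field_simps)
  also have "ord_ge z 2 \<dots>"
  proof (rule ord_ge_scale[OF ord_ge_q_powi])
    have "ord_ge z (1 + 1) ((1 - q powi e) * (1 - q powi (- e)))"
      using assms by (intro ord_ge_mult ord_ge_one_minus_q_powi(1)) auto
    then show "ord_ge z 2 ((1 - q powi e) * (1 - q powi (- e)))" by simp
  qed
  finally have *: "ord_ge z 2 ((1 - q powi (s - e)) * (1 - q powi (s + e)) - (1 - q powi s) * (1 - q powi s))" .
  have "ord_ge z 2 (fac (c - e) k * fac (c + e) k * ((1 - q powi (s - e)) * (1 - q powi (s + e)))
     - fac c k * fac c k * ((1 - q powi s) * (1 - q powi s)))"
    by (rule ord_ge_mult_diff[OF _ _ Suc *]) (intro ord_ge_scale ord_ge_fac ord_ge_one_minus_q_powi(2))+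
  then show ?case
    by (simp add: fac_Suc s_def algebra_simps)
qed simp

lemma inverse_fac_pair_diff:
  assumes e: "int d dvd e" "odd e \<or> e = 0" and "k < d"
  shows "ord_ge z 0 (1 / (fac (4 - e) k * fac (4 + e) k))"
    and "ord_ge z 2 (1 / (fac (4 - e) k * fac (4 + e) k) - 1 / (fac 4 k * fac 4 k))"
proof -
  have inv: "ord_ge z 0 (1 / fac (4 + f) k)" if "int d dvd f" for f
    by (rule ord_ge_inverse_fac) (rule not_dvd_first_period[OF that _ \<open>k < d\<close>])
  have *: "ord_ge z 0 (1 / (fac (4 + - f) k * fac (4 + f) k))" if "int d dvd f" for f
    using ord_ge_scale[OF inv[of "- f"] inv[OF that]] that by simp
  from *[OF e(1)] show "ord_ge z 0 (1 / (fac (4 - e) k * fac (4 + e) k))" by simp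
  moreover have "ord_ge z 0 (1 / (fac 4 k * fac 4 k))" using *[of 0] by simp
  moreover have "fac 4 k \<noteq> 0" "fac (4 - e) k \<noteq> 0" "fac (4 + e) k \<noteq> 0"
    using e(2) fac_pos_neq_0[of 4 k] fac_odd_neq_0[of "4 - e" k] fac_odd_neq_0[of "4 + e" k] by auto
  ultimately show "ord_ge z 2 (1 / (fac (4 - e) k * fac (4 + e) k) - 1 / (fac 4 k * fac 4 k))"
    using fac_pair_diff[OF e(1)] by (intro ord_ge_inverse_diff) auto
qed

lemma pair_diff:
  assumes e: "int d dvd e" "odd e \<or> e = 0" and "k < d"
  shows "ord_ge z 2 (pair e k - pair 0 k)"
proof -
  have pair_alt: "pair f k = fac (- 1 - f) k * fac (- 1 + f) k * (1 / (fac (4 - f) k * fac (4 + f) k))" for f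
  proof -
    have "- f - 1 = - 1 - f" "f - 1 = - 1 + f" by simp_all
    then show ?thesis by (simp only: pair_def) (simp add: mult_ac)
  qed
  have "ord_ge z 2 (pair e k - fac (- 1) k * fac (- 1) k * (1 / (fac 4 k * fac 4 k)))"
    unfolding pair_alt[of e]
  proof (rule ord_ge_mult_diff)
    show "ord_ge z 0 (1 / (fac 4 k * fac 4 k))"
      using inverse_fac_pair_diff(1)[of 0 k] \<open>k < d\<close> by simp
  qed (intro ord_ge_scale ord_ge_fac fac_pair_diff inverse_fac_pair_diff(2) assms)+
  then show ?thesis by (simp add: pair_alt[of 0])
qed

lemma ord_ge_coef:
  assumes "k < d"
  shows "ord_ge z (- 1) (coef k)"
proof -
  have "ord_ge z 0 (1 / fac 4 k)"
    by (rule ord_ge_inverse_fac) (use not_dvd_first_period[of 0 _ k] assms in auto)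
  moreover have "ord_ge z 0 (q ^ (8 * k))"
    using ord_ge_q_powi[of "int (8 * k)"] unfolding power_int_of_nat .
  moreover have "ord_ge z (- 1) (1 / fac 1 k)"
    using assms by (intro ord_ge_inverse_fac_minus_1) simp
  ultimately have "ord_ge z (- 1) (qint (8 * int k - 1) * fac (- 1) k * fac 2 k * q ^ (8 * k) * ((1 / fac 4 k) * (1 / fac 1 k)))"
    by (intro ord_ge_scale ord_ge_qint(1) ord_ge_fac)
  then show ?thesis by (simp add: coef_def)
qed

text \<open>
  With \<open>F f\<close> the deformed sum, \<open>F(0,0) - 2 F(e,0) + F(e,e)\<close> is the sum of
  \<open>coef k (pair e k - pair 0 k)^2\<close>, of order at least \<open>-1 + 2 + 2\<close>. In the formula for
  \<open>F(e,f)\<close> from Watson's transformation only the denominators depend on \<open>f\<close>; so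
  \<open>F(e,e) - F(e,0)\<close> has a double zero from them and a simple zero from \<open>[e]\<close>. Together this
  compares \<open>F(0,0)\<close> with \<open>F(e,0)\<close>.
\<close>
lemma first_period_sum:
  assumes N: "4 * int N = e + 1" "N > 0" "N < d" and e: "int d dvd e"
  shows "ord_ge z 3 ((\<Sum>k<d. summand k) - qint e * (fac 2 N / fac 4 N) ^ 2 * main_factor (q powi e))"
proof -
  have odd_e: "odd e" using N(1) by presburger
  let ?F = "\<lambda>f. \<Sum>k\<le>N. coef k * pair e k * pair f k"
  have F: "?F f = (\<Sum>k<d. coef k * pair e k * pair f k)" for f
    using N(3) by (intro sum.mono_neutral_left) (auto simp: pair_eq_0[OF N(1)])
  have "(\<Sum>k<d. summand k) - 2 * ?F 0 + ?F e = (\<Sum>k<d. coef k * ((pair e k - pair 0 k) * (pair e k - pair 0 k)))"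
    unfolding F sum_distrib_left sum_subtractf[symmetric] sum.distrib[symmetric] summand_eq_coef_pair
    by (intro sum.cong refl) (simp add: algebra_simps)
  also have "ord_ge z 3 \<dots>"
    using ord_ge_mult[OF ord_ge_coef ord_ge_mult[OF pair_diff pair_diff]] e odd_e
    by (intro ord_ge_sum) auto
  finally have 1: "ord_ge z 3 ((\<Sum>k<d. summand k) - 2 * ?F 0 + ?F e)" .
  let ?G = "\<lambda>f j. (1 - q powi (4 * int j + 1)) * saal_coef e j / (fac 4 j * fac (4 + f) j * fac (4 - f) j * fac 4 (N - j))"
  have G: "ord_ge z 2 (?G e j - ?G 0 j)" if "j \<le> N" for j
  proof -
    have "ord_ge z 0 (1 / fac 4 j)" "ord_ge z 0 (1 / fac 4 (N - j))"
      using not_dvd_first_period[of 0 _ j] not_dvd_first_period[of 0 _ "N - j"] that N(3)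
      by (auto intro!: ord_ge_inverse_fac)
    moreover have "ord_ge z 0 (saal_coef e j)"
      using ord_ge_power[of z 0 "- 1" j] ord_ge_uminus[OF ord_ge_1, of z]
      unfolding saal_coef_def by (intro ord_ge_scale ord_ge_fac ord_ge_q_powi) simp
    moreover have "ord_ge z 2 (1 / (fac (4 - e) j * fac (4 + e) j) - 1 / (fac 4 j * fac 4 j))"
      using that N(3) e odd_e by (intro inverse_fac_pair_diff) auto
    ultimately have "ord_ge z 2 ((1 - q powi (4 * int j + 1)) * saal_coef e j * ((1 / fac 4 j) * (1 / fac 4 (N - j)))
        * (1 / (fac (4 - e) j * fac (4 + e) j) - 1 / (fac 4 j * fac 4 j)))"
      by (intro ord_ge_scale ord_ge_one_minus_q_powi(2))
    moreover have "?G f j = (1 - q powi (4 * int j + 1)) * saal_coef e j * ((1 / fac 4 j) * (1 / fac 4 (N - j)))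
        * (1 / (fac (4 - f) j * fac (4 + f) j))" for f
      by (simp add: mult_ac)
    ultimately show ?thesis
      by (simp only: right_diff_distrib) simp
  qed
  have "?F e - ?F 0 = qint e * (1 / (1 - q) * q powi (- 2 * int N) * fac 4 N) * (\<Sum>j\<le>N. ?G e j - ?G 0 j)"
    unfolding sum_subtractf right_diff_distrib
    using sum_coef_pair_pair[OF N(1), of e] sum_coef_pair_pair[OF N(1), of 0] odd_e by (simp add: mult.assoc)
  also have "ord_ge z (1 + 2) \<dots>"
  proof (rule ord_ge_mult)
    have "ord_ge z 0 (1 / (1 - q))"
      using ord_ge_inverse_one_minus_q_powi[of 1] d_gt_1 by simp
    then show "ord_ge z 1 (qint e * (1 / (1 - q) * q powi (- 2 * int N) * fac 4 N))"
      using ord_ge_qint(2)[OF e] by (subst mult.commute) (intro ord_ge_scale ord_ge_q_powi ord_ge_fac)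
  qed (rule ord_ge_sum, rule G, simp)
  finally have 2: "ord_ge z 3 (?F e - ?F 0)" by simp
  have *: "(s - 2 * f + g) - (g - f) = s - f" for s f g :: ratfun
    by simp
  have "ord_ge z 3 ((\<Sum>k<d. summand k) - ?F 0)"
    using ord_ge_diff[OF 1 2] unfolding * .
  then show ?thesis
    unfolding sum_coef_pair_closed_form[OF N(1,2)] .
qed

lemma ord_ge_main_factor:
  assumes "int d dvd e"
  shows "ord_ge z 0 (main_factor (q powi e))"
proof -
  have q: "ord_ge z 0 q" "ord_ge z 0 (1 / q)"
    using ord_ge_q_powi[of 1] ord_ge_q_powi[of "- 1"] by (simp_all add: power_int_minus field_simps)
  have "\<not> int d dvd e - 1"
    using dvd_diff[OF assms, of "e - 1"] d_gt_1 by auto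
  then have "ord_ge z 0 (1 / (1 - q powi (e - 1)))"
    using ord_ge_inverse_one_minus_q_powi[of "e - 1"] by simp
  then have "ord_ge z 0 (- (1 / q) * (1 / (1 - q powi (e - 1))))"
    using q by (intro ord_ge_scale ord_ge_uminus)
  also have "- (1 / q) * (1 / (1 - q powi (e - 1))) = 1 / (q powi e - q)"
    by (simp add: power_int_diff divide_simps)
  finally have inv: "ord_ge z 0 (1 / (q powi e - q))" .
  have "main_factor (q powi e) = 1 - (q\<^sup>2 - q powi e) * (1 + q) * (1 - q powi e * q) * ((1 / q) * ((1 / (q powi e - q)) * (1 / (q powi e - q))))"
    by (simp add: main_factor_def power2_eq_square)
  also have "ord_ge z 0 \<dots>"
    using q inv unfolding power2_eq_square
    by (intro ord_ge_diff ord_ge_add ord_ge_scale ord_ge_1 ord_ge_q_powi)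
  finally show ?thesis .
qed

lemma ord_ge_fac_quotient_first_period:
  assumes "N < d"
  shows "ord_ge z 0 (fac 2 N / fac 4 N)"
proof -
  have "ord_ge z 0 (1 / fac 4 N)"
    using not_dvd_first_period[of 0 _ N] assms by (auto intro!: ord_ge_inverse_fac)
  from ord_ge_scale[OF ord_ge_fac[of 2 N] this] show ?thesis by simp
qed

lemma first_period_sum_mod_4_eq_3:
  assumes "d mod 4 = 3"
  shows "ord_ge z 1 (\<Sum>k<d. summand k)"
proof -
  define N where "N = (d + 1) div 4"
  have N: "4 * int N = int d + 1" "N > 0" "N < d"
    using assms unfolding N_def by presburger+
  define R where "R = qint (int d) * (fac 2 N / fac 4 N) ^ 2 * main_factor (q powi int d)"
  have "ord_ge z 1 R"
    using ord_ge_qint(2)[of "int d"] ord_ge_main_factor[of "int d"] ord_ge_power[OF ord_ge_fac_quotient_first_period[OF N(3)], of 2]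
    unfolding R_def mult.assoc by (subst mult.commute) (intro ord_ge_scale, auto)
  moreover have "ord_ge z 1 ((\<Sum>k<d. summand k) - R)"
    by (rule ord_ge_mono[OF first_period_sum[OF N, folded R_def]]) auto
  ultimately have "ord_ge z 1 (R + ((\<Sum>k<d. summand k) - R))"
    by (rule ord_ge_add)
  then show ?thesis by simp
qed

text \<open>
  With \<open>e = 3 d\<close> the upper limit \<open>N\<close> is so large that \<open>(q^2;q^4)_N\<close> contains the factor
  \<open>1 - q^(2d)\<close>. Its square and \<open>[3d]\<close> account for the triple zero.
\<close>
lemma first_period_sum_mod_4_eq_1:
  assumes "d mod 4 = 1"
  shows "ord_ge z 3 (\<Sum>k<d. summand k)"
proof -
  define m where "m = d div 4"
  have d: "d = 4 * m + 1"
    using assms by (simp add: m_def) presburger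
  define N where "N = 3 * m + 1"
  have N: "4 * int N = 3 * int d + 1" "N > 0" "N < d"
    using d_gt_1 unfolding N_def d by simp_all
  define j where "j = 2 * m"
  have j: "2 + 4 * int j = 2 * int d" "j < N"
    unfolding N_def j_def d by simp_all
  define R where "R = qint (3 * int d) * (fac 2 N / fac 4 N) ^ 2 * main_factor (q powi (3 * int d))"
  have "ord_ge z 1 (fac 2 N)"
    by (rule ord_ge_fac_1[OF j(2)]) (simp add: j(1))
  moreover have "ord_ge z 0 (1 / fac 4 N)"
    using not_dvd_first_period[of 0 _ N] N(3) by (auto intro!: ord_ge_inverse_fac)
  ultimately have "ord_ge z 1 ((1 / fac 4 N) * fac 2 N)"
    by (intro ord_ge_scale)
  from ord_ge_power[OF this, of 2] have "ord_ge z 2 ((fac 2 N / fac 4 N) ^ 2)" by simp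
  then have *: "ord_ge z (1 + 2) (qint (3 * int d) * (fac 2 N / fac 4 N) ^ 2)"
    by (intro ord_ge_mult ord_ge_qint) auto
  have "ord_ge z 3 R"
    using ord_ge_scale[OF ord_ge_main_factor[of "3 * int d"] *] by (simp add: R_def mult.commute)
  moreover have "ord_ge z 3 ((\<Sum>k<d. summand k) - R)"
    using first_period_sum[OF N] by (simp add: R_def)
  ultimately have "ord_ge z 3 (R + ((\<Sum>k<d. summand k) - R))"
    by (rule ord_ge_add)
  then show ?thesis by simp
qed

end

section \<open>The sum over all periods\<close>

text \<open>
  The summand with \<open>q^(4k)\<close> replaced by \<open>q^(m + 4s)\<close>, up to a factor \<open>block_scale\<close> without
  \<open>s\<close>. Letting \<open>m\<close> be any integer makes it possible to interpolate between the blocks that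
  occur in the sum, for which \<open>m = 4 d u\<close>.
\<close>
definition block_term :: "int \<Rightarrow> nat \<Rightarrow> ratfun" where
  "block_term m s = (1 - q powi (2 * m + 8 * int s - 1)) * fac (m - 1) s ^ 5 * fac (m + 2) s
      / (fac (m + 4) s ^ 5 * fac (m + 1) s) * q ^ (8 * s)"

definition block_scale :: "nat \<Rightarrow> ratfun" where
  "block_scale a = fac (- 1) a ^ 5 * fac 2 a / (fac 4 a ^ 5 * fac 1 a) * q ^ (8 * a) / (1 - q)"

lemma summand_add: "summand (a + s) = block_scale a * block_term (4 * int a) s"
proof -
  have "fac c (a + s) = fac c a * fac (4 * int a + c) s" for c
    by (simp add: fac_add add.commute)
  moreover have "8 * int (a + s) - 1 = 2 * (4 * int a) + 8 * int s - 1" by simp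
  moreover have "4 * int a + - 1 = 4 * int a - 1" by simp
  ultimately show ?thesis
    by (simp only: summand_def block_scale_def block_term_def qint_def)
       (simp add: power_mult_distrib power_add distrib_left mult_ac)
qed

lemma fac_reflect:
  assumes "c + c' = 4 - 4 * int k" and "s \<le> k"
  shows "fac c s * fac c' (k - s)
       = (-1) ^ s * q powi (- (int s * (c' + (4 * int (k - s) + 2 * (int s - 1))))) * fac c' k"
proof -
  have "fac c s = (-1) ^ s * q powi (- (int s * (c' + 4 * int (k - s) + 2 * (int s - 1)))) * fac (c' + 4 * int (k - s)) s"
    by (rule fac_reverse) (use assms in \<open>simp add: of_nat_diff\<close>)
  moreover have "fac c' k = fac c' (k - s) * fac (c' + 4 * int (k - s)) s"
    using fac_add[of c' "k - s" s] assms(2) by simp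
  ultimately show ?thesis
    by (simp add: add.assoc mult_ac)
qed

definition reflection_factor :: "nat \<Rightarrow> ratfun" where
  "reflection_factor k = - (q powi (1 - 16 * int k)) * (fac 4 k ^ 5 * fac 1 k / (fac (- 1) k ^ 5 * fac 2 k))"

text \<open>
  As a function of \<open>w = q^(m + 4s)\<close>, a very-well-poised summand is antisymmetric under
  \<open>w \<mapsto> q / w\<close>, up to normalisation. If \<open>m = 1 - 4 k\<close>, this sends \<open>w\<close> to
  \<open>q^(4 (k - s))\<close>.
\<close>
lemma block_term_reflect:
  assumes "s \<le> k"
  shows "block_term (1 - 4 * int k) s = reflection_factor k * block_term 0 (k - s)"
proof -
  define t where "t = k - s"
  define w where "w = 4 * int t + 2 * (int s - 1)"
  define A :: ratfun where "A = (-1) ^ s"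
  define Q where "Q c = q powi (- (int s * (c + w)))" for c
  have [simp]: "A \<noteq> 0" "Q c \<noteq> 0" for c by (simp_all add: A_def Q_def)
  have nz: "fac 4 i \<noteq> 0" "fac 1 i \<noteq> 0" "fac (- 1) i \<noteq> 0" "fac 2 i \<noteq> 0" for i
    by (simp_all add: fac_pos_neq_0 fac_odd_neq_0)
  have f: "fac c s = A * Q c' * fac c' k / fac c' t" if "c + c' = 4 - 4 * int k" "fac c' t \<noteq> 0" for c c'
    using fac_reflect[OF that(1) assms] that(2)
    by (simp add: t_def[symmetric] w_def A_def Q_def field_simps)
  have m: "fac (1 - 4 * int k - 1) s = A * Q 4 * fac 4 k / fac 4 t"
    "fac (1 - 4 * int k + 2) s = A * Q 1 * fac 1 k / fac 1 t"
    "fac (1 - 4 * int k + 4) s = A * Q (- 1) * fac (- 1) k / fac (- 1) t"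
    "fac (1 - 4 * int k + 1) s = A * Q 2 * fac 2 k / fac 2 t"
    by (rule f; simp add: nz)+
  have "Q 4 ^ 5 * Q 1 = q powi (- 24 * int s) * (Q (- 1) ^ 5 * Q 2)"
    unfolding Q_def power_int_power' q_powi_mult by (intro arg_cong[where f = "power_int q"]) (simp add: algebra_simps)
  then have QQ: "Q 4 ^ 5 * Q 1 / (Q (- 1) ^ 5 * Q 2) = q powi (- 24 * int s)"
    by simp
  have "2 * (1 - 4 * int k) + 8 * int s - 1 = - (8 * int t - 1)"
    using assms by (simp add: t_def of_nat_diff)
  then have one: "1 - q powi (2 * (1 - 4 * int k) + 8 * int s - 1) = - (q powi (1 - 8 * int t)) * (1 - q powi (2 * 0 + 8 * int t - 1))"
    by (simp add: right_diff_distrib q_powi_mult)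
  have pw: "q powi (1 - 8 * int t) * q powi (- 24 * int s) * q ^ (8 * s) = q powi (1 - 16 * int k) * q ^ (8 * t)"
  proof -
    have "q ^ (8 * i) = q powi (8 * int i)" for i by (simp flip: power_int_of_nat)
    then show ?thesis
      using assms by (simp only: q_powi_mult) (simp add: t_def of_nat_diff algebra_simps)
  qed
  have "block_term (1 - 4 * int k) s = (1 - q powi (2 * (1 - 4 * int k) + 8 * int s - 1))
     * (Q 4 ^ 5 * Q 1 / (Q (- 1) ^ 5 * Q 2)) * (fac 4 k ^ 5 * fac 1 k / (fac (- 1) k ^ 5 * fac 2 k))
     * (fac (- 1) t ^ 5 * fac 2 t / (fac 4 t ^ 5 * fac 1 t)) * q ^ (8 * s)"
    unfolding block_term_def m using nz by (simp add: power_mult_distrib power_divide field_simps)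
  also have "\<dots> = - (q powi (1 - 8 * int t) * q powi (- 24 * int s) * q ^ (8 * s))
     * (fac 4 k ^ 5 * fac 1 k / (fac (- 1) k ^ 5 * fac 2 k))
     * ((1 - q powi (2 * 0 + 8 * int t - 1)) * (fac (- 1) t ^ 5 * fac 2 t / (fac 4 t ^ 5 * fac 1 t)))"
    unfolding QQ one by (simp only: mult_ac mult_minus_left mult_minus_right)
  also have "\<dots> = reflection_factor k * block_term 0 t"
    unfolding pw by (simp add: reflection_factor_def block_term_def mult_ac)
  finally show ?thesis by (simp only: t_def)
qed

context odd_root_of_unity
begin

text \<open>
  A function of \<open>q^(d M)\<close> that is regular at \<open>z\<close> is affine in \<open>M\<close> up to order 2, with a
  slope that vanishes at \<open>z\<close>. The value \<open>M = -1\<close> is left out because the pole of the block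
  sum is cleared by \<open>1 - q^(d M + d)\<close>, which is zero there.
\<close>
definition affine_mod_2 :: "(int \<Rightarrow> ratfun) \<Rightarrow> bool" where
  "affine_mod_2 f \<longleftrightarrow> (\<exists>a b. ord_ge z 0 a \<and> ord_ge z 1 b \<and>
      (\<forall>M. M \<noteq> - 1 \<longrightarrow> ord_ge z 2 (f M - (a + of_int M * b))))"

lemma affine_mod_2_const: "ord_ge z 0 c \<Longrightarrow> affine_mod_2 (\<lambda>M. c)"
  unfolding affine_mod_2_def by (intro exI[of _ c] exI[of _ 0]) simp

lemma affine_mod_2_cong:
  "affine_mod_2 f \<Longrightarrow> (\<And>M. M \<noteq> - 1 \<Longrightarrow> f M = g M) \<Longrightarrow> affine_mod_2 g"
  unfolding affine_mod_2_def by metis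

lemma affine_mod_2_add:
  assumes "affine_mod_2 f" and "affine_mod_2 g"
  shows "affine_mod_2 (\<lambda>M. f M + g M)"
proof -
  obtain a b where f: "ord_ge z 0 a" "ord_ge z 1 b" "\<And>M. M \<noteq> - 1 \<Longrightarrow> ord_ge z 2 (f M - (a + of_int M * b))"
    using assms(1) unfolding affine_mod_2_def by blast
  obtain a' b' where g: "ord_ge z 0 a'" "ord_ge z 1 b'" "\<And>M. M \<noteq> - 1 \<Longrightarrow> ord_ge z 2 (g M - (a' + of_int M * b'))"
    using assms(2) unfolding affine_mod_2_def by blast
  have "ord_ge z 2 (f M + g M - ((a + a') + of_int M * (b + b')))" if "M \<noteq> - 1" for M
    using ord_ge_add[OF f(3)[OF that] g(3)[OF that]] by (simp add: algebra_simps)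
  then show ?thesis
    unfolding affine_mod_2_def
    using ord_ge_add[OF f(1) g(1)] ord_ge_add[OF f(2) g(2)] by blast
qed

lemma affine_mod_2_sum:
  "(\<And>k. k \<in> K \<Longrightarrow> affine_mod_2 (f k)) \<Longrightarrow> affine_mod_2 (\<lambda>M. \<Sum>k\<in>K. f k M)"
  by (induction K rule: infinite_finite_induct) (auto intro: affine_mod_2_const affine_mod_2_add)

text \<open>
  The product of the two slopes has a double zero and does not count.
\<close>
lemma affine_mod_2_mult:
  assumes "affine_mod_2 f" and "affine_mod_2 g"
  shows "affine_mod_2 (\<lambda>M. f M * g M)"
proof -
  obtain a b where f: "ord_ge z 0 a" "ord_ge z 1 b" "\<And>M. M \<noteq> - 1 \<Longrightarrow> ord_ge z 2 (f M - (a + of_int M * b))"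
    using assms(1) unfolding affine_mod_2_def by blast
  obtain a' b' where g: "ord_ge z 0 a'" "ord_ge z 1 b'" "\<And>M. M \<noteq> - 1 \<Longrightarrow> ord_ge z 2 (g M - (a' + of_int M * b'))"
    using assms(2) unfolding affine_mod_2_def by blast
  have bb: "ord_ge z 2 (b * b')"
    using ord_ge_mult[OF f(2) g(2)] by simp
  have lin: "ord_ge z 0 (a + of_int M * b)" "ord_ge z 0 (a' + of_int M * b')" for M
    using f(1,2) g(1,2) by (auto intro!: ord_ge_add ord_ge_scale intro: ord_ge_mono[of z 1])
  have "ord_ge z 2 (f M * g M - (a * a' + of_int M * (a * b' + a' * b)))" if "M \<noteq> - 1" for M
  proof -
    define u where "u = f M - (a + of_int M * b)"
    define v where "v = g M - (a' + of_int M * b')"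
    define p where "p = a + of_int M * b"
    define r where "r = a' + of_int M * b'"
    have u: "ord_ge z 2 u" and v: "ord_ge z 2 v" and p: "ord_ge z 0 p" and r: "ord_ge z 0 r"
      using f(3)[OF that] g(3)[OF that] lin by (simp_all add: u_def v_def p_def r_def)
    have u0: "ord_ge z 0 u"
      by (rule ord_ge_mono[OF u]) simp
    have "f M * g M - (a * a' + of_int M * (a * b' + a' * b)) = p * v + r * u + u * v + of_int M * (of_int M * (b * b'))"
      by (simp add: u_def v_def p_def r_def algebra_simps)
    also have "ord_ge z 2 \<dots>"
      by (intro ord_ge_add ord_ge_scale[OF p v] ord_ge_scale[OF r u] ord_ge_scale[OF u0 v]
          ord_ge_scale[OF ord_ge_of_int ord_ge_scale[OF ord_ge_of_int bb]])
    finally show ?thesis .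
  qed
  moreover have "ord_ge z 0 (a * a')" "ord_ge z 1 (a * b' + a' * b)"
    using f(1,2) g(1,2) by (auto intro: ord_ge_add ord_ge_scale)
  ultimately show ?thesis
    unfolding affine_mod_2_def by blast
qed

lemma affine_mod_2_power: "affine_mod_2 f \<Longrightarrow> affine_mod_2 (\<lambda>M. f M ^ n)"
  by (induction n) (auto intro: affine_mod_2_const affine_mod_2_mult)

lemma affine_mod_2_prod:
  "(\<And>k. k \<in> K \<Longrightarrow> affine_mod_2 (f k)) \<Longrightarrow> affine_mod_2 (\<lambda>M. \<Prod>k\<in>K. f k M)"
  by (induction K rule: infinite_finite_induct) (auto intro: affine_mod_2_const affine_mod_2_mult)

text \<open>
  To first order, the inverse of \<open>a + M b\<close> is \<open>c - M c^2 b\<close>, where \<open>c\<close> inverts \<open>a\<close>. The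
  inverse of \<open>f 0\<close> serves as \<open>c\<close>, as it is known to be regular.
\<close>
lemma affine_mod_2_inverse:
  assumes "affine_mod_2 f" and nz: "\<And>M. f M \<noteq> 0" and unit: "\<And>M. ord_ge z 0 (1 / f M)"
  shows "affine_mod_2 (\<lambda>M. 1 / f M)"
proof -
  obtain a b where f: "ord_ge z 0 a" "ord_ge z 1 b" "\<And>M. M \<noteq> - 1 \<Longrightarrow> ord_ge z 2 (f M - (a + of_int M * b))"
    using assms(1) unfolding affine_mod_2_def by blast
  define c where "c = 1 / f 0"
  have c: "ord_ge z 0 c" "c * f 0 = 1"
    using nz[of 0] unit[of 0] by (simp_all add: c_def)
  have ca: "ord_ge z 2 (1 - c * a)"
  proof -
    have "ord_ge z 2 (c * (f 0 - (a + of_int 0 * b)))"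
      using f(3)[of 0] c(1) by (intro ord_ge_scale) auto
    then show ?thesis
      by (simp add: right_diff_distrib c(2))
  qed
  have bb: "ord_ge z 2 (b * b)"
    using ord_ge_mult[OF f(2) f(2)] by simp
  have b0: "ord_ge z 0 b"
    by (rule ord_ge_mono[OF f(2)]) simp
  have "ord_ge z 2 (1 / f M - (c + of_int M * (- (c * (c * b)))))" if "M \<noteq> - 1" for M
  proof -
    define x where "x = c - of_int M * (c * (c * b))"
    have x: "ord_ge z 0 x"
      unfolding x_def using c(1) b0 by (intro ord_ge_diff ord_ge_scale ord_ge_of_int)
    define u where "u = f M - (a + of_int M * b)"
    define v where "v = 1 - c * a"
    define w where "w = b * b"
    have uvw: "ord_ge z 2 u" "ord_ge z 2 v" "ord_ge z 2 w"
      using f(3)[OF that] ca bb by (simp_all add: u_def v_def w_def)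
    have eq: "1 - f M * x = v - x * u - of_int M * (c * (b * v)) + of_int M * (of_int M * (c * (c * w)))"
      unfolding x_def u_def v_def w_def by (simp add: algebra_simps)
    have "ord_ge z 2 (1 - f M * x)"
      unfolding eq using c(1) b0 x uvw
      by (intro ord_ge_add ord_ge_diff ord_ge_scale ord_ge_of_int)
    then have "ord_ge z 2 (1 / f M * (1 - f M * x))"
      using unit by (intro ord_ge_scale)
    then show ?thesis
      using nz[of M] by (simp add: right_diff_distrib x_def)
  qed
  moreover have "ord_ge z 1 (- (c * (c * b)))"
    using c(1) f(2) by (intro ord_ge_uminus ord_ge_scale)
  ultimately show ?thesis
    unfolding affine_mod_2_def using c(1) by blast
qed

text \<open>
  The expansion of \<open>(1 + (q^D - 1))^M\<close> to first order in \<open>q^D - 1\<close>, which vanishes at \<open>z\<close>.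
\<close>
lemma q_powi_multiple_expansion:
  assumes "int d dvd D"
  shows "ord_ge z 2 (q powi (D * M) - (1 + of_int M * (q powi D - 1)))"
proof -
  have pos: "ord_ge z 2 (q powi (D * int n) - (1 + of_nat n * (q powi D - 1)))" if "int d dvd D" for D n
  proof -
    define y where "y = q powi D"
    have "ord_ge z 1 (- (1 - y))"
      unfolding y_def using that by (intro ord_ge_uminus ord_ge_one_minus_q_powi)
    then have y: "ord_ge z 2 ((y - 1) * (y - 1))"
      using ord_ge_mult[of z 1 "y - 1" 1 "y - 1"] by simp
    have "ord_ge z 2 (y ^ n - (1 + of_nat n * (y - 1)))"
    proof (induction n)
      case (Suc n)
      have n: "ord_ge z 0 (of_nat n)"
        using ord_ge_of_int[of z "int n"] by simp
      have y0: "ord_ge z 0 y"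
        by (simp add: y_def)
      have "y ^ Suc n - (1 + of_nat (Suc n) * (y - 1))
          = y * (y ^ n - (1 + of_nat n * (y - 1))) + of_nat n * ((y - 1) * (y - 1))"
        by (simp add: algebra_simps)
      then show ?case
        using ord_ge_add[OF ord_ge_scale[OF y0 Suc] ord_ge_scale[OF n y]] by (simp only:)
    qed simp
    then show ?thesis
      by (simp add: y_def power_int_mult)
  qed
  show ?thesis
  proof (cases "M \<ge> 0")
    case True
    then show ?thesis using pos[OF assms, of "nat M"] by simp
  next
    case False
    define n where "n = nat (- M)"
    have M: "M = - int n" using False by (simp add: n_def)
    have "ord_ge z 2 (q powi (- D * int n) - (1 + of_nat n * (q powi (- D) - 1)))"
      using assms by (intro pos) simp
    moreover have "ord_ge z 2 (of_nat n * (q powi (- D) * ((1 - q powi D) * (1 - q powi D))))"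
    proof -
      have "ord_ge z (1 + 1) ((1 - q powi D) * (1 - q powi D))"
        using assms by (intro ord_ge_mult ord_ge_one_minus_q_powi)
      then have "ord_ge z 2 ((1 - q powi D) * (1 - q powi D))" by simp
      from ord_ge_scale[OF _ ord_ge_scale[OF ord_ge_q_powi this], of "of_nat n" "- D"]
      show ?thesis
        using ord_ge_of_int[of z "int n"] by simp
    qed
    ultimately have "ord_ge z 2 ((q powi (- D * int n) - (1 + of_nat n * (q powi (- D) - 1)))
       + of_nat n * (q powi (- D) * ((1 - q powi D) * (1 - q powi D))))"
      by (rule ord_ge_add)
    also have "(q powi (- D * int n) - (1 + of_nat n * (q powi (- D) - 1)))
       + of_nat n * (q powi (- D) * ((1 - q powi D) * (1 - q powi D)))
      = q powi (D * M) - (1 + of_int M * (q powi D - 1))"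
    proof -
      have *: "w * ((1 - y) * (1 - y)) = w - 2 * (w * y) + (w * y) * y" for w y :: ratfun
        by (simp add: algebra_simps)
      have "q powi (- D) * q powi D = 1"
        unfolding q_powi_mult by simp
      then have "q powi (- D) * ((1 - q powi D) * (1 - q powi D)) = q powi (- D) - 2 + q powi D"
        unfolding * by simp
      moreover have "u - (1 + m * (w - 1)) + m * (w - 2 + y) = u - (1 + - m * (y - 1))" for u m w y :: ratfun
        by (simp add: algebra_simps)
      ultimately show ?thesis by (simp add: M)
    qed
    finally show ?thesis .
  qed
qed

lemma affine_mod_2_one_minus_q_powi: "affine_mod_2 (\<lambda>M. 1 - q powi (int d * j * M + c))"
proof -
  have "ord_ge z 2 (1 - q powi (int d * j * M + c) - ((1 - q powi c) + of_int M * (q powi c * (1 - q powi (int d * j)))))" for M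
  proof -
    have "1 - q powi (int d * j * M + c) - ((1 - q powi c) + of_int M * (q powi c * (1 - q powi (int d * j))))
       = - (q powi c) * (q powi (int d * j * M) - (1 + of_int M * (q powi (int d * j) - 1)))"
      by (simp add: power_int_add algebra_simps)
    also have "ord_ge z 2 \<dots>"
      by (intro ord_ge_scale ord_ge_uminus ord_ge_q_powi q_powi_multiple_expansion) simp
    finally show ?thesis .
  qed
  moreover have "ord_ge z 1 (q powi c * (1 - q powi (int d * j)))"
    by (intro ord_ge_scale ord_ge_q_powi ord_ge_one_minus_q_powi) simp
  ultimately show ?thesis
    unfolding affine_mod_2_def using ord_ge_one_minus_q_powi(2)[of c] by blast
qed

lemma affine_mod_2_fac: "affine_mod_2 (\<lambda>M. fac (int d * M + c) k)"
  unfolding fac_def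
  using affine_mod_2_one_minus_q_powi[of 1] by (intro affine_mod_2_prod) (simp add: add.assoc)

lemma dvd_shift_iff: "int d dvd int d * M + c + 4 * int j \<longleftrightarrow> int d dvd c + 4 * int j"
  unfolding add.assoc by (rule dvd_add_right_iff) simp

lemma affine_mod_2_inverse_fac:
  assumes "\<And>j. j < k \<Longrightarrow> \<not> int d dvd c + 4 * int j"
  shows "affine_mod_2 (\<lambda>M. 1 / fac (int d * M + c) k)"
proof (rule affine_mod_2_inverse[OF affine_mod_2_fac])
  fix M
  show "fac (int d * M + c) k \<noteq> 0"
    using assms by (intro fac_neq_0) (metis dvd_shift_iff dvd_0_right)
  show "ord_ge z 0 (1 / fac (int d * M + c) k)"
    unfolding dvd_shift_iff using assms by (intro ord_ge_inverse_fac) (simp add: dvd_shift_iff)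
qed

text \<open>
  Beyond \<open>k\<close> the fifth power of \<open>1 - q^(d M - 1 + 4k)\<close> occurs in the numerator, against at
  most a simple zero of the denominator.
\<close>
lemma ord_ge_block_term_tail:
  assumes k: "int d dvd 4 * int k - 1" and "k < s" "s < d"
  shows "ord_ge z 4 (block_term (int d * M) s)"
proof -
  have "ord_ge z 1 (fac (int d * M - 1) s)"
    by (rule ord_ge_fac_1[OF \<open>k < s\<close>]) (use dvd_add[OF dvd_triv_left[of "int d" M] k] in \<open>simp add: algebra_simps\<close>)
  then have num: "ord_ge z 5 (fac (int d * M - 1) s ^ 5)"
    using ord_ge_power[of z 1 "fac (int d * M - 1) s" 5] by simp
  have "ord_ge z 0 (1 / fac (4 + int d * M) s)"
    by (rule ord_ge_inverse_fac) (rule not_dvd_first_period[OF dvd_triv_left _ \<open>s < d\<close>])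
  then have den: "ord_ge z 0 ((1 / fac (int d * M + 4) s) ^ 5)"
    using ord_ge_power[of z 0 "1 / fac (int d * M + 4) s" 5] by (simp add: add.commute)
  define X where "X = 1 / fac (int d * M + 1) s * fac (int d * M - 1) s ^ 5"
  have "ord_ge z (- 1 + 5) X"
    unfolding X_def using \<open>s < d\<close> by (intro ord_ge_mult ord_ge_inverse_fac_minus_1 num) simp
  moreover have "ord_ge z 0 (q ^ (8 * s))"
    using ord_ge_q_powi[of "int (8 * s)"] unfolding power_int_of_nat .
  ultimately have "ord_ge z 4 ((1 - q powi (2 * (int d * M) + 8 * int s - 1)) * (fac (int d * M + 2) s
      * ((1 / fac (int d * M + 4) s) ^ 5 * (q ^ (8 * s) * X))))"
    using den by (intro ord_ge_scale ord_ge_one_minus_q_powi(2) ord_ge_fac) simp_all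
  then show ?thesis
    by (simp add: block_term_def X_def power_divide mult_ac)
qed

text \<open>
  The function \<open>P\<close> is there to clear the pole of \<open>1 / (q^(d M + 1); q^4)_s\<close>; all other
  factors are regular.
\<close>
lemma affine_mod_2_block_sum:
  assumes k: "k < d" and P: "\<And>s. s \<le> k \<Longrightarrow> affine_mod_2 (\<lambda>M. P M * (1 / fac (int d * M + 1) s))"
  shows "affine_mod_2 (\<lambda>M. P M * (\<Sum>s\<le>k. block_term (int d * M) s))"
proof -
  have "affine_mod_2 (\<lambda>M. P M * block_term (int d * M) s)" if "s \<le> k" for s
  proof -
    have inv: "affine_mod_2 (\<lambda>M. 1 / fac (int d * M + 4) s)"
      by (rule affine_mod_2_inverse_fac) (use not_dvd_first_period[of 0 _ s] that k in auto)
    have lin: "affine_mod_2 (\<lambda>M. 1 - q powi (int d * 2 * M + (8 * int s - 1)))"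
      by (rule affine_mod_2_one_minus_q_powi)
    have "ord_ge z 0 (q ^ (8 * s))"
      using ord_ge_q_powi[of "int (8 * s)"] unfolding power_int_of_nat .
    then have "affine_mod_2 (\<lambda>M. (1 - q powi (int d * 2 * M + (8 * int s - 1)))
        * (fac (int d * M + (- 1)) s ^ 5 * (fac (int d * M + 2) s * ((1 / fac (int d * M + 4) s) ^ 5
        * (q ^ (8 * s) * (P M * (1 / fac (int d * M + 1) s)))))))"
      by (intro affine_mod_2_mult affine_mod_2_power affine_mod_2_fac affine_mod_2_const inv lin P that)
    then show ?thesis
      by (rule affine_mod_2_cong) (simp add: block_term_def power_divide mult_ac add_diff_eq)
  qed
  then show ?thesis
    unfolding sum_distrib_left by (intro affine_mod_2_sum) simp
qed

lemma sum_block_term_0: "(\<Sum>s<d. block_term 0 s) = (1 - q) * (\<Sum>s<d. summand s)"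
  using summand_add[of 0] q_neq_1 by (simp add: block_scale_def sum_distrib_left)

lemma split_block_sum:
  assumes "int d dvd 4 * int k - 1" and "k < d"
  shows "ord_ge z 4 ((\<Sum>s<d. block_term (int d * M) s) - (\<Sum>s\<le>k. block_term (int d * M) s))"
proof -
  have "{..<d} = {..k} \<union> {k<..<d}" using assms(2) by auto
  then have "(\<Sum>s<d. block_term (int d * M) s) = (\<Sum>s\<le>k. block_term (int d * M) s) + (\<Sum>s\<in>{k<..<d}. block_term (int d * M) s)"
    by (simp add: sum.union_disjoint ivl_disj_int)
  moreover have "ord_ge z 4 (\<Sum>s\<in>{k<..<d}. block_term (int d * M) s)"
    using ord_ge_block_term_tail[OF assms(1)] by (intro ord_ge_sum) auto
  ultimately show ?thesis by simp
qed

text \<open>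
  For \<open>d = 4 k - 1\<close> the terms up to \<open>k\<close> are regular, so their sum is affine in \<open>M\<close>, and to
  order 1 it is constant. At \<open>M = 0\<close> it is the sum over the first period.
\<close>
lemma block_sum_mod_4_eq_3:
  assumes "d mod 4 = 3" and "M \<noteq> - 1"
  shows "ord_ge z 1 (\<Sum>s<d. block_term (int d * M) s)"
proof -
  define k where "k = d div 4 + 1"
  have d: "d = 4 * k - 1" "k > 0"
    using assms(1) unfolding k_def by presburger+
  then have k: "int d dvd 4 * int k - 1" "k < d"
    using d_gt_1 by (simp_all add: of_nat_diff)
  define T where "T M = (\<Sum>s\<le>k. block_term (int d * M) s)" for M
  have "affine_mod_2 (\<lambda>M. 1 * T M)"
    unfolding T_def
  proof (rule affine_mod_2_block_sum[OF k(2)])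
    fix s assume s: "s \<le> k"
    have "\<not> int d dvd 1 + 4 * int j" if "j < s" for j
      using zdvd_not_zless[of "1 + 4 * int j" "int d"] that s d by (simp add: of_nat_diff)
    from affine_mod_2_inverse_fac[OF this]
    show "affine_mod_2 (\<lambda>M. 1 * (1 / fac (int d * M + 1) s))" by simp
  qed
  then obtain a b where ab: "ord_ge z 0 a" "ord_ge z 1 b" "\<And>M. M \<noteq> - 1 \<Longrightarrow> ord_ge z 2 (T M - (a + of_int M * b))"
    unfolding affine_mod_2_def by auto
  have *: "ord_ge z 1 ((\<Sum>s<d. block_term (int d * M) s) - T M)" for M
    unfolding T_def by (rule ord_ge_mono[OF split_block_sum[OF k]]) simp
  have ab1: "ord_ge z 1 (T M - (a + of_int M * b))" if "M \<noteq> - 1" for M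
    by (rule ord_ge_mono[OF ab(3)[OF that]]) simp
  have "ord_ge z 1 ((1 - q) * (\<Sum>s<d. summand s))"
    using first_period_sum_mod_4_eq_3[OF assms(1)] ord_ge_one_minus_q_powi(2)[of 1]
    by (intro ord_ge_scale) simp_all
  then have S0: "ord_ge z 1 (\<Sum>s<d. block_term (int d * 0) s)"
    by (simp add: sum_block_term_0)
  have "ord_ge z 1 ((\<Sum>s<d. block_term (int d * 0) s) - ((\<Sum>s<d. block_term (int d * 0) s) - T 0) - (T 0 - (a + of_int 0 * b)))"
    by (intro ord_ge_diff S0 * ab1) simp
  then have a: "ord_ge z 1 a" by simp
  have "ord_ge z 1 (((\<Sum>s<d. block_term (int d * M) s) - T M) + ((T M - (a + of_int M * b)) + (a + of_int M * b)))"
    by (intro ord_ge_add[OF *] ord_ge_add[OF ab1[OF assms(2)]] ord_ge_add[OF a] ord_ge_scale ord_ge_of_int ab(2))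
  then show ?thesis by simp
qed

text \<open>
  For \<open>d = 4 l + 1\<close> the factor \<open>1 - q^(d M + d)\<close>, with index \<open>l\<close>, produces a simple pole.
  Multiplied by it, the sum up to \<open>k = 3 l + 1\<close> is affine in \<open>M\<close> up to order 2. It has a
  double zero for \<open>M = 0\<close>, by the result for the first period, and for \<open>M = -3\<close>, since
  \<open>- 3 d = 1 - 4 k\<close> and the block is the reflection of the first one. So both coefficients
  of the affine function have double zeros.
\<close>
lemma block_sum_mod_4_eq_1:
  assumes "d mod 4 = 1" and "M \<noteq> - 1"
  shows "ord_ge z 1 (\<Sum>s<d. block_term (int d * M) s)"
proof -
  define l where "l = d div 4"
  have d: "d = 4 * l + 1" "l > 0"
    using assms(1) d_gt_1 unfolding l_def by presburger+
  define k where "k = 3 * l + 1"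
  have k3: "4 * int k - 1 = 3 * int d"
    using d by (simp add: k_def)
  have "int d dvd 4 * int k - 1"
    unfolding k3 by simp
  moreover have "k < d"
    using d by (simp add: k_def)
  ultimately have k: "int d dvd 4 * int k - 1" "k < d" "4 * int k - 1 = 3 * int d"
    using k3 by blast+
  define T where "T M = (\<Sum>s\<le>k. block_term (int d * M) s)" for M
  define P where "P M = 1 - q powi (int d * 1 * M + int d)" for M
  have P_neq_0: "P M \<noteq> 0" if "M \<noteq> - 1" for M
  proof -
    have "int d * 1 * M + int d = int d * (M + 1)" by (simp add: algebra_simps)
    moreover have "int d * (M + 1) \<noteq> 0" using that d_gt_1 by auto
    ultimately show ?thesis
      using q_powi_eq_1_iff[of "int d * (M + 1)"] by (simp only: P_def) simp
  qed
  have not_dvd: "\<not> int d dvd 1 + 4 * int j" if "j < k" "j \<noteq> l" for j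
  proof
    assume *: "int d dvd 1 + 4 * int j"
    have "int d dvd 1 + 4 * int l" by (simp add: d)
    from dvd_progression_unique[OF * this] show False
      using that k(2) d by simp
  qed
  have "affine_mod_2 (\<lambda>M. P M * T M)"
    unfolding T_def
  proof (rule affine_mod_2_block_sum[OF k(2)])
    fix s assume s: "s \<le> k"
    show "affine_mod_2 (\<lambda>M. P M * (1 / fac (int d * M + 1) s))"
    proof (cases "s \<le> l")
      case True
      have "affine_mod_2 P"
        unfolding P_def by (rule affine_mod_2_one_minus_q_powi)
      moreover have "affine_mod_2 (\<lambda>M. 1 / fac (int d * M + 1) s)"
        by (rule affine_mod_2_inverse_fac, rule not_dvd) (use True s in auto)
      ultimately show ?thesis
        by (rule affine_mod_2_mult)
    next
      case False
      have "affine_mod_2 (\<lambda>M. 1 / fac (int d * M + 1) l)"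
        by (rule affine_mod_2_inverse_fac, rule not_dvd) (use False s in auto)
      moreover have "affine_mod_2 (\<lambda>M. 1 / fac (int d * M + (1 + 4 * int (Suc l))) (s - Suc l))"
      proof (rule affine_mod_2_inverse_fac)
        fix j assume "j < s - Suc l"
        then show "\<not> int d dvd 1 + 4 * int (Suc l) + 4 * int j"
          using not_dvd[of "Suc l + j"] s by (simp add: algebra_simps)
      qed
      ultimately have "affine_mod_2 (\<lambda>M. 1 / fac (int d * M + 1) l * (1 / fac (int d * M + (1 + 4 * int (Suc l))) (s - Suc l)))"
        by (rule affine_mod_2_mult)
      then show ?thesis
      proof (rule affine_mod_2_cong)
        fix M :: int assume "M \<noteq> - 1"
        have "int d * M + 1 + 4 * int l = int d * 1 * M + int d" by (simp add: d)
        then have "fac (int d * M + 1) s = fac (int d * M + 1) l * P M * fac (int d * M + (1 + 4 * int (Suc l))) (s - Suc l)"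
          using fac_split[of l s "int d * M + 1"] False by (simp only: P_def) (simp add: algebra_simps)
        then show "1 / fac (int d * M + 1) l * (1 / fac (int d * M + (1 + 4 * int (Suc l))) (s - Suc l))
            = P M * (1 / fac (int d * M + 1) s)"
          using P_neq_0[OF \<open>M \<noteq> - 1\<close>] by simp
      qed
    qed
  qed
  then obtain a b where ab: "ord_ge z 0 a" "ord_ge z 1 b" "\<And>M. M \<noteq> - 1 \<Longrightarrow> ord_ge z 2 (P M * T M - (a + of_int M * b))"
    unfolding affine_mod_2_def by auto
  have tail: "ord_ge z i ((\<Sum>s<d. block_term (int d * M) s) - T M)" if "i \<le> 4" for M i
    unfolding T_def by (rule ord_ge_mono[OF split_block_sum[OF k(1,2)] that])
  have "ord_ge z 3 ((1 - q) * (\<Sum>s<d. summand s))"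
    using first_period_sum_mod_4_eq_1[OF assms(1)] ord_ge_one_minus_q_powi(2)[of 1]
    by (intro ord_ge_scale) simp_all
  then have "ord_ge z 3 (\<Sum>s<d. block_term (int d * 0) s)"
    by (simp add: sum_block_term_0)
  then have "ord_ge z 3 ((\<Sum>s<d. block_term (int d * 0) s) - ((\<Sum>s<d. block_term (int d * 0) s) - T 0))"
    by (rule ord_ge_diff) (rule tail, simp)
  then have T0: "ord_ge z 3 (T 0)" by simp
  have P: "ord_ge z 0 (P M)" for M
    unfolding P_def by (rule ord_ge_one_minus_q_powi)
  have a: "ord_ge z 2 a"
  proof -
    have "ord_ge z 2 (P 0 * T 0)"
      using ord_ge_mono[OF T0, of 2] by (intro ord_ge_scale P) simp
    then have "ord_ge z 2 (P 0 * T 0 - (P 0 * T 0 - (a + of_int 0 * b)))"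
      by (rule ord_ge_diff) (rule ab(3), simp)
    then show ?thesis by simp
  qed
  have T3: "T (- 3) = reflection_factor k * T 0"
  proof -
    have m: "int d * (- 3) = 1 - 4 * int k" using k(3) by simp
    have "T (- 3) = (\<Sum>s\<le>k. reflection_factor k * block_term 0 (k - s))"
      unfolding T_def m by (intro sum.cong refl block_term_reflect) simp
    also have "\<dots> = reflection_factor k * T 0"
      unfolding T_def sum_distrib_left[symmetric]
      using sum.atLeastAtMost_rev[of "block_term 0" 0 k] by (simp add: atMost_atLeast0)
    finally show ?thesis .
  qed
  have "ord_ge z 0 (reflection_factor k)"
  proof -
    have "int d dvd 1 + 4 * int l" by (simp add: d)
    then have f1: "ord_ge z 1 (fac 1 k)"
      by (intro ord_ge_fac_1[of l]) (simp_all add: k_def)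
    have "ord_ge z (- 1) (1 / fac 2 k)"
      using k(2) by (intro ord_ge_inverse_fac_minus_1) simp
    from ord_ge_mult[OF f1 this] have f12: "ord_ge z 0 (fac 1 k * (1 / fac 2 k))" by simp
    have "\<not> int d dvd - 1 + 4 * int j" if "j < k" for j
    proof
      assume *: "int d dvd - 1 + 4 * int j"
      have "int d dvd - 1 + 4 * int k" using k(1) by simp
      from dvd_progression_unique[OF * this] show False
        using that k(2) by simp
    qed
    then have "ord_ge z 0 (1 / fac (- 1) k)"
      by (rule ord_ge_inverse_fac)
    then have "ord_ge z 0 ((1 / fac (- 1) k) ^ 5)"
      using ord_ge_power[of z 0 "1 / fac (- 1) k" 5] by simp
    moreover have "ord_ge z 0 (fac 4 k ^ 5)"
      using ord_ge_power[OF ord_ge_fac[of 4 k], of 5] by simp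
    ultimately have "ord_ge z 0 (- (q powi (1 - 16 * int k)) * (fac 4 k ^ 5 * ((1 / fac (- 1) k) ^ 5 * (fac 1 k * (1 / fac 2 k)))))"
      by (intro ord_ge_scale ord_ge_uminus ord_ge_q_powi f12)
    then show ?thesis
      by (simp add: reflection_factor_def power_divide mult_ac)
  qed
  then have PT3: "ord_ge z 2 (P (- 3) * T (- 3))"
    using ord_ge_mono[OF T0, of 2] unfolding T3 by (intro ord_ge_scale P) simp_all
  have "ord_ge z 2 (P (- 3) * T (- 3) - (P (- 3) * T (- 3) - (a + of_int (- 3) * b)) - a)"
    by (rule ord_ge_diff[OF ord_ge_diff[OF PT3 ab(3)] a]) simp
  \<comment> \<open>The slope is isolated by dividing by the constant - 3, a unit of the local ring.\<close>
  then have b3: "ord_ge z 2 (of_int (- 3) * b)" by simp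
  have p: "poly (- (1 + 1 + 1)) z \<noteq> 0" by simp
  have t: "to_fract (- (1 + 1 + 1)) = (of_int (- 3) :: ratfun)"
    by (simp only: to_fract_uminus to_fract_add to_fract_1) simp
  have three: "(of_int (- 3) :: ratfun) \<noteq> 0"
    unfolding t[symmetric] by simp
  have cancel: "1 / c * (c * b) = b" if "c \<noteq> 0" for c
    using that by simp
  have "ord_ge z 0 (1 / of_int (- 3))"
    using ord_ge_inverse_to_fract[OF p] unfolding t .
  from ord_ge_scale[OF this b3] have b: "ord_ge z 2 b"
    unfolding cancel[OF three] .
  have "ord_ge z 2 ((P M * T M - (a + of_int M * b)) + (a + of_int M * b))"
    by (intro ord_ge_add[OF ab(3)[OF assms(2)]] ord_ge_add[OF a] ord_ge_scale ord_ge_of_int b)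
  then have PT: "ord_ge z 2 (P M * T M)" by simp
  have "ord_ge z (- 1) (1 / P M)"
    using ord_ge_inverse_one_minus_q_powi[of "int d * 1 * M + int d"] by (simp add: P_def)
  from ord_ge_mult[OF this PT] have "ord_ge z 1 (T M)"
    using P_neq_0[OF assms(2)] by simp
  then have "ord_ge z 1 (((\<Sum>s<d. block_term (int d * M) s) - T M) + T M)"
    by (intro ord_ge_add tail) simp_all
  then show ?thesis by simp
qed

text \<open>
  Every period of \<open>d\<close> consecutive factors contains exactly one that vanishes at \<open>z\<close>.
\<close>
lemma ord_ge_fac_multiple:
  "ord_ge z (int u) (fac c (u * d))"
  "ord_ge z (- int u) (1 / fac c (u * d))"
proof (induction u)
  case (Suc u)
  have split: "fac c (Suc u * d) = fac c (u * d) * fac (c + 4 * int (u * d)) d"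
    using fac_add[of c "u * d" d] by (simp add: add.commute)
  have "\<exists>j<d. int d dvd c' + 4 * int j" for c'
  proof -
    have "coprime (2 * 2) (int d)"
      using odd_d by (simp only: coprime_mult_left_iff) simp
    then obtain x y where "x * 4 + y * int d = 1"
      using bezout_int[of 4 "int d"] by (auto simp: coprime_iff_gcd_eq_1)
    then have xy: "1 - 4 * x = y * int d" by simp
    define j where "j = nat ((- c' * x) mod int d)"
    have j: "int j = (- c' * x) mod int d" "j < d"
      using d_gt_1 by (simp_all add: j_def nat_less_iff)
    have "c' + 4 * int j = c' * (1 - 4 * x) - 4 * (- c' * x - int j)"
      by (simp add: algebra_simps)
    moreover have "int d dvd c' * (1 - 4 * x)"
      by (simp add: xy)
    moreover have "int d dvd 4 * (- c' * x - int j)"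
      unfolding j(1) by (intro dvd_mult dvd_minus_mod)
    ultimately have "int d dvd c' + 4 * int j"
      by (metis dvd_diff)
    then show ?thesis
      using j(2) by blast
  qed
  then have "ord_ge z 1 (fac c' d)" for c'
    using ord_ge_fac_1 by blast
  from ord_ge_mult[OF Suc.IH(1) this] show "ord_ge z (int (Suc u)) (fac c (Suc u * d))"
    unfolding split by (simp add: add.commute)
  have "ord_ge z (- 1) (1 / fac c' d)" for c'
    by (rule ord_ge_inverse_fac_minus_1) simp
  from ord_ge_mult[OF Suc.IH(2) this] show "ord_ge z (- int (Suc u)) (1 / fac c (Suc u * d))"
    unfolding split by (simp add: add.commute)
qed simp_all

end

section \<open>The right-hand side of the congruence\<close>

lemma qpoch_double: "qpoch x p (2 * k) = qpoch x (p\<^sup>2) k * qpoch (x * p) (p\<^sup>2) k"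
  by (induction k) (simp_all add: qpoch_Suc mult_ac flip: power_mult)

lemma summand_qpoch:
  "qint (8 * int k - 1)
     * (qpoch (q powi (- 1)) (q ^ 4) k ^ 6 * qpoch (q\<^sup>2) (q\<^sup>2) (2 * k))
     / (qpoch (q ^ 4) (q ^ 4) k ^ 6 * qpoch (q powi (- 1)) (q\<^sup>2) (2 * k))
     * q ^ (8 * k) = summand k"
proof -
  have pw: "(q\<^sup>2)\<^sup>2 = q ^ 4" "q\<^sup>2 * q\<^sup>2 = q powi 4" "q powi (- 1) * q\<^sup>2 = q powi 1"
    by (simp_all add: power_int_minus power2_eq_square power_numeral_reduce)
  have q2: "q\<^sup>2 = q powi 2" by simp
  have a: "qpoch (q\<^sup>2) (q\<^sup>2) (2 * k) = fac 2 k * fac 4 k"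
    unfolding qpoch_double pw by (simp only: qpoch_eq_fac) (simp only: q2 qpoch_eq_fac)
  have b: "qpoch (q powi (- 1)) (q\<^sup>2) (2 * k) = fac (- 1) k * fac 1 k"
    unfolding qpoch_double pw qpoch_eq_fac ..
  have c: "qpoch (q ^ 4) (q ^ 4) k = fac 4 k"
    using qpoch_eq_fac[of 4 k] by simp
  have six: "y ^ 6 = y * y ^ 5" for y :: ratfun
    by (simp flip: power_Suc)
  have "fac 4 k \<noteq> 0" "fac (- 1) k \<noteq> 0"
    by (simp_all add: fac_pos_neq_0 fac_odd_neq_0)
  then show ?thesis
    unfolding a b c qpoch_eq_fac summand_def six by (simp add: mult_ac)
qed

definition A_factor :: "ratfun \<Rightarrow> ratfun" where
  "A_factor x = q * x * (x - 2) * ((x - q) ^ 3 - x / q\<^sup>2 * (1 + q) * (1 - q\<^sup>2)\<^sup>2 * (x - q\<^sup>2))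
     / ((x - q ^ 3) * (x - q)\<^sup>2)"

lemma A_coeff_eq: "A_coeff n = qint (int n) * A_factor (q ^ n)"
proof -
  define x where "x = q ^ n"
  have x: "x \<noteq> 0" by (simp add: x_def)
  have pw: "q powi (1 - int n) = q / x" "q powi (2 - int n) = q\<^sup>2 / x" "q powi (3 - int n) = q ^ 3 / x"
    "q powi (- int n - 2) = 1 / (x * q\<^sup>2)" "q ^ (n + 1) = q * x"
    by (simp_all add: x_def power_int_diff power_int_minus divide_simps)
  have "((1 - q / x) ^ 3 - 1 / (x * q\<^sup>2) * (1 + q) * (1 - q\<^sup>2)\<^sup>2 * (1 - q\<^sup>2 / x)) / ((1 - q ^ 3 / x) * (1 - q / x)\<^sup>2)
     = ((x - q) ^ 3 - x / q\<^sup>2 * (1 + q) * (1 - q\<^sup>2)\<^sup>2 * (x - q\<^sup>2)) / ((x - q ^ 3) * (x - q)\<^sup>2)"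
  proof -
    have one: "1 - c / x = (x - c) / x" for c
      using x by (simp add: field_simps)
    have "(1 - q / x) ^ 3 - 1 / (x * q\<^sup>2) * (1 + q) * (1 - q\<^sup>2)\<^sup>2 * (1 - q\<^sup>2 / x)
       = ((x - q) ^ 3 - x / q\<^sup>2 * (1 + q) * (1 - q\<^sup>2)\<^sup>2 * (x - q\<^sup>2)) / x ^ 3"
      unfolding one[of q] one[of "q\<^sup>2"] power_divide diff_divide_distrib[of "(x - q) ^ 3"]
      using x by (simp add: power3_eq_cube mult_ac)
    moreover have "(1 - q ^ 3 / x) * (1 - q / x)\<^sup>2 = (x - q ^ 3) * (x - q)\<^sup>2 / x ^ 3"
      unfolding one by (simp add: power_divide power2_eq_square power3_eq_cube)
    ultimately show ?thesis using x by simp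
  qed
  then show ?thesis
    unfolding A_coeff_def pw x_def[symmetric] A_factor_def by (simp add: mult_ac)
qed

text \<open>
  The numerators of \<open>A_factor x\<close> and \<open>main_factor x\<close> over a common denominator agree to
  second order at \<open>x = 1\<close>. The cofactor of \<open>(1 - x)^2\<close> is found by polynomial division.
\<close>
lemma A_factor_polynomial_identity:
  fixes x q :: "'a::comm_ring_1"
  shows "x * (x - 2) * (q\<^sup>2 * (x - q) ^ 3 - x * (1 + q) * (1 - q\<^sup>2)\<^sup>2 * (x - q\<^sup>2))
     - (q * (x - q)\<^sup>2 - (q\<^sup>2 - x) * (1 + q) * (1 - x * q)) * (x - q ^ 3)
   = (1 - x)\<^sup>2
    * (- (q ^ 5) + (q\<^sup>2 + q ^ 3 + q ^ 4 - 2 * q ^ 5 + q ^ 6 + q ^ 7) * x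
       + (- 1 - q + 2 * q\<^sup>2 - q ^ 3 - q ^ 4 - q ^ 5) * x\<^sup>2 + q\<^sup>2 * x ^ 3)"
  by (simp add: eval_nat_numeral algebra_simps)

lemma A_factor_minus_main_factor:
  assumes "x \<noteq> q" and "x \<noteq> q ^ 3"
  shows "A_factor x - main_factor x = (1 - x)\<^sup>2
    * (- (q ^ 5) + (q\<^sup>2 + q ^ 3 + q ^ 4 - 2 * q ^ 5 + q ^ 6 + q ^ 7) * x
       + (- 1 - q + 2 * q\<^sup>2 - q ^ 3 - q ^ 4 - q ^ 5) * x\<^sup>2 + q\<^sup>2 * x ^ 3)
    / (q * (x - q ^ 3) * (x - q)\<^sup>2)"
proof -
  have nz: "(x - q)\<^sup>2 \<noteq> 0" "x - q ^ 3 \<noteq> 0" using assms by auto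
  define c where "c = (x - q)\<^sup>2"
  define b where "b = x - q ^ 3"
  have bc: "c \<noteq> 0" "b \<noteq> 0" using nz by (simp_all add: b_def c_def)
  have r: "A_factor x = x * (x - 2) * (q\<^sup>2 * (x - q) ^ 3 - x * (1 + q) * (1 - q\<^sup>2)\<^sup>2 * (x - q\<^sup>2)) / (q * b * c)"
  proof -
    have "q\<^sup>2 * ((x - q) ^ 3 - x / q\<^sup>2 * (1 + q) * (1 - q\<^sup>2)\<^sup>2 * (x - q\<^sup>2))
       = q\<^sup>2 * (x - q) ^ 3 - x * (1 + q) * (1 - q\<^sup>2)\<^sup>2 * (x - q\<^sup>2)"
      by (simp add: right_diff_distrib)
    moreover have "q * x * (x - 2) * B = x * (x - 2) * (q\<^sup>2 * B) / q" for B
      by (simp add: power2_eq_square)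
    ultimately have "q * x * (x - 2) * ((x - q) ^ 3 - x / q\<^sup>2 * (1 + q) * (1 - q\<^sup>2)\<^sup>2 * (x - q\<^sup>2))
      = x * (x - 2) * (q\<^sup>2 * (x - q) ^ 3 - x * (1 + q) * (1 - q\<^sup>2)\<^sup>2 * (x - q\<^sup>2)) / q"
      by (simp only:)
    then show ?thesis
      unfolding A_factor_def c_def[symmetric] b_def[symmetric] by (simp add: mult_ac)
  qed
  have m: "main_factor x = (q * c - (q\<^sup>2 - x) * (1 + q) * (1 - x * q)) * b / (q * b * c)"
    unfolding main_factor_def c_def[symmetric] using bc by (simp add: divide_simps)
  show ?thesis
    unfolding r m c_def[symmetric] b_def[symmetric] diff_divide_distrib[symmetric]
    by (rule arg_cong[where f = "\<lambda>u. u / (q * b * c)"]) (unfold b_def c_def, rule A_factor_polynomial_identity)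
qed

context odd_root_of_unity
begin

lemma block_sum:
  assumes "M \<noteq> - 1"
  shows "ord_ge z 1 (\<Sum>s<d. block_term (int d * M) s)"
proof -
  have "d mod 4 = 1 \<or> d mod 4 = 3" using odd_d by presburger
  then show ?thesis
    using block_sum_mod_4_eq_1[OF _ assms] block_sum_mod_4_eq_3[OF _ assms] by blast
qed

lemma ord_ge_block_scale: "ord_ge z 0 (block_scale (u * d))"
proof -
  have "ord_ge z (5 * int u) (fac (- 1) (u * d) ^ 5)" "ord_ge z (- 5 * int u) ((1 / fac 4 (u * d)) ^ 5)"
    using ord_ge_power[OF ord_ge_fac_multiple(1)[where c = "- 1" and u = u], of 5]
      ord_ge_power[OF ord_ge_fac_multiple(2)[where c = 4 and u = u], of 5] by simp_all
  then have "ord_ge z (5 * int u + - 5 * int u) (fac (- 1) (u * d) ^ 5 * (1 / fac 4 (u * d)) ^ 5)"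
    by (rule ord_ge_mult)
  then have 1: "ord_ge z 0 (fac (- 1) (u * d) ^ 5 * (1 / fac 4 (u * d)) ^ 5)" by simp
  have "ord_ge z (int u + - int u) (fac 2 (u * d) * (1 / fac 1 (u * d)))"
    by (intro ord_ge_mult ord_ge_fac_multiple)
  then have 2: "ord_ge z 0 (fac 2 (u * d) * (1 / fac 1 (u * d)))" by simp
  have 3: "ord_ge z 0 (1 / (1 - q))"
    using ord_ge_inverse_one_minus_q_powi[of 1] d_gt_1 by simp
  have 4: "ord_ge z 0 (q ^ (8 * (u * d)))"
    using ord_ge_q_powi[of "int (8 * (u * d))"] unfolding power_int_of_nat .
  have "block_scale (u * d) = (fac (- 1) (u * d) ^ 5 * (1 / fac 4 (u * d)) ^ 5) * (fac 2 (u * d) * (1 / fac 1 (u * d)))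
      * (q ^ (8 * (u * d)) * (1 / (1 - q)))"
    by (simp add: block_scale_def power_divide)
  also have "ord_ge z 0 \<dots>"
    by (rule ord_ge_scale[OF ord_ge_scale[OF 1 2] ord_ge_scale[OF 4 3]])
  finally show ?thesis .
qed

lemma ord_ge_summand_sum: "ord_ge z 1 (\<Sum>k<m * d. summand k)"
proof -
  have "(\<Sum>k<m * d. summand k) = (\<Sum>u<m. \<Sum>k = u * d..<u * d + d. summand k)"
    by (rule sum.nat_group[symmetric])
  also have "\<dots> = (\<Sum>u<m. block_scale (u * d) * (\<Sum>s<d. block_term (int d * (4 * int u)) s))"
  proof (rule sum.cong[OF refl])
    fix u
    have "(\<Sum>k = u * d..<u * d + d. summand k) = (\<Sum>s<d. summand (u * d + s))"
      using sum.shift_bounds_nat_ivl[of summand 0 "u * d" d] by (simp add: atLeast0LessThan add.commute)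
    also have "\<dots> = block_scale (u * d) * (\<Sum>s<d. block_term (int d * (4 * int u)) s)"
      unfolding summand_add sum_distrib_left by (simp add: mult_ac)
    finally show "(\<Sum>k = u * d..<u * d + d. summand k) = block_scale (u * d) * (\<Sum>s<d. block_term (int d * (4 * int u)) s)" .
  qed
  also have "ord_ge z 1 \<dots>"
  proof (rule ord_ge_sum)
    fix u
    have "4 * int u \<noteq> - 1" by presburger
    then show "ord_ge z 1 (block_scale (u * d) * (\<Sum>s<d. block_term (int d * (4 * int u)) s))"
      by (intro ord_ge_scale[OF ord_ge_block_scale block_sum])
  qed
  finally show ?thesis .
qed

lemma ord_ge_fac_quotient: "ord_ge z 0 (fac 2 N / fac 4 N)"
proof -
  define u where "u = N div d"
  define s where "s = N mod d"
  have N: "N = u * d + s" by (simp add: u_def s_def)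
  have s: "s < d" using d_gt_1 by (simp add: s_def)
  define W where "W = fac 2 (u * d) * (1 / fac 4 (u * d))"
  have "ord_ge z (int u + - int u) W"
    unfolding W_def by (intro ord_ge_mult ord_ge_fac_multiple)
  moreover have "ord_ge z 0 (1 / fac (4 + 4 * int (u * d)) s)"
    by (rule ord_ge_inverse_fac) (rule not_dvd_first_period[OF _ _ s], simp)
  ultimately have "ord_ge z 0 (fac (2 + 4 * int (u * d)) s * ((1 / fac (4 + 4 * int (u * d)) s) * W))"
    by (intro ord_ge_scale ord_ge_fac) simp_all
  then show ?thesis
    unfolding N fac_add by (simp add: W_def mult_ac)
qed

text \<open>
  The factor \<open>(1 - x)^2\<close> contributes a double zero. Of the denominators only \<open>x - q^3\<close> can
  vanish at \<open>z\<close>, namely if \<open>d\<close> divides 3.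
\<close>
lemma A_factor_diff:
  assumes "d dvd n" and "n > 3"
  shows "ord_ge z (if d dvd 3 then 1 else 2) (A_factor (q ^ n) - main_factor (q ^ n))"
proof -
  define x where "x = q ^ n"
  have q: "ord_ge z 0 q" "ord_ge z 0 (1 / q)"
    using ord_ge_q_powi[of 1] ord_ge_q_powi[of "- 1"] by (simp_all add: power_int_minus field_simps)
  have qp: "ord_ge z 0 (q ^ i)" for i
    using ord_ge_q_powi[of "int i"] unfolding power_int_of_nat .
  have inv: "x - q ^ j = - (q ^ j * (1 - q ^ (n - j)))" "x \<noteq> q ^ j"
    "ord_ge z (if d dvd j then - 1 else 0) (1 / (x - q ^ j))" if "j < n" for j
  proof -
    have xj: "x = q ^ j * q ^ (n - j)"
      using that by (simp add: x_def flip: power_add)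
    then show eq: "x - q ^ j = - (q ^ j * (1 - q ^ (n - j)))"
      by (simp add: algebra_simps)
    have nz: "1 - q ^ (n - j) \<noteq> 0"
      using that q_power_eq_1_iff[of "n - j"] by auto
    then show "x \<noteq> q ^ j" using eq by auto
    have dd: "d dvd n - j \<longleftrightarrow> d dvd j"
      using assms(1) that by (metis dvd_diff_nat diff_diff_cancel less_imp_le)
    have "ord_ge z (if d dvd j then - 1 else 0) (1 / (1 - q ^ (n - j)))"
      using ord_ge_inverse_one_minus_q_power[of "n - j"] that unfolding dd by simp
    moreover have "ord_ge z 0 (- ((1 / q) ^ j))"
      using ord_ge_power[OF q(2), of j] by (intro ord_ge_uminus) simp
    ultimately have "ord_ge z (if d dvd j then - 1 else 0) (- ((1 / q) ^ j) * (1 / (1 - q ^ (n - j))))"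
      by (intro ord_ge_scale)
    then show "ord_ge z (if d dvd j then - 1 else 0) (1 / (x - q ^ j))"
      unfolding eq by (simp add: power_divide)
  qed
  have "\<not> d dvd 1" using d_gt_1 by simp
  then have i1: "ord_ge z 0 (1 / (x - q))"
    using inv(3)[of 1] assms(2) by simp
  define G where "G = - (q ^ 5) + (q\<^sup>2 + q ^ 3 + q ^ 4 - 2 * q ^ 5 + q ^ 6 + q ^ 7) * x
       + (- 1 - q + 2 * q\<^sup>2 - q ^ 3 - q ^ 4 - q ^ 5) * x\<^sup>2 + q\<^sup>2 * x ^ 3"
  have xi: "ord_ge z 0 (x ^ i)" for i
    unfolding x_def power_mult[symmetric] by (rule qp)
  have two: "ord_ge z 0 2"
    using ord_ge_of_int[of z 2] by simp
  have G: "ord_ge z 0 G"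
    unfolding G_def
    using xi[of 1] by (intro ord_ge_add ord_ge_diff ord_ge_scale ord_ge_uminus qp xi two q ord_ge_1) simp_all
  have "ord_ge z 1 (1 - x)"
    unfolding x_def by (rule ord_ge_one_minus_q_power[OF assms(1)])
  from ord_ge_power[OF this, of 2] have x2: "ord_ge z 2 ((1 - x)\<^sup>2)" by simp
  have "ord_ge z (2 + (if d dvd 3 then - 1 else 0)) ((1 - x)\<^sup>2 * (1 / (x - q ^ 3)))"
    by (intro ord_ge_mult x2 inv(3)) (use assms(2) in simp)
  moreover have "2 + (if d dvd 3 then - 1 else 0) = (if d dvd 3 then 1 else 2 :: int)" by simp
  ultimately have "ord_ge z (if d dvd 3 then 1 else 2) ((1 - x)\<^sup>2 * (1 / (x - q ^ 3)))"
    by (simp only:)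
  then have "ord_ge z (if d dvd 3 then 1 else 2)
     (G * ((1 / q) * ((1 / (x - q)) * ((1 / (x - q)) * ((1 - x)\<^sup>2 * (1 / (x - q ^ 3)))))))"
    by (rule ord_ge_scale[OF G ord_ge_scale[OF q(2) ord_ge_scale[OF i1 ord_ge_scale[OF i1]]]])
  moreover have "x \<noteq> q" "x \<noteq> q ^ 3"
    using inv(2)[of 1] inv(2)[of 3] assms(2) by simp_all
  then have "A_factor x - main_factor x
      = G * ((1 / q) * ((1 / (x - q)) * ((1 / (x - q)) * ((1 - x)\<^sup>2 * (1 / (x - q ^ 3))))))"
    unfolding A_factor_minus_main_factor[OF \<open>x \<noteq> q\<close> \<open>x \<noteq> q ^ 3\<close>] G_def[symmetric]
    by (simp add: power2_eq_square[of "x - q"] mult_ac)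
  ultimately show ?thesis
    unfolding x_def[symmetric] by (simp only:)
qed

end

section \<open>From orders of vanishing to divisibility\<close>

definition unity_root :: "nat \<Rightarrow> nat \<Rightarrow> complex" where
  "unity_root n k = cis (2 * pi * real k / real n)"

lemma unity_root_power_eq_1_iff:
  assumes "n > 0"
  shows "unity_root n k ^ m = 1 \<longleftrightarrow> n dvd k * m"
proof -
  define w where "w = unity_root n 1"
  have pow: "w ^ i = unity_root n i" for i
    by (simp add: w_def unity_root_def DeMoivre mult_ac)
  have wn: "w ^ n = 1"
    using assms by (simp add: pow unity_root_def)
  have "w ^ i = w ^ (i mod n)" for i
    by (metis div_mult_mod_eq mult.commute mult_1 power_add power_mult power_one wn)
  moreover have "w ^ r = 1 \<longleftrightarrow> r = 0" if "r < n" for r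
  proof -
    have "inj_on (unity_root n) {..<n}"
      using bij_betw_roots_unity[OF assms] by (simp add: bij_betw_def unity_root_def[abs_def])
    then have "unity_root n r = unity_root n 0 \<longleftrightarrow> r = 0"
      using that assms by (auto dest: inj_onD)
    then show ?thesis
      by (simp add: pow unity_root_def)
  qed
  ultimately have "w ^ i = 1 \<longleftrightarrow> n dvd i" for i
    using assms by (metis dvd_eq_mod_eq_0 mod_less_divisor)
  then show ?thesis
    by (metis pow power_mult)
qed

lemma odd_root_of_unity_unity_root:
  assumes "odd n" and "0 < k" and "k < n"
  shows "odd_root_of_unity (unity_root n k) (n div gcd n k)"
proof
  define g where "g = gcd n k"
  have g: "g > 0" "g dvd n" "g dvd k" using assms by (simp_all add: g_def)
  have n: "n = g * (n div g)" and k: "k = g * (k div g)" using g by simp_all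
  have cop: "coprime (n div g) (k div g)"
    unfolding g_def by (rule div_gcd_coprime) (use assms in auto)
  show "odd (n div gcd n k)"
    using assms(1) n unfolding g_def[symmetric] by (metis even_mult_iff)
  have "g \<le> k" using g assms(2) by (simp add: dvd_imp_le)
  then have "n div g \<noteq> 1" using n assms(3) by (metis mult.right_neutral not_le)
  moreover have "n div g \<noteq> 0" using n assms(3) by (metis mult_0_right not_less_zero)
  ultimately show "n div gcd n k > 1" unfolding g_def[symmetric] by linarith
  fix m
  have "n dvd k * m \<longleftrightarrow> g * (n div g) dvd g * (k div g * m)"
    using n k by (metis mult.assoc)
  also have "\<dots> \<longleftrightarrow> n div g dvd m"
    using g(1) cop by (simp add: coprime_dvd_mult_right_iff)
  finally show "unity_root n k ^ m = 1 \<longleftrightarrow> n div gcd n k dvd m"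
    using unity_root_power_eq_1_iff[of n k m] assms by (simp add: g_def)
qed

text \<open>
  The polynomial \<open>X^n - 1 = (X - 1) qint_poly n\<close> is squarefree and hence the product of
  \<open>X - w\<close> over its roots.
\<close>
lemma qint_poly_factorization:
  assumes "n > 0"
  shows "qint_poly n = (\<Prod>k\<in>{0<..<n}. [:- unity_root n k, 1:])"
proof -
  let ?X = "[:0, 1:] :: complex poly"
  let ?p = "?X ^ n - 1"
  have roots: "{w. poly ?p w = 0} = {w. w ^ n = 1}" by auto
  have "rsquarefree ?p"
    unfolding rsquarefree_roots
  proof (intro allI notI)
    fix a assume a: "poly ?p a = 0 \<and> poly (pderiv ?p) a = 0"
    then have "a \<noteq> 0" using assms by (auto simp: power_0_left)
    moreover have "poly (pderiv ?p) a = of_nat n * a ^ (n - 1)"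
      by (simp add: pderiv_diff pderiv_power pderiv_pCons)
    ultimately show False using a assms by auto
  qed
  moreover have "lead_coeff ?p = 1"
  proof -
    have X: "?X ^ n = monom 1 n" by (simp add: monom_altdef)
    have "degree (monom 1 n + (- 1) :: complex poly) = degree (monom 1 n :: complex poly)"
      using assms by (intro degree_add_eq_left) (simp add: degree_monom_eq)
    then have "degree ?p = n" by (simp add: X degree_monom_eq)
    then show ?thesis using assms by (simp add: X)
  qed
  ultimately have "?p = (\<Prod>w | w ^ n = 1. [:-w, 1:])"
    using complex_poly_decompose_rsquarefree[of ?p] by (simp add: roots)
  also have "\<dots> = (\<Prod>k<n. [:- unity_root n k, 1:])"
    using prod.reindex_bij_betw[OF bij_betw_roots_unity[OF assms], of "\<lambda>w. [:-w, 1:]"]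
    by (simp add: unity_root_def)
  also have "{..<n} = insert 0 {0<..<n}" using assms by auto
  also have "(\<Prod>k\<in>insert 0 {0<..<n}. [:- unity_root n k, 1:]) = (?X - 1) * (\<Prod>k\<in>{0<..<n}. [:- unity_root n k, 1:])"
    by (simp add: unity_root_def one_pCons)
  finally have "(?X - 1) * qint_poly n = (?X - 1) * (\<Prod>k\<in>{0<..<n}. [:- unity_root n k, 1:])"
    by (simp add: qint_poly_def power_diff_1_eq)
  moreover have "?X - 1 \<noteq> 0" by (simp add: one_pCons)
  ultimately show ?thesis by simp
qed

lemma cyclotomic_eq:
  assumes "n > 1"
  shows "cyclotomic n = (\<Prod>k\<in>{0<..<n}. if coprime n k then [:- unity_root n k, 1:] else 1)"
proof -
  have "{k. 1 \<le> k \<and> k \<le> n \<and> coprime n k} = {k \<in> {0<..<n}. coprime n k}"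
  proof (rule Collect_cong)
    fix k
    show "1 \<le> k \<and> k \<le> n \<and> coprime n k \<longleftrightarrow> k \<in> {0<..<n} \<and> coprime n k"
      using assms by (cases "k = n") auto
  qed
  moreover have "exp (2 * complex_of_real pi * \<i> * of_nat k / of_nat n) = unity_root n k" for k
    by (simp add: unity_root_def cis_conv_exp mult_ac)
  ultimately show ?thesis
    unfolding cyclotomic_def by (simp only: prod.inter_filter finite_greaterThanLessThan)
qed

lemma prod_dvd_if_coprime:
  fixes f :: "'b \<Rightarrow> 'a::semiring_gcd"
  assumes "finite K" and "\<And>k. k \<in> K \<Longrightarrow> f k dvd c"
    and "\<And>k l. k \<in> K \<Longrightarrow> l \<in> K \<Longrightarrow> k \<noteq> l \<Longrightarrow> coprime (f k) (f l)"
  shows "(\<Prod>k\<in>K. f k) dvd c"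
  using assms
proof (induction K rule: finite_induct)
  case (insert k K)
  then have "coprime (f k) (\<Prod>l\<in>K. f l)"
    by (intro prod_coprime_right) (metis insertCI)
  with insert show ?case by (simp add: divides_mult)
qed simp

lemma coprime_linear_powers:
  assumes "a \<noteq> b"
  shows "coprime ([:-a, 1:] ^ i) ([:-b, 1:] ^ j :: complex poly)"
proof -
  have "prime_elem [:-a, 1:]" by (rule prime_elem_linear_field_poly) simp
  then have "coprime [:-a, 1:] [:-b, 1:]"
    using assms by (intro prime_elem_imp_coprime) (auto simp flip: poly_eq_0_iff_dvd)
  then show ?thesis by simp
qed

text \<open>
  The modulus is the product of \<open>(X - w)^3\<close> over the primitive and of \<open>X - w\<close> over the other
  \<open>n\<close>-th roots \<open>w \<noteq> 1\<close> of unity, and these factors are pairwise coprime.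
\<close>
lemma ratfun_cong_if_ord_ge:
  assumes "n > 1"
    and 1: "\<And>k. 0 < k \<Longrightarrow> k < n \<Longrightarrow> ord_ge (unity_root n k) 1 (A - B)"
    and 3: "\<And>k. 0 < k \<Longrightarrow> k < n \<Longrightarrow> coprime n k \<Longrightarrow> ord_ge (unity_root n k) 3 (A - B)"
  shows "ratfun_cong A B (qint_poly n * cyclotomic n ^ 2)"
proof -
  have "qint_poly n * cyclotomic n ^ 2
      = (\<Prod>k\<in>{0<..<n}. [:- unity_root n k, 1:] ^ (if coprime n k then 3 else 1))"
    using assms(1)
    by (auto simp: qint_poly_factorization cyclotomic_eq power2_eq_square power3_eq_cube mult.assoc
        simp flip: prod.distrib intro!: prod.cong)
  also have "\<dots> dvd fst (quot_of_fract (A - B))"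
  proof (rule prod_dvd_if_coprime)
    fix k assume "k \<in> {0<..<n}"
    then show "[:- unity_root n k, 1:] ^ (if coprime n k then 3 else 1) dvd fst (quot_of_fract (A - B))"
      using 1[of k] 3[of k] dvd_numerator_of_ord_ge[of "unity_root n k" 1] dvd_numerator_of_ord_ge[of "unity_root n k" 3]
      by auto
  next
    fix k l assume "k \<in> {0<..<n}" "l \<in> {0<..<n}" "k \<noteq> l"
    moreover have "inj_on (unity_root n) {..<n}"
      using bij_betw_roots_unity[of n] assms(1) by (simp add: bij_betw_def unity_root_def[abs_def])
    ultimately have "unity_root n k \<noteq> unity_root n l"
      by (auto dest: inj_onD)
    then show "coprime ([:- unity_root n k, 1:] ^ (if coprime n k then 3 else 1))
        ([:- unity_root n l, 1:] ^ (if coprime n l then 3 else 1))"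
      by (rule coprime_linear_powers)
  qed simp
  finally show ?thesis
    by (simp add: ratfun_cong_def)
qed

theorem theorem1p3:
  fixes n :: nat
  assumes "odd n" and "n > 3"
  shows "ratfun_cong
    (\<Sum>k = 0..n - 1.
        qint (8 * int k - 1)
        * (qpoch (q powi (- 1)) (q ^ 4) k ^ 6 * qpoch (q\<^sup>2) (q\<^sup>2) (2 * k))
        / (qpoch (q ^ 4) (q ^ 4) k ^ 6 * qpoch (q powi (- 1)) (q\<^sup>2) (2 * k))
        * q ^ (8 * k))
    (if n mod 4 = 1 then 0
     else A_coeff n * (qpoch (q\<^sup>2) (q ^ 4) ((n + 1) div 4) ^ 2
                       / qpoch (q ^ 4) (q ^ 4) ((n + 1) div 4) ^ 2))
    (qint_poly n * cyclotomic n ^ 2)"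
proof -
  define S where "S = (\<Sum>k<n. summand k)"
  define N where "N = (n + 1) div 4"
  define R where "R = (if n mod 4 = 1 then 0 else qint (int n) * (fac 2 N / fac 4 N) ^ 2 * A_factor (q ^ n))"
  have range: "{0..n - 1} = {..<n}" using assms(2) by auto
  have rhs: "(if n mod 4 = 1 then 0
     else A_coeff n * (qpoch (q\<^sup>2) (q ^ 4) ((n + 1) div 4) ^ 2
                       / qpoch (q ^ 4) (q ^ 4) ((n + 1) div 4) ^ 2)) = R"
    using qpoch_eq_fac[of 2] qpoch_eq_fac[of 4] by (simp add: R_def N_def A_coeff_eq power_divide)
  have "ratfun_cong S R (qint_poly n * cyclotomic n ^ 2)"
  proof (rule ratfun_cong_if_ord_ge)
    show "n > 1" using assms(2) by simp
  next
    fix k assume k: "0 < k" "k < n"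
    define z where "z = unity_root n k"
    define d where "d = n div gcd n k"
    interpret odd_root_of_unity z d
      unfolding z_def d_def by (rule odd_root_of_unity_unity_root[OF assms(1) k])
    have "n = d * gcd n k" by (simp add: d_def)
    then have dvd: "d dvd n" by (rule dvdI)
    then obtain m where m: "n = m * d" by (metis dvdE mult.commute)
    have S: "ord_ge z 1 S"
      unfolding S_def m by (rule ord_ge_summand_sum)
    have rhs_split: "qint (int n) * (fac 2 N / fac 4 N) ^ 2 * A_factor (q ^ n)
       = (fac 2 N / fac 4 N) ^ 2 * (A_factor (q ^ n) * qint (int n))"
      by (simp add: mult_ac)
    have sq: "ord_ge z 0 ((fac 2 N / fac 4 N) ^ 2)"
      using ord_ge_power[OF ord_ge_fac_quotient[of N], of 2] by simp
    have qn: "ord_ge z 1 (qint (int n))"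
      using dvd by (intro ord_ge_qint) simp
    have main: "ord_ge z 0 (main_factor (q ^ n))"
      using ord_ge_main_factor[of "int n"] dvd by simp
    have "ord_ge z 0 (A_factor (q ^ n) - main_factor (q ^ n))"
      by (rule ord_ge_mono[OF A_factor_diff[OF dvd assms(2)]]) simp
    from ord_ge_add[OF this main] have "ord_ge z 0 (A_factor (q ^ n))" by simp
    then have "ord_ge z 1 R"
      unfolding R_def rhs_split using sq qn by (auto intro: ord_ge_scale)
    with S show "ord_ge (unity_root n k) 1 (S - R)"
      unfolding z_def by (rule ord_ge_diff)
    assume "coprime n k"
    then have d: "d = n" by (simp add: d_def)
    show "ord_ge (unity_root n k) 3 (S - R)"
    proof (cases "n mod 4 = 1")
      case True
      then show ?thesis
        using first_period_sum_mod_4_eq_1 by (simp add: d S_def R_def z_def)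
    next
      case False
      then have N: "4 * int N = int n + 1" "N > 0" "N < d"
        using assms unfolding N_def d by presburger+
      define R' where "R' = qint (int n) * (fac 2 N / fac 4 N) ^ 2 * main_factor (q ^ n)"
      have 1: "ord_ge z 3 (S - R')"
        using first_period_sum[OF N] by (simp add: d S_def R'_def)
      have "\<not> d dvd 3" using assms(2) by (auto simp: d dest: dvd_imp_le)
      then have "ord_ge z 2 (A_factor (q ^ n) - main_factor (q ^ n))"
        using A_factor_diff[OF dvd assms(2)] by simp
      from ord_ge_scale[OF sq ord_ge_mult[OF qn this]]
      have 2: "ord_ge z 3 ((fac 2 N / fac 4 N) ^ 2 * (qint (int n) * (A_factor (q ^ n) - main_factor (q ^ n))))" by simp
      have eq: "S - R = (S - R') - (fac 2 N / fac 4 N) ^ 2 * (qint (int n) * (A_factor (q ^ n) - main_factor (q ^ n)))"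
        using False by (simp add: R_def R'_def algebra_simps)
      show ?thesis
        using ord_ge_diff[OF 1 2] unfolding eq[symmetric] z_def .
    qed
  qed
  then show ?thesis
    unfolding range summand_qpoch rhs S_def .
qed

end
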